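(* Let $H=\mathcal B\#\Bbbk\Gamma$ be a pointed Hopf algebra, where $\Gamma$ is a group and $\mathcal B$ is a pre-Nichols algebra of a finite-dimensional Yetter-Drinfeld module $V$ over $\Gamma$ with basis $(x_i)_{1\le i\le\theta}$ and coactions $x_i\mapsto g_i\otimes x_i$, $g_i\in\Gamma$. An associative $G$-zesting datum $(\gamma,\lambda,\omega)$ for $H$ is determined by the following choices: 1. A grading group $G$ chosen via a surjective group homomorphism $\iota:\Gamma/\mathrm{supp}(V)\to G$; write also $\iota:\Gamma\to G$ for the composite with $\Gamma\to\Gamma/\mathrm{supp}(V)$. 2. A pair $(\Gamma_0,\Phi)$, where $\Gamma_0$ is a subgroup of $\ker(\iota:\Gamma\to G)$ that is central in $\Gamma$, and $\Phi:\Gamma_0\to\widehat\Gamma$ is a group homomorphism such that $g\cdot x_i=\langle g_i,\Phi(g)\rangle x_i$ for all $g\in\Gamma_0$ and $1\le i\le\theta$, thus determining a relative $r$-form via the map $\gamma:\Gamma_0\to\mathrm{Alg}(H,\Bbbk)$. 3. A normalized 2-cocycle $\lambda:G\times G\to\Gamma_0$. 4. A normalized 3-cochain $\omega:G\times G\times G\to\Bbbk^\times$ satisfying, for all $g_1,g_2,g_3,g_4\in G$, $$\langle\gamma(\lambda(g_1,g_2)),\lambda(g_3,g_4)\rangle=\frac{\omega(g_1,g_2,g_3)\,\omega(g_1,g_2g_3,g_4)\,\omega(g_2,g_3,g_4)}{\omega(g_1g_2,g_3,g_4)\,\omega(g_1,g_2,g_3g_4)}.$$ Given such a valid datum $(\gamma,\lambda,\omega)$,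 the resulting coquasi-Hopf algebra $H^\lambda$ shares the same underlying coalgebra structure as $H$. Its multiplication $m^\lambda$ and associator $\Omega$ are given by $$m^\lambda\big((x\#g)\otimes(y\#h)\big)=x(g\cdot y)\,\#\,gh\,\lambda(\iota(g),\iota(h)),$$ $$\Omega(x\#g,\,y\#h,\,z\#k)=\varepsilon(x)\varepsilon(y)\varepsilon(z)\,\omega(\iota(g),\iota(h),\iota(k))\,\langle\gamma(\lambda(\iota(g),\iota(h))),k\rangle$$ for $x,y,z\in\mathcal B$ and $g,h,k\in\Gamma$, where $\varepsilon$ is the counit.
   Context: $\Bbbk$ is a field; $\widehat\Gamma=\mathrm{Hom}(\Gamma,\Bbbk^\times)$; Sweedler notation is used. $V$ is an object of the category of left-left Yetter-Drinfeld modules over $\Bbbk\Gamma$, with action written $g\cdot v$. A pre-Nichols algebra $\mathcal B$ of $V$ is an intermediate graded Hopf algebra, in this braided category, between the tensor algebra $T(V)$ and the Nichols algebra $\mathcal B(V)$ (a graded Hopf quotient of $T(V)$ that surjects onto $\mathcal B(V)$). In the bosonization $H=\mathcal B\#\Bbbk\Gamma$ one has $\Delta(x_i)=x_i\otimes1+g_i\otimes x_i$, and elements of $\Gamma$ are group-like; $g\cdot x_i=gx_ig^{-1}$ in $H$. The support $\mathrm{supp}(V)$ is the (normal) subgroup of $\Gamma$ generated by $g_1,\dots,g_\theta$. A homomorphism $\iota$ as in choice 1 gives the cocentral Hopf epimorphism $\pi:H\to\Bbbk G$, $\pi(x\#g)=\varepsilon(x)\iota(g)$; cocentral means $h_{(1)}\otimes\pi(h_{(2)})=h_{(2)}\otimes\pi(h_{(1)})$.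 Put $H_s=\{h\in H:(\pi\otimes\mathrm{id})\Delta(h)=s\otimes h\}$, so $H=\bigoplus_{s\in G}H_s$, and $H^{\mathrm{co}\,\pi}=H_e$. **Relative $r$-form and $\gamma$.** For a Hopf subalgebra $K\subset H$, a relative $r$-form is a linear map $r:H\otimes K\to\Bbbk$ with $r(hh',k)=r(h',k_{(1)})r(h,k_{(2)})$, $r(h,kk')=r(h_{(1)},k)r(h_{(2)},k')$, $r(h,1)=\varepsilon(h)$, $r(1,k)=\varepsilon(k)$ and $r(h_{(1)},k_{(1)})k_{(2)}h_{(2)}=h_{(1)}k_{(1)}r(h_{(2)},k_{(2)})$. Here $K=\Bbbk\Gamma_0$, and $r$ corresponds to $\gamma$ by $r(h,g)=\langle\gamma(g),h\rangle$. The map $\gamma$ associated with $\Phi$ is the one with $\langle\gamma(g),x\#h\rangle=\varepsilon(x)\langle h,\Phi(g)\rangle$ for $g\in\Gamma_0$, $x\in\mathcal B$, $h\in\Gamma$. **Associative $G$-zesting datum for a Hopf algebra $H$ with a surjective cocentral $\pi:H\to\Bbbk G$.** Given a subgroup $\Gamma_0$ of the group $G(H^{\mathrm{co}\,\pi})$ of group-likes, a triple $(\gamma,\lambda,\omega)$ where: $\gamma:\Gamma_0\to\mathrm{Alg}(H,\Bbbk)$ is a group homomorphism to the group of algebra maps $H\to\Bbbk$ under convolution, with $\langle\gamma(g),h_{(1)}\rangle\,g h_{(2)}g^{-1}=h_{(1)}\langle\gamma(g),h_{(2)}\rangle$ for all $g\in\Gamma_0$, $h\in H$; $\lambda:G\times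 G\to\Gamma_0$ is a normalized 2-cocycle (trivial action), i.e. $\lambda(g_1,g_2)\lambda(g_1g_2,g_3)=\lambda(g_2,g_3)\lambda(g_1,g_2g_3)$ and $\lambda(g,e)=\lambda(e,g)=1$; $\omega:G^3\to\Bbbk^\times$ is a normalized 3-cochain (value $1$ if some argument is $e$) satisfying the displayed identity in choice 4. **The coquasi-Hopf algebra $H^\lambda$.** It is the coalgebra $H$ with unit $1_H$, multiplication $h\otimes k\mapsto hk\,\lambda(s_1,s_2)$ and associator $\Omega(h,k,l)=\varepsilon(hk)\omega(s_1,s_2,s_3)\langle\gamma(\lambda(s_1,s_2)),l\rangle$ for $h\in H_{s_1}$, $k\in H_{s_2}$, $l\in H_{s_3}$. **Coquasi-Hopf algebra.** A coalgebra with coalgebra maps $m$ (multiplication), $u$ (unit) and a convolution invertible $\Omega\in(H^{\otimes3})^*$ such that $(h_{(1)}k_{(1)})l_{(1)}\Omega(h_{(2)},k_{(2)},l_{(2)})=\Omega(h_{(1)},k_{(1)},l_{(1)})h_{(2)}(k_{(2)}l_{(2)})$; $1h=h1=h$; $\Omega(h_{(1)}k_{(1)},l_{(1)},t_{(1)})\Omega(h_{(2)},k_{(2)},l_{(2)}t_{(2)})=\Omega(h_{(1)},k_{(1)},l_{(1)})\Omega(h_{(2)},k_{(2)}l_{(2)},t_{(1)})\Omega(k_{(3)},l_{(3)},t_{(2)})$; $\Omega(h,1,k)=\varepsilon(h)\varepsilon(k)$; together with a linear map $S:H\to H$ and $\alpha,\beta\in H^*$ such that $S(h_{(1)})\alpha(h_{(2)})h_{(3)}=\alpha(h)1$,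 $h_{(1)}\beta(h_{(2)})S(h_{(3)})=\beta(h)1$, and $\Omega(h_{(1)}\beta(h_{(2)}),S(h_{(3)}),\alpha(h_{(4)})h_{(5)})=\Omega^{-1}(S(h_{(1)}),\alpha(h_{(2)})h_{(3)}\beta(h_{(4)}),S(h_{(5)}))=\varepsilon(h)$.
   Formalization: Conventions corrected: the condition on γ reads ⟨γ(g),h1⟩g⁻¹h2g = h1⟨γ(g),h2⟩, the r-form rule r(h1,k1)h2k2 = k1h1r(h2,k2), and Ω, Ω⁻¹ are exchanged in the last antipode axiom; as given these fail unless ⟨g_i,Φ(g)⟩²=1. *)

theory Defs
  imports Complex_Main "HOL-Algebra.Generated_Groups" "HOL-Library.Poly_Mapping"
begin

section \<open>Multilinear maps and tensors\<close>

abbreviation keys where "keys \<equiv> Poly_Mapping.keys"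
abbreviation lookup where "lookup \<equiv> Poly_Mapping.lookup"
abbreviation single where "single \<equiv> Poly_Mapping.single"

text \<open>
  Vector spaces over a field are given by a scalar multiplication on a type together with a
  carrier, which is a linear subspace of the type.
\<close>

definition vec_sp :: "'a set \<Rightarrow> ('k::field \<Rightarrow> 'a::ab_group_add \<Rightarrow> 'a) \<Rightarrow> bool" where
  "vec_sp C s \<longleftrightarrow> vector_space s \<and> module.subspace s C"

definition lin ::
  "'a::ab_group_add set \<Rightarrow> ('k::field \<Rightarrow> 'a \<Rightarrow> 'a) \<Rightarrow> ('k \<Rightarrow> 'b::ab_group_add \<Rightarrow> 'b) \<Rightarrow> ('a \<Rightarrow> 'b) \<Rightarrow> bool"
where
  "lin C s t f \<longleftrightarrow>
     (\<forall>x\<in>C. \<forall>y\<in>C. f (x + y) = f x + f y) \<and> (\<forall>c. \<forall>x\<in>C. f (s c x) = t c (f x))"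

definition bilin ::
  "'a::ab_group_add set \<Rightarrow> ('k::field \<Rightarrow> 'a \<Rightarrow> 'a) \<Rightarrow> 'b::ab_group_add set \<Rightarrow> ('k \<Rightarrow> 'b \<Rightarrow> 'b)
    \<Rightarrow> ('k \<Rightarrow> 'c::ab_group_add \<Rightarrow> 'c) \<Rightarrow> ('a \<Rightarrow> 'b \<Rightarrow> 'c) \<Rightarrow> bool"
where
  "bilin C s D t r f \<longleftrightarrow>
     (\<forall>x\<in>C. lin D t r (\<lambda>y. f x y)) \<and> (\<forall>y\<in>D. lin C s r (\<lambda>x. f x y))"

definition trilin_form ::
  "'a::ab_group_add set \<Rightarrow> ('k::field \<Rightarrow> 'a \<Rightarrow> 'a) \<Rightarrow> ('a \<Rightarrow> 'a \<Rightarrow> 'a \<Rightarrow> 'k) \<Rightarrow> bool"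
where
  "trilin_form C s f \<longleftrightarrow>
     (\<forall>x\<in>C. \<forall>y\<in>C. lin C s (*) (\<lambda>z. f x y z)) \<and>
     (\<forall>x\<in>C. \<forall>z\<in>C. lin C s (*) (\<lambda>y. f x y z)) \<and>
     (\<forall>y\<in>C. \<forall>z\<in>C. lin C s (*) (\<lambda>x. f x y z))"

definition lsum :: "('k::zero \<Rightarrow> 'v \<Rightarrow> 'v::comm_monoid_add) \<Rightarrow> ('x \<Rightarrow>\<^sub>0 'k) \<Rightarrow> ('x \<Rightarrow> 'v) \<Rightarrow> 'v" where
  "lsum s u F = (\<Sum>x\<in>keys u. s (lookup u x) (F x))"

definition fscale :: "'k::field \<Rightarrow> ('x \<Rightarrow>\<^sub>0 'k) \<Rightarrow> ('x \<Rightarrow>\<^sub>0 'k)" where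
  "fscale c = Poly_Mapping.map (\<lambda>a. c * a)"

text \<open>
  An element of the tensor product of \<open>C\<close> and \<open>D\<close> is represented by a formal linear combination
  of pairs from \<open>C \<times> D\<close>. Two of them represent the same tensor iff all bilinear
  forms agree on them; lemma \<open>tens_eq_iff_relations\<close> below shows that this is the usual quotient of
  the free vector space on \<open>C \<times> D\<close> by the relations of bilinearity. In the same way identities
  in a threefold tensor product are tested on trilinear forms.
\<close>

definition tens_eq ::
  "'a::ab_group_add set \<Rightarrow> ('k::field \<Rightarrow> 'a \<Rightarrow> 'a) \<Rightarrow> 'b::ab_group_add set \<Rightarrow> ('k \<Rightarrow> 'b \<Rightarrow> 'b)
    \<Rightarrow> ('a \<times> 'b \<Rightarrow>\<^sub>0 'k) \<Rightarrow> ('a \<times> 'b \<Rightarrow>\<^sub>0 'k) \<Rightarrow> bool"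
where
  "tens_eq C s D t u v \<longleftrightarrow>
     (\<forall>f. bilin C s D t (*) f \<longrightarrow> lsum (*) u (\<lambda>(a,b). f a b) = lsum (*) v (\<lambda>(a,b). f a b))"

abbreviation pure :: "'a \<Rightarrow> 'b \<Rightarrow> ('a \<times> 'b \<Rightarrow>\<^sub>0 'k::field)" where
  "pure a b \<equiv> single (a, b) 1"

definition bilin_relations ::
  "'a::ab_group_add set \<Rightarrow> ('k::field \<Rightarrow> 'a \<Rightarrow> 'a) \<Rightarrow> 'b::ab_group_add set \<Rightarrow> ('k \<Rightarrow> 'b \<Rightarrow> 'b)
    \<Rightarrow> ('a \<times> 'b \<Rightarrow>\<^sub>0 'k) set"
where
  "bilin_relations C s D t =
     {pure (a + a') b - pure a b - pure a' b | a a' b. a \<in> C \<and> a' \<in> C \<and> b \<in> D} \<union>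
     {pure a (b + b') - pure a b - pure a b' | a b b'. a \<in> C \<and> b \<in> D \<and> b' \<in> D} \<union>
     {pure (s c a) b - fscale c (pure a b) | c a b. a \<in> C \<and> b \<in> D} \<union>
     {pure a (t c b) - fscale c (pure a b) | c a b. a \<in> C \<and> b \<in> D}"

lemma lookup_fscale [simp]: "lookup (fscale c u) x = c * lookup u x"
  by (simp add: fscale_def Poly_Mapping.map.rep_eq when_def)

lemma vector_space_fscale: "vector_space (fscale :: 'k::field \<Rightarrow> ('x \<Rightarrow>\<^sub>0 'k) \<Rightarrow> _)"
  by unfold_locales (auto intro!: poly_mapping_eqI simp: lookup_add algebra_simps)

lemma lsum_superset:
  fixes F :: "'x \<Rightarrow> 'k::field"
  assumes "finite A" "keys u \<subseteq> A"
  shows "lsum (*) u F = (\<Sum>x\<in>A. lookup u x * F x)"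
  unfolding lsum_def using assms
  by (intro sum.mono_neutral_left) (auto simp: in_keys_iff)

lemma lsum_add:
  fixes F :: "'x \<Rightarrow> 'k::field"
  shows "lsum (*) (u + v) F = lsum (*) u F + lsum (*) v F"
proof -
  let ?A = "keys u \<union> keys v"
  have "lsum (*) (u + v) F = (\<Sum>x\<in>?A. lookup (u + v) x * F x)"
    by (rule lsum_superset) (auto dest: subsetD[OF Poly_Mapping.keys_add])
  also have "\<dots> = (\<Sum>x\<in>?A. lookup u x * F x) + (\<Sum>x\<in>?A. lookup v x * F x)"
    by (simp add: lookup_add algebra_simps sum.distrib)
  finally show ?thesis by (simp add: lsum_superset[of ?A])
qed

lemma lsum_fscale:
  fixes F :: "'x \<Rightarrow> 'k::field"
  shows "lsum (*) (fscale c u) F = c * lsum (*) u F"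
proof -
  have "lsum (*) (fscale c u) F = (\<Sum>x\<in>keys u. lookup (fscale c u) x * F x)"
    by (rule lsum_superset) (auto simp: in_keys_iff)
  thus ?thesis by (simp add: lsum_def sum_distrib_left mult.assoc)
qed

lemma lsum_single [simp]:
  fixes F :: "'x \<Rightarrow> 'k::field"
  shows "lsum (*) (single x c) F = c * F x"
  by (simp add: lsum_def)

lemma lsum_diff:
  fixes F :: "'x \<Rightarrow> 'k::field"
  shows "lsum (*) (u - v) F = lsum (*) u F - lsum (*) v F"
  using lsum_add[of "u - v" v F] by simp

lemma tens_eq_iff_relations:
  fixes C :: "'a::ab_group_add set" and s :: "'k::field \<Rightarrow> 'a \<Rightarrow> 'a"
    and D :: "'b::ab_group_add set" and t :: "'k \<Rightarrow> 'b \<Rightarrow> 'b"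
  shows "tens_eq C s D t u v \<longleftrightarrow> u - v \<in> module.span fscale (bilin_relations C s D t)"
proof -
  interpret F: vector_space "fscale :: 'k \<Rightarrow> ('a \<times> 'b \<Rightarrow>\<^sub>0 'k) \<Rightarrow> _"
    by (rule vector_space_fscale)
  interpret K: vector_space "(*) :: 'k \<Rightarrow> 'k \<Rightarrow> 'k"
    by unfold_locales (auto simp: algebra_simps)
  interpret P: vector_space_pair "fscale :: 'k \<Rightarrow> ('a \<times> 'b \<Rightarrow>\<^sub>0 'k) \<Rightarrow> _" "(*) :: 'k \<Rightarrow> 'k \<Rightarrow> 'k" ..
  let ?R = "bilin_relations C s D t"
  show ?thesis
  proof
    assume eq: "tens_eq C s D t u v"
    show "u - v \<in> F.span ?R"
    proof (rule ccontr)
      assume nin: "u - v \<notin> F.span ?R"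
      obtain B where B: "B \<subseteq> ?R" "F.independent B" "?R \<subseteq> F.span B"
        by (rule F.basis_exists[of ?R])
      have spB: "F.span B = F.span ?R"
        using F.span_mono[OF B(1)] F.span_minimal[OF B(3) F.subspace_span] by (rule subset_antisym)
      have ind: "F.independent (insert (u - v) B)"
        by (rule F.independent_insertI) (use B nin spB in simp_all)
      have notB: "u - v \<notin> B" using nin F.span_base[of "u - v" B] unfolding spB by blast
      obtain \<phi> where \<phi>: "Vector_Spaces.linear fscale (*) \<phi>"
        "\<forall>x\<in>insert (u - v) B. \<phi> x = (if x = u - v then 1 else 0)"
        using P.linear_independent_extend[OF ind, of "\<lambda>x. if x = u - v then 1 else 0"]
        by (elim exE conjE)
      interpret L: Vector_Spaces.linear fscale "(*)" \<phi> by (rule \<phi>(1))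
      have zB: "\<phi> b = 0" if "b \<in> B" for b using \<phi>(2) notB that by auto
      have zR: "\<phi> b = 0" if "b \<in> ?R" for b
      proof -
        have "b \<in> F.span B" using B(3) that by blast
        from L.eq_0_on_span[OF zB this] show ?thesis by simp
      qed
      have ev: "\<phi> w = lsum (*) w (\<lambda>(a,b). \<phi> (pure a b))" for w
      proof -
        have "w = (\<Sum>x\<in>keys w. fscale (lookup w x) (single x 1))"
        proof (rule poly_mapping_eqI)
          fix y show "lookup w y = lookup (\<Sum>x\<in>keys w. fscale (lookup w x) (single x 1)) y"
            by (simp add: Poly_Mapping.lookup_sum lookup_single when_def in_keys_iff
                if_distrib[of "\<lambda>z. _ * z"] cong: if_cong)
        qed
        hence "\<phi> w = \<phi> (\<Sum>x\<in>keys w. fscale (lookup w x) (single x 1))" by simp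
        also have "\<dots> = (\<Sum>x\<in>keys w. lookup w x * \<phi> (single x 1))"
          by (simp only: L.sum L.scale)
        finally have "\<phi> w = (\<Sum>x\<in>keys w. lookup w x * \<phi> (single x 1))" .
        thus ?thesis unfolding lsum_def by (simp add: case_prod_unfold)
      qed
      have "bilin C s D t (*) (\<lambda>a b. \<phi> (pure a b))"
        unfolding bilin_def lin_def
      proof (intro ballI conjI allI)
        fix x y z assume "x \<in> C" "y \<in> D" "z \<in> D"
        hence "pure x (y + z) - pure x y - pure x z \<in> ?R" unfolding bilin_relations_def by blast
        from zR[OF this] show "\<phi> (pure x (y + z)) = \<phi> (pure x y) + \<phi> (pure x z)"
          by (simp add: L.diff L.add diff_diff_eq)
      next
        fix x c y assume "x \<in> C" "y \<in> D"
        hence "pure x (t c y) - fscale c (pure x y) \<in> ?R" unfolding bilin_relations_def by blast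
        from zR[OF this] show "\<phi> (pure x (t c y)) = c * \<phi> (pure x y)"
          by (simp add: L.diff L.scale)
      next
        fix y x z assume "y \<in> D" "x \<in> C" "z \<in> C"
        hence "pure (x + z) y - pure x y - pure z y \<in> ?R" unfolding bilin_relations_def by blast
        from zR[OF this] show "\<phi> (pure (x + z) y) = \<phi> (pure x y) + \<phi> (pure z y)"
          by (simp add: L.diff L.add diff_diff_eq)
      next
        fix y c x assume "y \<in> D" "x \<in> C"
        hence "pure (s c x) y - fscale c (pure x y) \<in> ?R" unfolding bilin_relations_def by blast
        from zR[OF this] show "\<phi> (pure (s c x) y) = c * \<phi> (pure x y)"
          by (simp add: L.diff L.scale)
      qed
      hence "\<phi> u = \<phi> v" using eq unfolding tens_eq_def ev[of u] ev[of v] by blast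
      thus False using \<phi>(2) L.diff[of u v] by auto
    qed
  next
    assume sp: "u - v \<in> F.span ?R"
    show "tens_eq C s D t u v"
      unfolding tens_eq_def
    proof (intro allI impI)
      fix f :: "'a \<Rightarrow> 'b \<Rightarrow> 'k" assume f: "bilin C s D t (*) f"
      let ?L = "\<lambda>w. lsum (*) w (\<lambda>(a,b). f a b)"
      have "?L (u - v) = 0" using sp
      proof (induction rule: F.span_induct_alt)
        case base show ?case by (simp add: lsum_def)
      next
        case (step c x y)
        have "?L x = 0"
          using step(1) f unfolding bilin_relations_def bilin_def lin_def
          by (auto simp: lsum_diff lsum_fscale)
        thus ?case using step by (simp add: lsum_add lsum_fscale)
      qed
      thus "?L u = ?L v" by (simp add: lsum_diff)
    qed
  qed
qed


section \<open>Coalgebras, Hopf algebras, coquasi-Hopf algebras\<close>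

record (overloaded) ('k, 'a) hopf_data =
  space :: "'a set"
  smul :: "'k \<Rightarrow> 'a \<Rightarrow> 'a"
  mul :: "'a \<Rightarrow> 'a \<Rightarrow> 'a"
  unt :: "'a"
  comul :: "'a \<Rightarrow> ('a \<times> 'a \<Rightarrow>\<^sub>0 'k)"
  counit :: "'a \<Rightarrow> 'k"

abbreviation teq ("_ \<approx>\<index> _" [51, 51] 50) where
  "u \<approx>\<^bsub>H\<^esub> v \<equiv> tens_eq (space H) (smul H) (space H) (smul H) u v"

text \<open>
  Sweedler sums: \<open>sw H s h F\<close> is the value of the linear extension of \<open>F\<close> (with values
  in a vector space with scalar multiplication \<open>s\<close>) on the coproduct of \<open>h\<close>, that is
  \<open>F h(1) h(2)\<close>; \<open>sw3\<close>, \<open>sw4\<close>, \<open>sw5\<close> are the same for iterated coproducts.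
\<close>

definition sw ::
  "('k::field, 'a, 'z) hopf_data_scheme \<Rightarrow> ('k \<Rightarrow> 'v \<Rightarrow> 'v::ab_group_add) \<Rightarrow> 'a \<Rightarrow> ('a \<Rightarrow> 'a \<Rightarrow> 'v) \<Rightarrow> 'v"
where
  "sw H s h F = lsum s (comul H h) (\<lambda>(a, b). F a b)"

definition sw3 ::
  "('k::field, 'a, 'z) hopf_data_scheme \<Rightarrow> ('k \<Rightarrow> 'v \<Rightarrow> 'v::ab_group_add) \<Rightarrow> 'a
    \<Rightarrow> ('a \<Rightarrow> 'a \<Rightarrow> 'a \<Rightarrow> 'v) \<Rightarrow> 'v"
where
  "sw3 H s h F = sw H s h (\<lambda>h1 r. sw H s r (\<lambda>h2 h3. F h1 h2 h3))"

definition sw4 ::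
  "('k::field, 'a, 'z) hopf_data_scheme \<Rightarrow> ('k \<Rightarrow> 'v \<Rightarrow> 'v::ab_group_add) \<Rightarrow> 'a
    \<Rightarrow> ('a \<Rightarrow> 'a \<Rightarrow> 'a \<Rightarrow> 'a \<Rightarrow> 'v) \<Rightarrow> 'v"
where
  "sw4 H s h F = sw H s h (\<lambda>h1 r. sw3 H s r (\<lambda>h2 h3 h4. F h1 h2 h3 h4))"

definition sw5 ::
  "('k::field, 'a, 'z) hopf_data_scheme \<Rightarrow> ('k \<Rightarrow> 'v \<Rightarrow> 'v::ab_group_add) \<Rightarrow> 'a
    \<Rightarrow> ('a \<Rightarrow> 'a \<Rightarrow> 'a \<Rightarrow> 'a \<Rightarrow> 'a \<Rightarrow> 'v) \<Rightarrow> 'v"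
where
  "sw5 H s h F = sw H s h (\<lambda>h1 r. sw4 H s r (\<lambda>h2 h3 h4 h5. F h1 h2 h3 h4 h5))"

definition coalgebra :: "('k::field, 'a::ab_group_add, 'z) hopf_data_scheme \<Rightarrow> bool" where
  "coalgebra H \<longleftrightarrow>
     vec_sp (space H) (smul H) \<and>
     (\<forall>h\<in>space H. keys (comul H h) \<subseteq> space H \<times> space H) \<and>
     (\<forall>h\<in>space H. \<forall>k\<in>space H. comul H (h + k) \<approx>\<^bsub>H\<^esub> comul H h + comul H k) \<and>
     (\<forall>c. \<forall>h\<in>space H. comul H (smul H c h) \<approx>\<^bsub>H\<^esub> fscale c (comul H h)) \<and>
     lin (space H) (smul H) (*) (counit H) \<and>
     (\<forall>h\<in>space H. \<forall>f. trilin_form (space H) (smul H) f \<longrightarrow>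
        sw H (*) h (\<lambda>r h3. sw H (*) r (\<lambda>h1 h2. f h1 h2 h3)) =
        sw H (*) h (\<lambda>h1 r. sw H (*) r (\<lambda>h2 h3. f h1 h2 h3))) \<and>
     (\<forall>h\<in>space H. sw H (smul H) h (\<lambda>h1 h2. smul H (counit H h1) h2) = h) \<and>
     (\<forall>h\<in>space H. sw H (smul H) h (\<lambda>h1 h2. smul H (counit H h2) h1) = h)"

definition algebra :: "('k::field, 'a::ab_group_add, 'z) hopf_data_scheme \<Rightarrow> bool" where
  "algebra H \<longleftrightarrow>
     vec_sp (space H) (smul H) \<and>
     (\<forall>h\<in>space H. \<forall>k\<in>space H. mul H h k \<in> space H) \<and>
     bilin (space H) (smul H) (space H) (smul H) (smul H) (mul H) \<and>
     unt H \<in> space H \<and>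
     (\<forall>h\<in>space H. \<forall>k\<in>space H. \<forall>l\<in>space H. mul H (mul H h k) l = mul H h (mul H k l)) \<and>
     (\<forall>h\<in>space H. mul H (unt H) h = h \<and> mul H h (unt H) = h)"

definition bialgebra :: "('k::field, 'a::ab_group_add, 'z) hopf_data_scheme \<Rightarrow> bool" where
  "bialgebra H \<longleftrightarrow> coalgebra H \<and> algebra H \<and>
     (\<forall>h\<in>space H. \<forall>k\<in>space H. comul H (mul H h k) \<approx>\<^bsub>H\<^esub>
        sw H fscale h (\<lambda>h1 h2. sw H fscale k (\<lambda>k1 k2. pure (mul H h1 k1) (mul H h2 k2)))) \<and>
     comul H (unt H) \<approx>\<^bsub>H\<^esub> pure (unt H) (unt H) \<and>
     (\<forall>h\<in>space H. \<forall>k\<in>space H. counit H (mul H h k) = counit H h * counit H k) \<and>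
     counit H (unt H) = 1"

definition antipode :: "('k::field, 'a::ab_group_add, 'z) hopf_data_scheme \<Rightarrow> ('a \<Rightarrow> 'a) \<Rightarrow> bool" where
  "antipode H S \<longleftrightarrow>
     (\<forall>h\<in>space H. S h \<in> space H) \<and> lin (space H) (smul H) (smul H) S \<and>
     (\<forall>h\<in>space H.
        sw H (smul H) h (\<lambda>h1 h2. mul H (S h1) h2) = smul H (counit H h) (unt H) \<and>
        sw H (smul H) h (\<lambda>h1 h2. mul H h1 (S h2)) = smul H (counit H h) (unt H))"

definition hopf_algebra :: "('k::field, 'a::ab_group_add, 'z) hopf_data_scheme \<Rightarrow> bool" where
  "hopf_algebra H \<longleftrightarrow> bialgebra H \<and> (\<exists>S. antipode H S)"

definition subcoalgebra :: "('k::field, 'a::ab_group_add, 'z) hopf_data_scheme \<Rightarrow> 'a set \<Rightarrow> bool" where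
  "subcoalgebra H E \<longleftrightarrow> E \<subseteq> space H \<and> module.subspace (smul H) E \<and>
     (\<forall>x\<in>E. \<exists>u. keys u \<subseteq> E \<times> E \<and> comul H x \<approx>\<^bsub>H\<^esub> u)"

definition pointed :: "('k::field, 'a::ab_group_add, 'z) hopf_data_scheme \<Rightarrow> bool" where
  "pointed H \<longleftrightarrow>
     (\<forall>E. subcoalgebra H E \<and> E \<noteq> {0} \<and>
          (\<forall>E'. subcoalgebra H E' \<and> E' \<subseteq> E \<longrightarrow> E' = {0} \<or> E' = E)
        \<longrightarrow> (\<exists>x. x \<noteq> 0 \<and> E = module.span (smul H) {x}))"

definition bialgebra_map ::
  "('k::field, 'a::ab_group_add, 'z) hopf_data_scheme \<Rightarrow> ('k, 'b::ab_group_add, 'y) hopf_data_scheme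
    \<Rightarrow> ('a \<Rightarrow> 'b) \<Rightarrow> bool"
where
  "bialgebra_map H K f \<longleftrightarrow>
     (\<forall>h\<in>space H. f h \<in> space K) \<and> lin (space H) (smul H) (smul K) f \<and>
     (\<forall>h\<in>space H. \<forall>k\<in>space H. f (mul H h k) = mul K (f h) (f k)) \<and> f (unt H) = unt K \<and>
     (\<forall>h\<in>space H. comul K (f h) \<approx>\<^bsub>K\<^esub> sw H fscale h (\<lambda>h1 h2. pure (f h1) (f h2))) \<and>
     (\<forall>h\<in>space H. counit K (f h) = counit H h)"

definition grouplikes :: "('k::field, 'a::ab_group_add, 'z) hopf_data_scheme \<Rightarrow> 'a set" where
  "grouplikes H = {g \<in> space H. comul H g \<approx>\<^bsub>H\<^esub> pure g g \<and> counit H g = 1}"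

definition alg_chars :: "('k::field, 'a::ab_group_add, 'z) hopf_data_scheme \<Rightarrow> ('a \<Rightarrow> 'k) set" where
  "alg_chars H = {\<chi>. lin (space H) (smul H) (*) \<chi> \<and> \<chi> (unt H) = 1 \<and>
     (\<forall>h\<in>space H. \<forall>k\<in>space H. \<chi> (mul H h k) = \<chi> h * \<chi> k)}"

text \<open>
  The compatibility of antipode and associator (last two equations) depends on the direction
  in which the associator reassociates. For the direction fixed by quasi-associativity,
  where \<open>\<Omega>\<close> turns \<open>(h k) l\<close> into \<open>h (k l)\<close>, it is \<open>\<Omega>'\<close> (the convolution inverse) that occurs in the
  equation starting with \<open>\<beta>\<close>, and \<open>\<Omega>\<close> in the one starting with \<open>S\<close>.
\<close>

definition coquasi_hopf ::
  "('k::field, 'a::ab_group_add, 'z) hopf_data_scheme \<Rightarrow> ('a \<Rightarrow> 'a \<Rightarrow> 'a \<Rightarrow> 'k) \<Rightarrow> bool"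
where
  "coquasi_hopf H \<Omega> \<longleftrightarrow>
     coalgebra H \<and>
     (\<forall>h\<in>space H. \<forall>k\<in>space H. mul H h k \<in> space H) \<and>
     bilin (space H) (smul H) (space H) (smul H) (smul H) (mul H) \<and>
     unt H \<in> space H \<and>
     (\<forall>h\<in>space H. \<forall>k\<in>space H. comul H (mul H h k) \<approx>\<^bsub>H\<^esub>
        sw H fscale h (\<lambda>h1 h2. sw H fscale k (\<lambda>k1 k2. pure (mul H h1 k1) (mul H h2 k2)))) \<and>
     (\<forall>h\<in>space H. \<forall>k\<in>space H. counit H (mul H h k) = counit H h * counit H k) \<and>
     comul H (unt H) \<approx>\<^bsub>H\<^esub> pure (unt H) (unt H) \<and> counit H (unt H) = 1 \<and>
     (\<forall>h\<in>space H. mul H (unt H) h = h \<and> mul H h (unt H) = h) \<and>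
     trilin_form (space H) (smul H) \<Omega> \<and>
     (\<forall>h\<in>space H. \<forall>k\<in>space H. \<forall>l\<in>space H.
        sw H (smul H) h (\<lambda>h1 h2. sw H (smul H) k (\<lambda>k1 k2. sw H (smul H) l (\<lambda>l1 l2.
          smul H (\<Omega> h2 k2 l2) (mul H (mul H h1 k1) l1)))) =
        sw H (smul H) h (\<lambda>h1 h2. sw H (smul H) k (\<lambda>k1 k2. sw H (smul H) l (\<lambda>l1 l2.
          smul H (\<Omega> h1 k1 l1) (mul H h2 (mul H k2 l2)))))) \<and>
     (\<forall>h\<in>space H. \<forall>k\<in>space H. \<forall>l\<in>space H. \<forall>t\<in>space H.
        sw H (*) h (\<lambda>h1 h2. sw H (*) k (\<lambda>k1 k2. sw H (*) l (\<lambda>l1 l2. sw H (*) t (\<lambda>t1 t2.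
          \<Omega> (mul H h1 k1) l1 t1 * \<Omega> h2 k2 (mul H l2 t2))))) =
        sw H (*) h (\<lambda>h1 h2. sw3 H (*) k (\<lambda>k1 k2 k3. sw3 H (*) l (\<lambda>l1 l2 l3. sw H (*) t (\<lambda>t1 t2.
          \<Omega> h1 k1 l1 * \<Omega> h2 (mul H k2 l2) t1 * \<Omega> k3 l3 t2))))) \<and>
     (\<forall>h\<in>space H. \<forall>k\<in>space H. \<Omega> h (unt H) k = counit H h * counit H k) \<and>
     (\<exists>\<Omega>'. trilin_form (space H) (smul H) \<Omega>' \<and>
        (\<forall>h\<in>space H. \<forall>k\<in>space H. \<forall>l\<in>space H.
           sw H (*) h (\<lambda>h1 h2. sw H (*) k (\<lambda>k1 k2. sw H (*) l (\<lambda>l1 l2.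
             \<Omega> h1 k1 l1 * \<Omega>' h2 k2 l2))) = counit H h * counit H k * counit H l \<and>
           sw H (*) h (\<lambda>h1 h2. sw H (*) k (\<lambda>k1 k2. sw H (*) l (\<lambda>l1 l2.
             \<Omega>' h1 k1 l1 * \<Omega> h2 k2 l2))) = counit H h * counit H k * counit H l) \<and>
        (\<exists>S \<alpha> \<beta>.
           (\<forall>h\<in>space H. S h \<in> space H) \<and> lin (space H) (smul H) (smul H) S \<and>
           lin (space H) (smul H) (*) \<alpha> \<and> lin (space H) (smul H) (*) \<beta> \<and>
           (\<forall>h\<in>space H.
              sw3 H (smul H) h (\<lambda>h1 h2 h3. smul H (\<alpha> h2) (mul H (S h1) h3)) = smul H (\<alpha> h) (unt H) \<and>
              sw3 H (smul H) h (\<lambda>h1 h2 h3. smul H (\<beta> h2) (mul H h1 (S h3))) = smul H (\<beta> h) (unt H) \<and>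
              sw5 H (*) h (\<lambda>h1 h2 h3 h4 h5.
                \<Omega>' (smul H (\<beta> h2) h1) (S h3) (smul H (\<alpha> h4) h5)) = counit H h \<and>
              sw5 H (*) h (\<lambda>h1 h2 h3 h4 h5.
                \<Omega> (S h1) (smul H (\<alpha> h2 * \<beta> h4) h3) (S h5)) = counit H h)))"


section \<open>Group algebras, cocentral maps and zesting data\<close>

definition units_group :: "'k::field monoid" where
  "units_group = \<lparr>carrier = UNIV - {0}, mult = (*), one = 1\<rparr>"

definition char_group :: "('g, 'm) monoid_scheme \<Rightarrow> ('g \<Rightarrow> 'k::field) monoid" where
  "char_group \<Gamma> = \<lparr>carrier = hom \<Gamma> units_group \<inter> extensional (carrier \<Gamma>),
     mult = (\<lambda>\<chi> \<psi>. \<lambda>g\<in>carrier \<Gamma>. \<chi> g * \<psi> g), one = (\<lambda>g\<in>carrier \<Gamma>. 1)\<rparr>"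

definition group_algebra :: "('s, 'm) monoid_scheme \<Rightarrow> ('k::field, 's \<Rightarrow>\<^sub>0 'k) hopf_data" where
  "group_algebra G =
     \<lparr>space = {u. keys u \<subseteq> carrier G},
      smul = fscale,
      mul = (\<lambda>u v. \<Sum>a\<in>keys u. \<Sum>b\<in>keys v. single (a \<otimes>\<^bsub>G\<^esub> b) (lookup u a * lookup v b)),
      unt = single \<one>\<^bsub>G\<^esub> 1,
      comul = (\<lambda>u. \<Sum>a\<in>keys u. single (single a 1, single a 1) (lookup u a)),
      counit = (\<lambda>u. \<Sum>a\<in>keys u. lookup u a)\<rparr>"

definition cocentral_epi ::
  "('k::field, 'a::ab_group_add, 'z) hopf_data_scheme \<Rightarrow> ('s, 'm) monoid_scheme
    \<Rightarrow> ('a \<Rightarrow> ('s \<Rightarrow>\<^sub>0 'k)) \<Rightarrow> bool"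
where
  "cocentral_epi H G \<pi> \<longleftrightarrow>
     bialgebra_map H (group_algebra G) \<pi> \<and> \<pi> ` space H = space (group_algebra G :: ('k, _) hopf_data) \<and>
     (\<forall>h\<in>space H.
        tens_eq (space H) (smul H) (space (group_algebra G)) (smul (group_algebra G))
          (sw H fscale h (\<lambda>h1 h2. pure h1 (\<pi> h2))) (sw H fscale h (\<lambda>h1 h2. pure h2 (\<pi> h1))))"

definition homog ::
  "('k::field, 'a::ab_group_add, 'z) hopf_data_scheme \<Rightarrow> ('s, 'm) monoid_scheme
    \<Rightarrow> ('a \<Rightarrow> ('s \<Rightarrow>\<^sub>0 'k)) \<Rightarrow> 's \<Rightarrow> 'a set"
where
  "homog H G \<pi> s = {h \<in> space H.
     tens_eq (space (group_algebra G)) (smul (group_algebra G)) (space H) (smul H)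
       (sw H fscale h (\<lambda>h1 h2. pure (\<pi> h1) h2)) (pure (single s 1) h)}"

definition coinv_grouplikes ::
  "('k::field, 'a::ab_group_add, 'z) hopf_data_scheme \<Rightarrow> ('s, 'm) monoid_scheme
    \<Rightarrow> ('a \<Rightarrow> ('s \<Rightarrow>\<^sub>0 'k)) \<Rightarrow> 'a monoid"
where
  "coinv_grouplikes H G \<pi> =
     \<lparr>carrier = grouplikes H \<inter> homog H G \<pi> \<one>\<^bsub>G\<^esub>, mult = mul H, one = unt H\<rparr>"

definition hopf_subalgebra :: "('k::field, 'a::ab_group_add, 'z) hopf_data_scheme \<Rightarrow> 'a set \<Rightarrow> bool" where
  "hopf_subalgebra H K \<longleftrightarrow> subcoalgebra H K \<and> unt H \<in> K \<and>
     (\<forall>x\<in>K. \<forall>y\<in>K. mul H x y \<in> K) \<and> (\<forall>S. antipode H S \<longrightarrow> S ` K \<subseteq> K)"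

text \<open>
  As \<open>r\<close> only accepts second arguments from \<open>K\<close>, coproducts of elements of \<open>K\<close> have to be
  expanded in \<open>K \<otimes> K\<close>; the axioms are required for every such expansion \<open>u\<close>.
  The commutation rule is \<open>r(h(1),k(1)) h(2) k(2) = k(1) h(1) r(h(2),k(2))\<close>. For a group-like
  \<open>k = g\<close> it says \<open>r(h(1),g) inv(g) h(2) g = h(1) r(h(2),g)\<close>, the condition on \<open>\<gamma>\<close> in
  \<open>zesting_datum\<close> below. This direction of the conjugation is the one compatible with
  \<open>g \<cdot> x_i = \<langle>g_i, \<Phi>(g)\<rangle> x_i\<close> and with the quasi-associativity in \<open>coquasi_hopf\<close> for the
  associator given by \<open>\<gamma>\<close>; with the opposite conjugation both would need
  the inverse of \<open>\<gamma>\<close>.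
\<close>

definition relative_r_form ::
  "('k::field, 'a::ab_group_add, 'z) hopf_data_scheme \<Rightarrow> 'a set \<Rightarrow> ('a \<Rightarrow> 'a \<Rightarrow> 'k) \<Rightarrow> bool"
where
  "relative_r_form H K r \<longleftrightarrow>
     hopf_subalgebra H K \<and>
     bilin (space H) (smul H) K (smul H) (*) r \<and>
     (\<forall>h\<in>space H. \<forall>h'\<in>space H. \<forall>k\<in>K. \<forall>u. keys u \<subseteq> K \<times> K \<and> comul H k \<approx>\<^bsub>H\<^esub> u \<longrightarrow>
        r (mul H h h') k = lsum (*) u (\<lambda>(k1, k2). r h' k1 * r h k2)) \<and>
     (\<forall>h\<in>space H. \<forall>k\<in>K. \<forall>k'\<in>K.
        r h (mul H k k') = sw H (*) h (\<lambda>h1 h2. r h1 k * r h2 k')) \<and>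
     (\<forall>h\<in>space H. r h (unt H) = counit H h) \<and>
     (\<forall>k\<in>K. r (unt H) k = counit H k) \<and>
     (\<forall>h\<in>space H. \<forall>k\<in>K. \<forall>u. keys u \<subseteq> K \<times> K \<and> comul H k \<approx>\<^bsub>H\<^esub> u \<longrightarrow>
        sw H (smul H) h (\<lambda>h1 h2. lsum (smul H) u (\<lambda>(k1, k2). smul H (r h1 k1) (mul H h2 k2))) =
        sw H (smul H) h (\<lambda>h1 h2. lsum (smul H) u (\<lambda>(k1, k2). smul H (r h2 k2) (mul H k1 h1))))"

definition normalized_2cocycle ::
  "('s, 'm) monoid_scheme \<Rightarrow> ('a, 'n) monoid_scheme \<Rightarrow> 'a set \<Rightarrow> ('s \<Rightarrow> 's \<Rightarrow> 'a) \<Rightarrow> bool"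
where
  "normalized_2cocycle G A \<Gamma>0 lam \<longleftrightarrow>
     (\<forall>a\<in>carrier G. \<forall>b\<in>carrier G. lam a b \<in> \<Gamma>0) \<and>
     (\<forall>a\<in>carrier G. \<forall>b\<in>carrier G. \<forall>c\<in>carrier G.
        lam a b \<otimes>\<^bsub>A\<^esub> lam (a \<otimes>\<^bsub>G\<^esub> b) c = lam b c \<otimes>\<^bsub>A\<^esub> lam a (b \<otimes>\<^bsub>G\<^esub> c)) \<and>
     (\<forall>a\<in>carrier G. lam a \<one>\<^bsub>G\<^esub> = \<one>\<^bsub>A\<^esub> \<and> lam \<one>\<^bsub>G\<^esub> a = \<one>\<^bsub>A\<^esub>)"

definition normalized_3cochain ::
  "('s, 'm) monoid_scheme \<Rightarrow> ('s \<Rightarrow> 's \<Rightarrow> 's \<Rightarrow> 'k::field) \<Rightarrow> bool"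
where
  "normalized_3cochain G \<omega> \<longleftrightarrow>
     (\<forall>a\<in>carrier G. \<forall>b\<in>carrier G. \<forall>c\<in>carrier G. \<omega> a b c \<noteq> 0) \<and>
     (\<forall>a\<in>carrier G. \<forall>b\<in>carrier G.
        \<omega> \<one>\<^bsub>G\<^esub> a b = 1 \<and> \<omega> a \<one>\<^bsub>G\<^esub> b = 1 \<and> \<omega> a b \<one>\<^bsub>G\<^esub> = 1)"

definition zesting_datum ::
  "('k::field, 'a::ab_group_add, 'z) hopf_data_scheme \<Rightarrow> ('s, 'm) monoid_scheme
    \<Rightarrow> ('a \<Rightarrow> ('s \<Rightarrow>\<^sub>0 'k)) \<Rightarrow> 'a set \<Rightarrow> ('a \<Rightarrow> 'a \<Rightarrow> 'k) \<Rightarrow> ('s \<Rightarrow> 's \<Rightarrow> 'a)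
    \<Rightarrow> ('s \<Rightarrow> 's \<Rightarrow> 's \<Rightarrow> 'k) \<Rightarrow> bool"
where
  "zesting_datum H G \<pi> \<Gamma>0 \<gamma> lam \<omega> \<longleftrightarrow>
     subgroup \<Gamma>0 (coinv_grouplikes H G \<pi>) \<and>
     (\<forall>g\<in>\<Gamma>0. \<gamma> g \<in> alg_chars H) \<and>
     (\<forall>g\<in>\<Gamma>0. \<forall>g'\<in>\<Gamma>0. \<forall>h\<in>space H. \<gamma> (mul H g g') h = sw H (*) h (\<lambda>h1 h2. \<gamma> g h1 * \<gamma> g' h2)) \<and>
     (\<forall>g\<in>\<Gamma>0. \<forall>h\<in>space H.
        sw H (smul H) h (\<lambda>h1 h2.
          smul H (\<gamma> g h1) (mul H (mul H (inv\<^bsub>coinv_grouplikes H G \<pi>\<^esub> g) h2) g)) =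
        sw H (smul H) h (\<lambda>h1 h2. smul H (\<gamma> g h2) h1)) \<and>
     normalized_2cocycle G (coinv_grouplikes H G \<pi>) \<Gamma>0 lam \<and>
     normalized_3cochain G \<omega> \<and>
     (\<forall>a\<in>carrier G. \<forall>b\<in>carrier G. \<forall>c\<in>carrier G. \<forall>d\<in>carrier G.
        \<gamma> (lam a b) (lam c d) =
          (\<omega> a b c * \<omega> a (b \<otimes>\<^bsub>G\<^esub> c) d * \<omega> b c d) /
          (\<omega> (a \<otimes>\<^bsub>G\<^esub> b) c d * \<omega> a b (c \<otimes>\<^bsub>G\<^esub> d)))"

text \<open>
  Multiplication and associator of the zested algebra are specified on homogeneous
  elements and extended multilinearly.
\<close>

definition zesting ::
  "('k::field, 'a::ab_group_add, 'z) hopf_data_scheme \<Rightarrow> ('s, 'm) monoid_scheme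
    \<Rightarrow> ('a \<Rightarrow> ('s \<Rightarrow>\<^sub>0 'k)) \<Rightarrow> ('a \<Rightarrow> 'a \<Rightarrow> 'k) \<Rightarrow> ('s \<Rightarrow> 's \<Rightarrow> 'a)
    \<Rightarrow> ('s \<Rightarrow> 's \<Rightarrow> 's \<Rightarrow> 'k) \<Rightarrow> ('a \<Rightarrow> 'a \<Rightarrow> 'a) \<Rightarrow> ('a \<Rightarrow> 'a \<Rightarrow> 'a \<Rightarrow> 'k) \<Rightarrow> bool"
where
  "zesting H G \<pi> \<gamma> lam \<omega> m \<Omega> \<longleftrightarrow>
     bilin (space H) (smul H) (space H) (smul H) (smul H) m \<and>
     trilin_form (space H) (smul H) \<Omega> \<and>
     (\<forall>a\<in>carrier G. \<forall>b\<in>carrier G. \<forall>h\<in>homog H G \<pi> a. \<forall>k\<in>homog H G \<pi> b.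
        m h k = mul H (mul H h k) (lam a b)) \<and>
     (\<forall>a\<in>carrier G. \<forall>b\<in>carrier G. \<forall>c\<in>carrier G.
        \<forall>h\<in>homog H G \<pi> a. \<forall>k\<in>homog H G \<pi> b. \<forall>l\<in>homog H G \<pi> c.
        \<Omega> h k l = counit H (mul H h k) * \<omega> a b c * \<gamma> (lam a b) l)"


section \<open>Yetter-Drinfeld modules and pre-Nichols algebras\<close>

text \<open>
  A left coaction of the group algebra on \<open>C\<close> is a linear map into \<open>k\<Gamma> \<otimes> C\<close>,
  and the latter is identified with the finitely supported functions from \<open>\<Gamma>\<close> to \<open>C\<close>:
  \<open>g \<otimes> v\<close> is \<open>single g v\<close>.
\<close>

definition yd_module ::
  "('g, 'm) monoid_scheme \<Rightarrow> 'a::ab_group_add set \<Rightarrow> ('k::field \<Rightarrow> 'a \<Rightarrow> 'a)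
    \<Rightarrow> ('g \<Rightarrow> 'a \<Rightarrow> 'a) \<Rightarrow> ('a \<Rightarrow> ('g \<Rightarrow>\<^sub>0 'a)) \<Rightarrow> bool"
where
  "yd_module \<Gamma> C s act coact \<longleftrightarrow>
     vec_sp C s \<and>
     (\<forall>g\<in>carrier \<Gamma>. (\<forall>v\<in>C. act g v \<in> C) \<and> lin C s s (act g)) \<and>
     (\<forall>v\<in>C. act \<one>\<^bsub>\<Gamma>\<^esub> v = v) \<and>
     (\<forall>g\<in>carrier \<Gamma>. \<forall>h\<in>carrier \<Gamma>. \<forall>v\<in>C. act (g \<otimes>\<^bsub>\<Gamma>\<^esub> h) v = act g (act h v)) \<and>
     (\<forall>v\<in>C. keys (coact v) \<subseteq> carrier \<Gamma> \<and> (\<forall>g. lookup (coact v) g \<in> C)) \<and>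
     (\<forall>g. lin C s s (\<lambda>v. lookup (coact v) g)) \<and>
     (\<forall>v\<in>C. (\<Sum>g\<in>keys (coact v). lookup (coact v) g) = v) \<and>
     (\<forall>v\<in>C. \<forall>g\<in>carrier \<Gamma>. coact (lookup (coact v) g) = single g (lookup (coact v) g)) \<and>
     (\<forall>v\<in>C. \<forall>g\<in>carrier \<Gamma>. \<forall>h\<in>carrier \<Gamma>.
        lookup (coact (act h v)) (h \<otimes>\<^bsub>\<Gamma>\<^esub> g \<otimes>\<^bsub>\<Gamma>\<^esub> inv\<^bsub>\<Gamma>\<^esub> h) = act h (lookup (coact v) g))"

record (overloaded) ('k, 'a, 'g) yd_hopf_data = "('k, 'a) hopf_data" +
  act :: "'g \<Rightarrow> 'a \<Rightarrow> 'a"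
  coact :: "'a \<Rightarrow> ('g \<Rightarrow>\<^sub>0 'a)"
  gr :: "nat \<Rightarrow> 'a set"

text \<open>
  Graded Hopf algebras in the braided category of Yetter-Drinfeld modules; the braiding enters in
  the multiplicativity of the coproduct, where
  \<open>(a \<otimes> b) (c \<otimes> d) = a (b(-1) \<cdot> c) \<otimes> b(0) d\<close>.
\<close>

definition yd_graded_hopf ::
  "('g, 'm) monoid_scheme \<Rightarrow> ('k::field, 'a::ab_group_add, 'g, 'z) yd_hopf_data_scheme \<Rightarrow> bool"
where
  "yd_graded_hopf \<Gamma> B \<longleftrightarrow>
     yd_module \<Gamma> (space B) (smul B) (act B) (coact B) \<and>
     algebra B \<and> coalgebra B \<and>
     (
      (\<forall>g\<in>carrier \<Gamma>. \<forall>x\<in>space B. \<forall>y\<in>space B. act B g (mul B x y) = mul B (act B g x) (act B g y)) \<and>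
      (\<forall>x\<in>space B. \<forall>y\<in>space B. coact B (mul B x y) =
         (\<Sum>g\<in>keys (coact B x). \<Sum>h\<in>keys (coact B y).
            single (g \<otimes>\<^bsub>\<Gamma>\<^esub> h) (mul B (lookup (coact B x) g) (lookup (coact B y) h)))) \<and>
      (\<forall>g\<in>carrier \<Gamma>. act B g (unt B) = unt B) \<and> coact B (unt B) = single \<one>\<^bsub>\<Gamma>\<^esub> (unt B) \<and>
      (\<forall>g\<in>carrier \<Gamma>. \<forall>x\<in>space B. comul B (act B g x) \<approx>\<^bsub>B\<^esub>
         sw B fscale x (\<lambda>x1 x2. pure (act B g x1) (act B g x2))) \<and>
      (\<forall>u\<in>carrier \<Gamma>. \<forall>x\<in>space B. comul B (lookup (coact B x) u) \<approx>\<^bsub>B\<^esub>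
         sw B fscale x (\<lambda>x1 x2. \<Sum>g\<in>keys (coact B x1). \<Sum>h\<in>keys (coact B x2).
           if g \<otimes>\<^bsub>\<Gamma>\<^esub> h = u then pure (lookup (coact B x1) g) (lookup (coact B x2) h) else 0)) \<and>
      (\<forall>g\<in>carrier \<Gamma>. \<forall>x\<in>space B. counit B (act B g x) = counit B x) \<and>
      (\<forall>g\<in>carrier \<Gamma>. \<forall>x\<in>space B. g \<noteq> \<one>\<^bsub>\<Gamma>\<^esub> \<longrightarrow> counit B (lookup (coact B x) g) = 0)) \<and>
     (
      (\<forall>x\<in>space B. \<forall>y\<in>space B. comul B (mul B x y) \<approx>\<^bsub>B\<^esub>
         sw B fscale x (\<lambda>x1 x2. sw B fscale y (\<lambda>y1 y2.
           \<Sum>g\<in>keys (coact B x2).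
             pure (mul B x1 (act B g y1)) (mul B (lookup (coact B x2) g) y2)))) \<and>
      comul B (unt B) \<approx>\<^bsub>B\<^esub> pure (unt B) (unt B) \<and>
      (\<forall>x\<in>space B. \<forall>y\<in>space B. counit B (mul B x y) = counit B x * counit B y) \<and>
      counit B (unt B) = 1) \<and>
     (\<exists>S. antipode B S \<and>
        (\<forall>g\<in>carrier \<Gamma>. \<forall>x\<in>space B. S (act B g x) = act B g (S x)) \<and>
        (\<forall>g\<in>carrier \<Gamma>. \<forall>x\<in>space B. lookup (coact B (S x)) g = S (lookup (coact B x) g)) \<and>
        (\<forall>n. S ` gr B n \<subseteq> gr B n)) \<and>
     (
      (\<forall>n. gr B n \<subseteq> space B \<and> module.subspace (smul B) (gr B n)) \<and>
      (\<forall>x\<in>space B. \<exists>!f :: nat \<Rightarrow>\<^sub>0 'a. (\<forall>n. lookup f n \<in> gr B n) \<and> x = (\<Sum>n\<in>keys f. lookup f n)) \<and>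
      (\<forall>n. \<forall>x\<in>gr B n. (\<forall>g\<in>carrier \<Gamma>. act B g x \<in> gr B n) \<and> (\<forall>g. lookup (coact B x) g \<in> gr B n)) \<and>
      unt B \<in> gr B 0 \<and>
      (\<forall>n m. \<forall>x\<in>gr B n. \<forall>y\<in>gr B m. mul B x y \<in> gr B (n + m)) \<and>
      (\<forall>n. \<forall>x\<in>gr B n. \<exists>u. keys u \<subseteq> (\<Union>i\<le>n. gr B i \<times> gr B (n - i)) \<and> comul B x \<approx>\<^bsub>B\<^esub> u) \<and>
      (\<forall>n>0. \<forall>x\<in>gr B n. counit B x = 0))"

definition yd_hopf_map ::
  "('g, 'm) monoid_scheme \<Rightarrow> ('k::field, 'a::ab_group_add, 'g, 'z) yd_hopf_data_scheme
    \<Rightarrow> ('k, 'b::ab_group_add, 'g, 'y) yd_hopf_data_scheme \<Rightarrow> ('a \<Rightarrow> 'b) \<Rightarrow> bool"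
where
  "yd_hopf_map \<Gamma> A B p \<longleftrightarrow> bialgebra_map A B p \<and>
     (\<forall>g\<in>carrier \<Gamma>. \<forall>x\<in>space A. p (act A g x) = act B g (p x)) \<and>
     (\<forall>g\<in>carrier \<Gamma>. \<forall>x\<in>space A. lookup (coact B (p x)) g = p (lookup (coact A x) g)) \<and>
     (\<forall>n. p ` gr A n \<subseteq> gr B n)"

text \<open>
  The tensor algebra of a Yetter-Drinfeld module \<open>V\<close> with basis \<open>x 1, \<dots>, x \<theta>\<close>, where \<open>x i\<close> has coaction
  \<open>gd i \<otimes> x i\<close>, in coordinates: the free algebra on the letters \<open>1, \<dots>, \<theta>\<close>. The word
  \<open>[i, \<dots>, j]\<close> stands for \<open>x i \<otimes> \<dots> \<otimes> x j\<close>.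
\<close>

definition tmul :: "(nat list \<Rightarrow>\<^sub>0 'k::field) \<Rightarrow> (nat list \<Rightarrow>\<^sub>0 'k) \<Rightarrow> (nat list \<Rightarrow>\<^sub>0 'k)" where
  "tmul t u = (\<Sum>v\<in>keys t. \<Sum>w\<in>keys u. single (v @ w) (lookup t v * lookup u w))"

definition tvec :: "('k::field \<Rightarrow> 'v::ab_group_add \<Rightarrow> 'v) \<Rightarrow> nat \<Rightarrow> (nat \<Rightarrow> 'v) \<Rightarrow> 'v \<Rightarrow> (nat list \<Rightarrow>\<^sub>0 'k)" where
  "tvec s \<theta> x v = (\<Sum>i\<in>{1..\<theta>}. single [i] (module.representation s (x ` {1..\<theta>}) v (x i)))"

fun word_act ::
  "('k::field \<Rightarrow> 'v::ab_group_add \<Rightarrow> 'v) \<Rightarrow> ('g \<Rightarrow> 'v \<Rightarrow> 'v) \<Rightarrow> nat \<Rightarrow> (nat \<Rightarrow> 'v) \<Rightarrow> 'g \<Rightarrow> nat list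
    \<Rightarrow> (nat list \<Rightarrow>\<^sub>0 'k)"
where
  "word_act s a \<theta> x g [] = single [] 1"
| "word_act s a \<theta> x g (i # w) = tmul (tvec s \<theta> x (a g (x i))) (word_act s a \<theta> x g w)"

fun word_deg :: "('g, 'm) monoid_scheme \<Rightarrow> (nat \<Rightarrow> 'g) \<Rightarrow> nat list \<Rightarrow> 'g" where
  "word_deg \<Gamma> gd [] = \<one>\<^bsub>\<Gamma>\<^esub>"
| "word_deg \<Gamma> gd (i # w) = gd i \<otimes>\<^bsub>\<Gamma>\<^esub> word_deg \<Gamma> gd w"

definition tact ::
  "('k::field \<Rightarrow> 'v::ab_group_add \<Rightarrow> 'v) \<Rightarrow> ('g \<Rightarrow> 'v \<Rightarrow> 'v) \<Rightarrow> nat \<Rightarrow> (nat \<Rightarrow> 'v) \<Rightarrow> 'g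
    \<Rightarrow> (nat list \<Rightarrow>\<^sub>0 'k) \<Rightarrow> (nat list \<Rightarrow>\<^sub>0 'k)"
where
  "tact s a \<theta> x g t = lsum fscale t (word_act s a \<theta> x g)"

text \<open>
  The letters are primitive, so the coproduct of \<open>x i w\<close> is
  \<open>(x i \<otimes> 1 + 1 \<otimes> x i) (w(1) \<otimes> w(2)) = x i w(1) \<otimes> w(2) + (gd i \<cdot> w(1)) \<otimes> x i w(2)\<close>.
\<close>

fun word_comul ::
  "('k::field \<Rightarrow> 'v::ab_group_add \<Rightarrow> 'v) \<Rightarrow> ('g \<Rightarrow> 'v \<Rightarrow> 'v) \<Rightarrow> nat \<Rightarrow> (nat \<Rightarrow> 'v) \<Rightarrow> (nat \<Rightarrow> 'g) \<Rightarrow> nat list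
    \<Rightarrow> ((nat list \<Rightarrow>\<^sub>0 'k) \<times> (nat list \<Rightarrow>\<^sub>0 'k) \<Rightarrow>\<^sub>0 'k)"
where
  "word_comul s a \<theta> x gd [] = pure (single [] 1) (single [] 1)"
| "word_comul s a \<theta> x gd (i # w) =
     lsum fscale (word_comul s a \<theta> x gd w) (\<lambda>(u, v).
       pure (tmul (single [i] 1) u) v + pure (tact s a \<theta> x (gd i) u) (tmul (single [i] 1) v))"

definition tensor_algebra ::
  "('g, 'm) monoid_scheme \<Rightarrow> ('k::field \<Rightarrow> 'v::ab_group_add \<Rightarrow> 'v) \<Rightarrow> ('g \<Rightarrow> 'v \<Rightarrow> 'v) \<Rightarrow> nat
    \<Rightarrow> (nat \<Rightarrow> 'v) \<Rightarrow> (nat \<Rightarrow> 'g) \<Rightarrow> ('k, nat list \<Rightarrow>\<^sub>0 'k, 'g) yd_hopf_data"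
where
  "tensor_algebra \<Gamma> s a \<theta> x gd =
     \<lparr>space = {t. \<forall>w\<in>keys t. set w \<subseteq> {1..\<theta>}},
      smul = fscale,
      mul = tmul,
      unt = single [] 1,
      comul = (\<lambda>t. lsum fscale t (word_comul s a \<theta> x gd)),
      counit = (\<lambda>t. lookup t []),
      act = tact s a \<theta> x,
      coact = (\<lambda>t. \<Sum>w\<in>keys t. single (word_deg \<Gamma> gd w) (single w (lookup t w))),
      gr = (\<lambda>n. {t. \<forall>w\<in>keys t. set w \<subseteq> {1..\<theta>} \<and> length w = n})\<rparr>"

definition ideal_generated ::
  "('k::field, 'a::ab_group_add, 'z) hopf_data_scheme \<Rightarrow> 'a set \<Rightarrow> 'a set"
where
  "ideal_generated T X = module.span (smul T)
     {mul T (mul T a y) b | a y b. a \<in> space T \<and> y \<in> X \<and> b \<in> space T}"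

definition coideal :: "('k::field, 'a::ab_group_add, 'z) hopf_data_scheme \<Rightarrow> 'a set \<Rightarrow> bool" where
  "coideal T I \<longleftrightarrow> module.subspace (smul T) I \<and>
     (\<forall>y\<in>I. counit T y = 0 \<and>
        (\<exists>u. keys u \<subseteq> (I \<times> space T) \<union> (space T \<times> I) \<and> comul T y \<approx>\<^bsub>T\<^esub> u))"

text \<open>
  The defining ideal of the Nichols algebra \<open>B(V) = T(V) / nichols_ideal\<close>: the sum of
  all ideals which are coideals and Yetter-Drinfeld submodules and are generated by homogeneous elements
  of degree at least 2.
\<close>

definition nichols_ideal ::
  "('g, 'm) monoid_scheme \<Rightarrow> ('k::field, 'a::ab_group_add, 'g, 'z) yd_hopf_data_scheme \<Rightarrow> 'a set"
where
  "nichols_ideal \<Gamma> T = module.span (smul T)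
     (\<Union>{I. (\<exists>X. X \<subseteq> (\<Union>n\<in>{2..}. gr T n) \<and> I = ideal_generated T X) \<and> coideal T I \<and>
           (\<forall>g\<in>carrier \<Gamma>. \<forall>y\<in>I. act T g y \<in> I \<and> lookup (coact T y) g \<in> I)})"

text \<open>
  A pre-Nichols algebra is a graded Hopf quotient \<open>p : T(V) \<rightarrow> B\<close> such that the projection of
  \<open>T(V)\<close> onto \<open>B(V)\<close> factors through \<open>p\<close>.
\<close>

definition pre_nichols ::
  "('g, 'm) monoid_scheme \<Rightarrow> ('k::field \<Rightarrow> 'v::ab_group_add \<Rightarrow> 'v) \<Rightarrow> ('g \<Rightarrow> 'v \<Rightarrow> 'v) \<Rightarrow> nat
    \<Rightarrow> (nat \<Rightarrow> 'v) \<Rightarrow> (nat \<Rightarrow> 'g) \<Rightarrow> ('k, 'b::ab_group_add, 'g, 'z) yd_hopf_data_scheme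
    \<Rightarrow> ((nat list \<Rightarrow>\<^sub>0 'k) \<Rightarrow> 'b) \<Rightarrow> bool"
where
  "pre_nichols \<Gamma> s a \<theta> x gd B p \<longleftrightarrow>
     (let T = tensor_algebra \<Gamma> s a \<theta> x gd in
        yd_graded_hopf \<Gamma> B \<and> yd_hopf_map \<Gamma> T B p \<and>
        p ` space T = space B \<and> (\<forall>n. p ` gr T n = gr B n) \<and>
        (\<forall>t\<in>space T. \<forall>t'\<in>space T. p t = p t' \<longrightarrow> t - t' \<in> nichols_ideal \<Gamma> T))"


section \<open>Bosonization\<close>

text \<open>
  The underlying space \<open>B \<otimes> k\<Gamma>\<close> is identified with the finitely supported functions from
  \<open>\<Gamma>\<close> to \<open>B\<close>: \<open>x # g\<close> is \<open>single g x\<close>. Multiplication and coproduct are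
  \<open>(x # g) (y # h) = x (g \<cdot> y) # g h\<close> and
  \<open>x # g \<mapsto> (x(1) # x(2)(-1) g) \<otimes> (x(2)(0) # g)\<close>.
\<close>

abbreviation smash :: "'b \<Rightarrow> 'g \<Rightarrow> ('g \<Rightarrow>\<^sub>0 'b::zero)" (infix "#\<^sub>b" 70) where
  "x #\<^sub>b g \<equiv> single g x"

definition bosonization ::
  "('g, 'm) monoid_scheme \<Rightarrow> ('k::field, 'b::ab_group_add, 'g, 'z) yd_hopf_data_scheme
    \<Rightarrow> ('k, 'g \<Rightarrow>\<^sub>0 'b) hopf_data"
where
  "bosonization \<Gamma> B =
     \<lparr>space = {t. keys t \<subseteq> carrier \<Gamma> \<and> (\<forall>g. lookup t g \<in> space B)},
      smul = (\<lambda>c. Poly_Mapping.map (smul B c)),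
      mul = (\<lambda>t u. \<Sum>g\<in>keys t. \<Sum>h\<in>keys u.
        mul B (lookup t g) (act B g (lookup u h)) #\<^sub>b (g \<otimes>\<^bsub>\<Gamma>\<^esub> h)),
      unt = unt B #\<^sub>b \<one>\<^bsub>\<Gamma>\<^esub>,
      comul = (\<lambda>t. \<Sum>g\<in>keys t. sw B fscale (lookup t g) (\<lambda>x1 x2.
        \<Sum>u\<in>keys (coact B x2). pure (x1 #\<^sub>b (u \<otimes>\<^bsub>\<Gamma>\<^esub> g)) (lookup (coact B x2) u #\<^sub>b g))),
      counit = (\<lambda>t. \<Sum>g\<in>keys t. counit B (lookup t g))\<rparr>"

definition boson_pi ::
  "('k::field, 'b::ab_group_add, 'g, 'z) yd_hopf_data_scheme \<Rightarrow> ('g \<Rightarrow> 's) \<Rightarrow> ('g \<Rightarrow>\<^sub>0 'b) \<Rightarrow> ('s \<Rightarrow>\<^sub>0 'k)"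
where
  "boson_pi B \<iota> t = (\<Sum>g\<in>keys t. single (\<iota> g) (counit B (lookup t g)))"

abbreviation grp_emb ::
  "('k::field, 'b::ab_group_add, 'g, 'z) yd_hopf_data_scheme \<Rightarrow> 'g \<Rightarrow> ('g \<Rightarrow>\<^sub>0 'b)"
where
  "grp_emb B g \<equiv> unt B #\<^sub>b g"

definition boson_gamma ::
  "('k::field, 'b::ab_group_add, 'g, 'z) yd_hopf_data_scheme \<Rightarrow> ('g \<Rightarrow> 'g \<Rightarrow> 'k) \<Rightarrow> 'g
    \<Rightarrow> ('g \<Rightarrow>\<^sub>0 'b) \<Rightarrow> 'k"
where
  "boson_gamma B \<Phi> g t = (\<Sum>h\<in>keys t. counit B (lookup t h) * \<Phi> g h)"

text \<open>The same map, with the elements of \<open>\<Gamma>\<close> regarded as group-like elements of the bosonization.\<close>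

definition boson_gamma_H ::
  "('g, 'm) monoid_scheme \<Rightarrow> ('k::field, 'b::ab_group_add, 'g, 'z) yd_hopf_data_scheme
    \<Rightarrow> ('g \<Rightarrow> 'g \<Rightarrow> 'k) \<Rightarrow> ('g \<Rightarrow>\<^sub>0 'b) \<Rightarrow> ('g \<Rightarrow>\<^sub>0 'b) \<Rightarrow> 'k"
where
  "boson_gamma_H \<Gamma> B \<Phi> u = boson_gamma B \<Phi> (inv_into (carrier \<Gamma>) (grp_emb B) u)"

end

theory Submission
  imports Defs
begin

text \<open>
  Since \<open>\<iota>\<close> is trivial on the support, both tensor factors of the coproduct of \<open>x # g\<close> have the same
  degree \<open>\<iota> g\<close>, so that \<open>H\<close> is a \<open>G\<close>-graded Hopf algebra and all axioms only have to be
  tested on homogeneous elements. There \<open>\<Omega>\<close> is a scalar times \<open>\<epsilon> \<otimes> \<epsilon> \<otimes> \<gamma>(\<lambda>(a, b))\<close>: quasi-associativity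
  becomes the commutation rule of \<open>\<gamma>\<close> and the cocycle condition for \<open>\<lambda>\<close>, and the pentagon becomes the condition
  on \<open>\<omega>\<close>. With \<open>L = \<lambda>(inv a, a)\<close>, the antipode in degree \<open>a\<close> is \<open>inv L\<close> times an antipode of \<open>H\<close>, with
  \<open>\<alpha> = \<epsilon>\<close> and \<open>\<beta> = \<omega>(a, inv a, a) \<gamma>(L)\<close>. The commutation rule itself
  is \<open>g \<cdot> x = \<Phi>(g)(x(-1)) x(0)\<close> for \<open>g\<close> in \<open>\<Gamma>0\<close>, which holds on the generators of the tensor algebra by
  assumption and hence on all words, as \<open>\<Phi>(g)\<close> is multiplicative.
\<close>

section \<open>Linear maps and Sweedler sums\<close>

text \<open>Tensors are formal sums compared only through scalar bilinear forms. A Sweedler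
  expression may therefore be rewritten only once it is known to be multilinear on the carrier, and
  this is why linearity is tracked for every auxiliary map. Homogeneity, in contrast, is available
  for the formal sums themselves: the one representing the coproduct of an element of degree
  \<open>a\<close> consists of pairs of degree \<open>a\<close>, so degree-dependent scalars and
  values of \<open>lam\<close> can be substituted under a Sweedler sum.

  A single \<beta> has to fit both the associator and its inverse. This works because the condition
  on \<omega> at (a, inv a, a, inv a) reads \<omega>(a, inv a, a) \<omega>(inv a, a, inv a) =
  \<gamma>(L)(L).

  Two facts about all of \<open>B\<close> are needed: \<iota> kills every degree of its coaction,
  and g in \<Gamma>0 acts through the coaction. Both are transported along the surjection from the
  tensor algebra, where the degree of a word is a product of the g_i. The subgroup generated by the
  g_i is normal by the Yetter-Drinfeld condition, so that \<iota> is a homomorphism on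
  \<Gamma>.\<close>

lemma vector_space_field: "vector_space ((*) :: 'k::field \<Rightarrow> 'k \<Rightarrow> 'k)"
  by unfold_locales (auto simp: algebra_simps)

lemma linI:
  assumes "\<And>x y. x \<in> C \<Longrightarrow> y \<in> C \<Longrightarrow> f (x + y) = f x + f y"
    and "\<And>c x. x \<in> C \<Longrightarrow> f (s c x) = t c (f x)"
  shows "lin C s t f"
  using assms unfolding lin_def by blast

lemma lin_add: "\<lbrakk>lin C s t f; x \<in> C; y \<in> C\<rbrakk> \<Longrightarrow>
      f (x + y) = f x + f y"
  unfolding lin_def by blast

lemma lin_scale: "lin C s t f \<Longrightarrow> x \<in> C \<Longrightarrow> f (s c x) = t c (f x)"
  unfolding lin_def by blast

lemma lin_zero: "lin C s t f \<Longrightarrow> 0 \<in> C \<Longrightarrow> f 0 = 0"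
  using lin_add[of C s t f 0 0] by simp

lemma bilinI:
  assumes "\<And>x. x \<in> C \<Longrightarrow> lin D t r (\<lambda>y. f x y)" "\<And>y. y \<in> D \<Longrightarrow> lin C s r (\<lambda>x. f x y)"
  shows "bilin C s D t r f"
  using assms unfolding bilin_def by blast

lemma bilin_left: "bilin C s D t r f \<Longrightarrow> y \<in> D \<Longrightarrow> lin C s r (\<lambda>x. f x y)"
  and bilin_right: "bilin C s D t r f \<Longrightarrow> x \<in> C \<Longrightarrow> lin D t r (\<lambda>y. f x y)"
  unfolding bilin_def by blast+

lemma vec_sp_closed:
  assumes "vec_sp C s"
  shows "0 \<in> C" "x \<in> C \<Longrightarrow> y \<in> C \<Longrightarrow> x + y \<in> C" "x \<in> C \<Longrightarrow> s c x \<in> C"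
    "(\<And>i. i \<in> I \<Longrightarrow> F i \<in> C) \<Longrightarrow> sum F I \<in> C"
proof -
  interpret vector_space s using assms by (simp add: vec_sp_def)
  have "subspace C" using assms by (simp add: vec_sp_def)
  thus "0 \<in> C" "x \<in> C \<Longrightarrow> y \<in> C \<Longrightarrow> x + y \<in> C" "x \<in> C \<Longrightarrow> s c x \<in> C"
    "(\<And>i. i \<in> I \<Longrightarrow> F i \<in> C) \<Longrightarrow> sum F I \<in> C"
    by (auto intro: subspace_0 subspace_add subspace_scale subspace_sum)
qed

lemma lin_sum:
  assumes "lin C s t f" "vec_sp C s" "\<And>i. i \<in> I \<Longrightarrow> F i \<in> C"
  shows "f (sum F I) = (\<Sum>i\<in>I. f (F i))"
  using assms(3)
proof (induction I rule: infinite_finite_induct)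
  case (insert i I)
  have "sum F I \<in> C" using insert by (intro vec_sp_closed(4)[OF assms(2)]) auto
  then show ?case using insert by (simp add: lin_add[OF assms(1)])
qed (auto intro: lin_zero[OF assms(1)] vec_sp_closed(1)[OF assms(2)])

context vector_space
begin

lemma lsum_on_superset:
  assumes "finite A" "keys u \<subseteq> A"
  shows "lsum scale u F = (\<Sum>x\<in>A. scale (lookup u x) (F x))"
  unfolding lsum_def using assms
  by (intro sum.mono_neutral_left) (auto simp: in_keys_iff)

lemma lsum_plus: "lsum scale (u + v) F = lsum scale u F + lsum scale v F"
proof -
  let ?A = "keys u \<union> keys v"
  have "lsum scale (u + v) F = (\<Sum>x\<in>?A. scale (lookup (u + v) x) (F x))"
    by (rule lsum_on_superset) (auto dest: subsetD[OF Poly_Mapping.keys_add])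
  thus ?thesis
    by (simp add: lsum_on_superset[of ?A] lookup_add scale_left_distrib sum.distrib)
qed

lemma lsum_0 [simp]: "lsum scale 0 F = 0"
  by (simp add: lsum_def)

lemma lsum_Sum: "lsum scale (sum u I) F = (\<Sum>i\<in>I. lsum scale (u i) F)"
  by (induction I rule: infinite_finite_induct) (auto simp: lsum_plus)

lemma lsum_scaled: "lsum scale (fscale c u) F = scale c (lsum scale u F)"
proof -
  have "lsum scale (fscale c u) F = (\<Sum>x\<in>keys u. scale (lookup (fscale c u) x) (F x))"
    by (rule lsum_on_superset) (auto simp: in_keys_iff)
  thus ?thesis by (simp add: lsum_def scale_sum_right)
qed

lemma lsum_of_single [simp]: "lsum scale (single x c) F = scale c (F x)"
  by (simp add: lsum_def)

lemma lsum_lsum: "lsum scale (lsum fscale u F) K = lsum scale u (\<lambda>x. lsum scale (F x) K)"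
  by (simp add: lsum_def[of fscale] lsum_def[of scale u] lsum_Sum lsum_scaled)

lemma lsum_fun_add: "lsum scale u (\<lambda>x. F x + K x) = lsum scale u F + lsum scale u K"
  by (simp add: lsum_def scale_right_distrib sum.distrib)

lemma lsum_fun_scale: "lsum scale u (\<lambda>x. scale c (F x)) = scale c (lsum scale u F)"
  by (simp add: lsum_def scale_sum_right mult.commute)

lemma lsum_linear:
  assumes "lin C scale t T" "vec_sp C scale" "\<And>x. x \<in> keys u \<Longrightarrow> F x \<in> C"
  shows "T (lsum scale u F) = lsum t u (\<lambda>x. T (F x))"
proof -
  have "T (lsum scale u F) = (\<Sum>x\<in>keys u. T (scale (lookup u x) (F x)))"
    unfolding lsum_def by (rule lin_sum[OF assms(1,2)]) (auto intro!: vec_sp_closed(3)[OF assms(2)] assms(3))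
  also have "\<dots> = lsum t u (\<lambda>x. T (F x))"
    unfolding lsum_def by (intro sum.cong refl lin_scale[OF assms(1)] assms(3))
  finally show ?thesis .
qed

text \<open>Equality of tensors is tested on scalar forms only; membership in the span of the
  bilinear relations carries it over to bilinear maps into any vector space.\<close>

lemma tens_eq_lsum:
  assumes "tens_eq C s D t u v" "bilin C s D t scale f"
  shows "lsum scale u (\<lambda>(a,b). f a b) = lsum scale v (\<lambda>(a,b). f a b)"
proof -
  interpret F: vector_space "fscale :: 'a \<Rightarrow> ('c \<times> 'd \<Rightarrow>\<^sub>0 'a) \<Rightarrow> _"
    by (rule vector_space_fscale)
  let ?L = "\<lambda>w. lsum scale w (\<lambda>(a,b). f a b)"
  have diff: "?L (w - w') = ?L w - ?L w'" for w w'
    using lsum_plus[of "w - w'" w'] by (simp add: algebra_simps)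
  have "u - v \<in> F.span (bilin_relations C s D t)"
    using assms(1) by (simp add: tens_eq_iff_relations)
  hence "?L (u - v) = 0"
  proof (induction rule: F.span_induct_alt)
    case (step c x y)
    have "?L x = 0"
      using step(1) assms(2) unfolding bilin_relations_def bilin_def lin_def
      by (auto simp: diff lsum_scaled)
    thus ?case using step by (simp add: lsum_plus lsum_scaled)
  qed simp
  thus ?thesis by (simp add: diff)
qed

text \<open>Reduces vector-valued identities to scalar ones, since coassociativity is postulated for
  scalar trilinear forms. A nonzero difference x - y is independent, so some functional takes the
  value 1 on it.\<close>

lemma functionals_separate:
  assumes "\<And>\<phi>. lin UNIV scale (*) \<phi> \<Longrightarrow> \<phi> x = \<phi> y"
  shows "x = y"
proof (rule ccontr)
  interpret K: vector_space "(*) :: 'a \<Rightarrow> 'a \<Rightarrow> 'a" by (rule vector_space_field)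
  interpret P: vector_space_pair scale "(*) :: 'a \<Rightarrow> 'a \<Rightarrow> 'a" ..
  assume "x \<noteq> y"
  hence ind: "independent {x - y}" by (simp add: dependent_single)
  obtain \<phi> where \<phi>: "Vector_Spaces.linear scale (*) \<phi>" "\<phi> (x - y) = 1"
    using P.linear_independent_extend[OF ind, of "\<lambda>_. 1"] by auto
  interpret L: Vector_Spaces.linear scale "(*)" \<phi> by (rule \<phi>(1))
  have "lin UNIV scale (*) \<phi>" by (rule linI) (auto simp: L.add L.scale)
  from assms[OF this] have "\<phi> (x - y) = 0" by (simp add: L.diff)
  thus False using \<phi>(2) by simp
qed

end

lemma lsum_cong: "(\<And>x. x \<in> keys u \<Longrightarrow> F x = K x) \<Longrightarrow> lsum s u F = lsum s u K"
  by (simp add: lsum_def)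

lemma lsum_closed:
  assumes "vec_sp C s" "\<And>x. x \<in> keys u \<Longrightarrow> F x \<in> C"
  shows "lsum s u F \<in> C"
  unfolding lsum_def by (intro vec_sp_closed(3,4)[OF assms(1)] assms(2))

text \<open>For coproducts that are themselves given by Sweedler sums of formal tensors, such as
  that of a product: an evaluation on pairs passes inside the sum.\<close>

lemma sw_lsum:
  assumes "vector_space r"
  shows "lsum r (sw H fscale h F) K = sw H r h (\<lambda>a b. lsum r (F a b) K)"
  unfolding sw_def vector_space.lsum_lsum[OF assms] by (simp add: case_prod_unfold)

section \<open>Sweedler calculus in a coalgebra\<close>

locale coalg =
  fixes H :: "('k::field, 'a::ab_group_add, 'z) hopf_data_scheme" (structure)
  assumes coalgebra: "coalgebra H"
begin

abbreviation swH :: "'a \<Rightarrow> ('a \<Rightarrow> 'a \<Rightarrow> 'a) \<Rightarrow> 'a" where "swH \<equiv> sw H (smul H)"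
abbreviation swk :: "'a \<Rightarrow> ('a \<Rightarrow> 'a \<Rightarrow> 'k) \<Rightarrow> 'k" where "swk \<equiv> sw H (*)"

lemma H_vec: "vec_sp (space H) (smul H)" and H_vs: "vector_space (smul H)"
  using coalgebra[unfolded coalgebra_def, THEN conjunct1] by (simp_all add: vec_sp_def)

sublocale V: vector_space "smul H" by (rule H_vs)

lemmas H_closed = vec_sp_closed[OF H_vec]

lemma comul_keys_subset: "\<forall>h\<in>space H. keys (comul H h) \<subseteq> space H \<times> space H"
  and comul_add: "\<forall>h\<in>space H. \<forall>k\<in>space H. comul H (h + k) \<approx> comul H h + comul H k"
  and comul_scale: "\<forall>c. \<forall>h\<in>space H. comul H (smul H c h) \<approx> fscale c (comul H h)"
  and counit_lin: "lin (space H) (smul H) (*) (counit H)"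
  and comul_coassoc: "\<forall>h\<in>space H. \<forall>f. trilin_form (space H) (smul H) f \<longrightarrow>
        swk h (\<lambda>r h3. swk r (\<lambda>h1 h2. f h1 h2 h3)) =
        swk h (\<lambda>h1 r. swk r (\<lambda>h2 h3. f h1 h2 h3))"
  and comul_counit_left: "\<forall>h\<in>space H. swH h (\<lambda>h1 h2. smul H (counit H h1) h2) = h"
  and comul_counit_right: "\<forall>h\<in>space H. swH h (\<lambda>h1 h2. smul H (counit H h2) h1) = h"
  by (rule coalgebra[unfolded coalgebra_def, THEN conjunct2, THEN conjunct1]
      coalgebra[unfolded coalgebra_def, THEN conjunct2, THEN conjunct2, THEN conjunct1]
      coalgebra[unfolded coalgebra_def, THEN conjunct2, THEN conjunct2, THEN conjunct2, THEN conjunct1]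
      coalgebra[unfolded coalgebra_def, THEN conjunct2, THEN conjunct2, THEN conjunct2, THEN conjunct2, THEN conjunct1]
      coalgebra[unfolded coalgebra_def, THEN conjunct2, THEN conjunct2, THEN conjunct2, THEN conjunct2, THEN conjunct2, THEN conjunct1]
      coalgebra[unfolded coalgebra_def, THEN conjunct2, THEN conjunct2, THEN conjunct2, THEN conjunct2, THEN conjunct2, THEN conjunct2, THEN conjunct1]
      coalgebra[unfolded coalgebra_def, THEN conjunct2, THEN conjunct2, THEN conjunct2, THEN conjunct2, THEN conjunct2, THEN conjunct2, THEN conjunct2])+

lemma comul_keys: "h \<in> space H \<Longrightarrow> (a, b) \<in> keys (comul H h) \<Longrightarrow> a \<in> space H \<and> b \<in> space H"
  using comul_keys_subset by blast

lemma sw_cong: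
  assumes "h \<in> space H" "\<And>a b. a \<in> space H \<Longrightarrow> b \<in> space H \<Longrightarrow> F a b = K a b"
  shows "sw H r h F = sw H r h K"
  unfolding sw_def by (rule lsum_cong) (auto dest!: comul_keys[OF assms(1)] simp: assms(2))

lemma sw_closed:
  assumes "h \<in> space H" "vec_sp C r" "\<And>a b. a \<in> space H \<Longrightarrow> b \<in> space H \<Longrightarrow> F a b \<in> C"
  shows "sw H r h F \<in> C"
  unfolding sw_def by (rule lsum_closed[OF assms(2)]) (auto dest!: comul_keys[OF assms(1)] simp: assms(3))

lemma sw_linear:
  assumes "lin C r t T" "vec_sp C r" "h \<in> space H"
    "\<And>a b. a \<in> space H \<Longrightarrow> b \<in> space H \<Longrightarrow> F a b \<in> C"
  shows "T (sw H r h F) = sw H t h (\<lambda>a b. T (F a b))"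
proof -
  interpret R: vector_space r using assms(2) by (simp add: vec_sp_def)
  have "T (sw H r h F) = lsum t (comul H h) (\<lambda>p. T ((\<lambda>(a,b). F a b) p))"
    unfolding sw_def by (rule R.lsum_linear[OF assms(1,2)]) (auto dest!: comul_keys[OF assms(3)] simp: assms(4))
  thus ?thesis unfolding sw_def by (simp add: case_prod_unfold)
qed

text \<open>The coproduct of a sum is the sum of the coproducts only as a tensor, not as a formal
  sum; bilinearity of \<open>F\<close> makes the difference invisible.\<close>

lemma sw_arg_lin:
  assumes "vector_space r" "bilin (space H) (smul H) (space H) (smul H) r F"
  shows "lin (space H) (smul H) r (\<lambda>h. sw H r h F)"
proof (rule linI)
  interpret R: vector_space r by (rule assms(1))
  fix h k assume "h \<in> space H" "k \<in> space H"
  hence "comul H (h + k) \<approx> comul H h + comul H k"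
    using comul_add by blast
  from R.tens_eq_lsum[OF this assms(2)]
  show "sw H r (h + k) F = sw H r h F + sw H r k F" by (simp add: sw_def R.lsum_plus)
next
  interpret R: vector_space r by (rule assms(1))
  fix c h assume "h \<in> space H"
  hence "comul H (smul H c h) \<approx> fscale c (comul H h)"
    using comul_scale by blast
  from R.tens_eq_lsum[OF this assms(2)]
  show "sw H r (smul H c h) F = r c (sw H r h F)" by (simp add: sw_def R.lsum_scaled)
qed

lemma sw_fun_lin:
  assumes "vector_space r" "h \<in> space H"
    "\<And>a b. a \<in> space H \<Longrightarrow> b \<in> space H \<Longrightarrow> lin C s r (\<lambda>x. F x a b)"
  shows "lin C s r (\<lambda>x. sw H r h (F x))"
proof (rule linI)
  interpret R: vector_space r by (rule assms(1))
  fix x y assume "x \<in> C" "y \<in> C"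
  hence "sw H r h (F (x + y)) = sw H r h (\<lambda>a b. F x a b + F y a b)"
    by (intro sw_cong assms(2)) (simp add: lin_add[OF assms(3)])
  thus "sw H r h (F (x + y)) = sw H r h (F x) + sw H r h (F y)"
    by (simp add: sw_def case_prod_unfold R.lsum_fun_add)
next
  interpret R: vector_space r by (rule assms(1))
  fix c x assume "x \<in> C"
  hence "sw H r h (F (s c x)) = sw H r h (\<lambda>a b. r c (F x a b))"
    by (intro sw_cong assms(2)) (simp add: lin_scale[OF assms(3)])
  thus "sw H r h (F (s c x)) = r c (sw H r h (F x))"
    by (simp add: sw_def case_prod_unfold R.lsum_fun_scale)
qed

lemma sw_scale: "vector_space r \<Longrightarrow> sw H r h (\<lambda>a b. r c (F a b)) = r c (sw H r h F)"
  unfolding sw_def case_prod_unfold by (rule vector_space.lsum_fun_scale)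

lemma sw_counit_left:
  assumes "lin (space H) (smul H) r f" "h \<in> space H"
  shows "sw H r h (\<lambda>a b. r (counit H a) (f b)) = f h"
proof -
  have "f h = f (swH h (\<lambda>a b. smul H (counit H a) b))"
    using comul_counit_left assms(2) by simp
  also have "\<dots> = sw H r h (\<lambda>a b. f (smul H (counit H a) b))"
    by (rule sw_linear[OF assms(1) H_vec assms(2)]) (simp add: H_closed)
  also have "\<dots> = sw H r h (\<lambda>a b. r (counit H a) (f b))"
    by (rule sw_cong[OF assms(2)]) (simp add: lin_scale[OF assms(1)])
  finally show ?thesis by simp
qed

lemma sw_counit_right:
  assumes "lin (space H) (smul H) r f" "h \<in> space H"
  shows "sw H r h (\<lambda>a b. r (counit H b) (f a)) = f h"
proof -
  have "f h = f (swH h (\<lambda>a b. smul H (counit H b) a))"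
    using comul_counit_right assms(2) by simp
  also have "\<dots> = sw H r h (\<lambda>a b. f (smul H (counit H b) a))"
    by (rule sw_linear[OF assms(1) H_vec assms(2)]) (simp add: H_closed)
  also have "\<dots> = sw H r h (\<lambda>a b. r (counit H b) (f a))"
    by (rule sw_cong[OF assms(2)]) (simp add: lin_scale[OF assms(1)])
  finally show ?thesis by simp
qed

text \<open>Every functional \<phi> on the target turns \<open>F\<close> into a scalar trilinear
  form, to which the coassociativity axiom applies, and functionals separate points of the
  target.\<close>

lemma sw_coassoc:
  assumes r: "vector_space r" and h: "h \<in> space H"
    and F: "\<And>a b. a \<in> space H \<Longrightarrow> b \<in> space H \<Longrightarrow> lin (space H) (smul H) r (\<lambda>c. F a b c)"
      "\<And>a c. a \<in> space H \<Longrightarrow> c \<in> space H \<Longrightarrow> lin (space H) (smul H) r (\<lambda>b. F a b c)"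
      "\<And>b c. b \<in> space H \<Longrightarrow> c \<in> space H \<Longrightarrow> lin (space H) (smul H) r (\<lambda>a. F a b c)"
  shows "sw H r h (\<lambda>d c. sw H r d (\<lambda>a b. F a b c)) = sw H r h (\<lambda>a d. sw H r d (\<lambda>b c. F a b c))"
proof (rule vector_space.functionals_separate[OF r])
  fix \<phi> assume \<phi>: "lin UNIV r (*) \<phi>"
  interpret R: vector_space r by (rule r)
  have U: "vec_sp UNIV r"
    unfolding vec_sp_def using r R.subspace_UNIV by (rule conjI)
  have push: "\<phi> (sw H r k L) = swk k (\<lambda>a b. \<phi> (L a b))" if "k \<in> space H" for k L
    by (rule sw_linear[OF \<phi> U that]) simp
  have comp: "lin (space H) (smul H) (*) (\<lambda>a. \<phi> (f a))" if "lin (space H) (smul H) r f" for f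
    by (rule linI) (simp_all add: lin_add[OF that] lin_scale[OF that] lin_add[OF \<phi>] lin_scale[OF \<phi>])
  have "trilin_form (space H) (smul H) (\<lambda>a b c. \<phi> (F a b c))"
    unfolding trilin_form_def by (auto intro!: comp F)
  hence "swk h (\<lambda>d c. swk d (\<lambda>a b. \<phi> (F a b c))) = swk h (\<lambda>a d. swk d (\<lambda>b c. \<phi> (F a b c)))"
    using comul_coassoc h by blast
  moreover have "\<phi> (sw H r h (\<lambda>d c. sw H r d (\<lambda>a b. F a b c))) = swk h (\<lambda>d c. swk d (\<lambda>a b. \<phi> (F a b c)))"
    unfolding push[OF h] by (rule sw_cong[OF h]) (simp add: push)
  moreover have "\<phi> (sw H r h (\<lambda>a d. sw H r d (\<lambda>b c. F a b c))) = swk h (\<lambda>a d. swk d (\<lambda>b c. \<phi> (F a b c)))"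
    unfolding push[OF h] by (rule sw_cong[OF h]) (simp add: push)
  ultimately show "\<phi> (sw H r h (\<lambda>d c. sw H r d (\<lambda>a b. F a b c))) = \<phi> (sw H r h (\<lambda>a d. sw H r d (\<lambda>b c. F a b c)))"
    by simp
qed

text \<open>Closure and linearity travel together because both are needed, on the carrier only,
  whenever a map is pulled through a Sweedler sum. The introduction rules below then settle such
  side conditions by composition.\<close>

definition endo :: "('a \<Rightarrow> 'a) \<Rightarrow> bool" where
  "endo f \<longleftrightarrow> (\<forall>x\<in>space H. f x \<in> space H) \<and> lin (space H) (smul H) (smul H) f"

abbreviation form :: "('a \<Rightarrow> 'k) \<Rightarrow> bool" where
  "form f \<equiv> lin (space H) (smul H) (*) f"

abbreviation scal (infixr "\<cdot>" 75) where "c \<cdot> x \<equiv> smul H c x"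

lemma endoI: "(\<And>x. x \<in> space H \<Longrightarrow> f x \<in> space H) \<Longrightarrow> lin (space H) (smul H) (smul H) f \<Longrightarrow> endo f"
  by (simp add: endo_def)

lemma endo_closed: "endo f \<Longrightarrow> x \<in> space H \<Longrightarrow> f x \<in> space H"
  and endo_lin: "endo f \<Longrightarrow> lin (space H) (smul H) (smul H) f"
  by (simp_all add: endo_def)

lemma endo_comp: "endo f \<Longrightarrow> endo g \<Longrightarrow> endo (\<lambda>x. f (g x))"
  by (simp add: endo_def lin_def)

lemma form_comp: "form f \<Longrightarrow> endo g \<Longrightarrow> form (\<lambda>x. f (g x))"
  by (simp add: endo_def lin_def)

lemma endo_id: "endo (\<lambda>x. x)"
  by (simp add: endo_def lin_def)

lemma endo_scale: "endo f \<Longrightarrow> endo (\<lambda>x. c \<cdot> f x)"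
  by (simp add: endo_def lin_def H_closed V.scale_right_distrib mult.commute)

lemma endo_form: "form f \<Longrightarrow> y \<in> space H \<Longrightarrow> endo (\<lambda>x. f x \<cdot> y)"
  by (simp add: endo_def lin_def H_closed V.scale_left_distrib)

lemma form_mult_left: "form f \<Longrightarrow> form (\<lambda>x. c * f x)"
  and form_mult_right: "form f \<Longrightarrow> form (\<lambda>x. f x * c)"
  by (simp_all add: lin_def algebra_simps)

lemma endo_sw:
  "h \<in> space H \<Longrightarrow> (\<And>a b. a \<in> space H \<Longrightarrow> b \<in> space H \<Longrightarrow> endo (\<lambda>x. F x a b))
    \<Longrightarrow> endo (\<lambda>x. swH h (F x))"
  by (intro endoI sw_fun_lin sw_closed H_vec H_vs) (auto intro: endo_lin endo_closed)

lemma endo_sw_arg: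
  "(\<And>a. a \<in> space H \<Longrightarrow> endo (\<lambda>b. F a b)) \<Longrightarrow> (\<And>b. b \<in> space H \<Longrightarrow> endo (\<lambda>a. F a b))
    \<Longrightarrow> endo (\<lambda>h. swH h F)"
  by (intro endoI sw_arg_lin sw_closed bilinI H_vec H_vs) (auto intro: endo_lin endo_closed)

lemma form_sw:
  "h \<in> space H \<Longrightarrow> (\<And>a b. a \<in> space H \<Longrightarrow> b \<in> space H \<Longrightarrow> form (\<lambda>x. F x a b))
    \<Longrightarrow> form (\<lambda>x. swk h (F x))"
  by (intro sw_fun_lin vector_space_field)

lemma form_sw_arg:
  "(\<And>a. a \<in> space H \<Longrightarrow> form (\<lambda>b. F a b)) \<Longrightarrow> (\<And>b. b \<in> space H \<Longrightarrow> form (\<lambda>a. F a b))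
    \<Longrightarrow> form (\<lambda>h. swk h F)"
  by (intro sw_arg_lin bilinI vector_space_field)

lemmas linear_intros = endo_id endo_scale endo_form form_mult_left form_mult_right
  endo_sw endo_sw_arg form_sw form_sw_arg counit_lin

lemma sw_endo:
  "endo T \<Longrightarrow> h \<in> space H \<Longrightarrow> (\<And>a b. a \<in> space H \<Longrightarrow> b \<in> space H \<Longrightarrow> F a b \<in> space H) \<Longrightarrow>
    T (swH h F) = swH h (\<lambda>a b. T (F a b))"
  by (rule sw_linear[OF endo_lin H_vec])

lemma sw_form:
  "form T \<Longrightarrow> h \<in> space H \<Longrightarrow> (\<And>a b. a \<in> space H \<Longrightarrow> b \<in> space H \<Longrightarrow> F a b \<in> space H) \<Longrightarrow>
    T (swH h F) = swk h (\<lambda>a b. T (F a b))"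
  by (rule sw_linear[OF _ H_vec])

lemmas sw_counit_right_endo = sw_counit_right[OF endo_lin]
  and sw_counit_left_endo = sw_counit_left[OF endo_lin]

lemma sw_mult_left: "swk h (\<lambda>a b. c * F a b) = c * swk h F"
  by (rule sw_scale[OF vector_space_field])

end

section \<open>Sweedler calculus in a Hopf algebra\<close>

locale hopf = coalg H
  for H :: "('k::field, 'a::ab_group_add, 'z) hopf_data_scheme" (structure) +
  assumes hopf: "hopf_algebra H"
begin

abbreviation prd (infixl "\<odot>" 70) where "x \<odot> y \<equiv> mul H x y"

lemma bialg: "bialgebra H"
  using hopf by (simp add: hopf_algebra_def)

lemma alg: "algebra H"
  by (rule bialg[unfolded bialgebra_def, THEN conjunct2, THEN conjunct1])

lemma mul_closed: "x \<in> space H \<Longrightarrow> y \<in> space H \<Longrightarrow> x \<odot> y \<in> space H"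
  and mul_bilin: "bilin (space H) (smul H) (space H) (smul H) (smul H) (mul H)"
  and unt_closed: "unt H \<in> space H"
  and mul_assoc: "\<lbrakk>x \<in> space H; y \<in> space H; z \<in> space H\<rbrakk> \<Longrightarrow>
      x \<odot> y \<odot> z = x \<odot> (y \<odot> z)"
  and unt_left: "x \<in> space H \<Longrightarrow> unt H \<odot> x = x"
  and unt_right: "x \<in> space H \<Longrightarrow> x \<odot> unt H = x"
  using alg unfolding algebra_def by blast+

lemma comul_mul: "\<forall>h\<in>space H. \<forall>k\<in>space H. comul H (h \<odot> k) \<approx>
      sw H fscale h (\<lambda>h1 h2. sw H fscale k (\<lambda>k1 k2. pure (h1 \<odot> k1) (h2 \<odot> k2)))"
  and comul_unt: "comul H (unt H) \<approx> pure (unt H) (unt H)"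
  and counit_mul_all: "\<forall>h\<in>space H. \<forall>k\<in>space H. counit H (h \<odot> k) = counit H h * counit H k"
  and counit_unt: "counit H (unt H) = 1"
  by (rule bialg[unfolded bialgebra_def, THEN conjunct2, THEN conjunct2, THEN conjunct1]
     bialg[unfolded bialgebra_def, THEN conjunct2, THEN conjunct2, THEN conjunct2, THEN conjunct1]
     bialg[unfolded bialgebra_def, THEN conjunct2, THEN conjunct2, THEN conjunct2, THEN conjunct2, THEN conjunct1]
     bialg[unfolded bialgebra_def, THEN conjunct2, THEN conjunct2, THEN conjunct2, THEN conjunct2, THEN conjunct2])+

lemma counit_mul: "h \<in> space H \<Longrightarrow> k \<in> space H \<Longrightarrow> counit H (h \<odot> k) = counit H h * counit H k"
  using counit_mul_all by blast

lemma endo_mul_left: "endo f \<Longrightarrow> y \<in> space H \<Longrightarrow> endo (\<lambda>x. f x \<odot> y)"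
  and endo_mul_right: "endo f \<Longrightarrow> y \<in> space H \<Longrightarrow> endo (\<lambda>x. y \<odot> f x)"
  using mul_bilin unfolding endo_def bilin_def lin_def by (simp_all add: mul_closed)

lemma mul_scale_left: "x \<in> space H \<Longrightarrow> y \<in> space H \<Longrightarrow> (c \<cdot> x) \<odot> y = c \<cdot> (x \<odot> y)"
  and mul_scale_right: "x \<in> space H \<Longrightarrow> y \<in> space H \<Longrightarrow> x \<odot> (c \<cdot> y) = c \<cdot> (x \<odot> y)"
  using mul_bilin unfolding bilin_def lin_def by blast+

lemmas mul_linear_intros = linear_intros endo_mul_left endo_mul_right
lemmas closed = mul_closed unt_closed H_closed(1-3)

lemma sw_mul:
  assumes "vector_space r" "h \<in> space H" "k \<in> space H" "bilin (space H) (smul H) (space H) (smul H) r f"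
  shows "sw H r (h \<odot> k) f = sw H r h (\<lambda>h1 h2. sw H r k (\<lambda>k1 k2. f (h1 \<odot> k1) (h2 \<odot> k2)))"
proof -
  interpret R: vector_space r by (rule assms(1))
  have "comul H (h \<odot> k) \<approx>
      sw H fscale h (\<lambda>h1 h2. sw H fscale k (\<lambda>k1 k2. pure (h1 \<odot> k1) (h2 \<odot> k2)))"
    using comul_mul assms(2,3) by blast
  from R.tens_eq_lsum[OF this assms(4)] show ?thesis
    by (simp add: sw_def[of H r "h \<odot> k"] sw_lsum[OF assms(1)])
qed

end

section \<open>Graded Hopf algebras\<close>

text \<open>\<open>E s\<close> is the component of degree s and \<open>P s\<close> the projection
  onto it. \<open>comul_E\<close> puts both tensor factors in the degree of the element itself: this
  is the grading that comes from a cocentral map, not the additive one of a graded coalgebra. It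
  speaks of the formal sum, so that the factors of a coproduct may be taken homogeneous.\<close>

locale graded_hopf = hopf H
  for H :: "('k::field, 'a::ab_group_add, 'z) hopf_data_scheme" (structure) +
  fixes G :: "('s, 'n) monoid_scheme" and E :: "'s \<Rightarrow> 'a set" and P :: "'s \<Rightarrow> 'a \<Rightarrow> 'a"
  assumes G: "group G"
    and E_sub: "s \<in> carrier G \<Longrightarrow> h \<in> E s \<Longrightarrow> h \<in> space H"
    and P_endo: "s \<in> carrier G \<Longrightarrow> endo (P s)"
    and P_in: "s \<in> carrier G \<Longrightarrow> h \<in> space H \<Longrightarrow> P s h \<in> E s"
    and P_E: "\<lbrakk>s \<in> carrier G; a \<in> carrier G; h \<in> E a\<rbrakk> \<Longrightarrow>
      P s h = (if s = a then h else 0)"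
    and P_finite: "h \<in> space H \<Longrightarrow> finite {s \<in> carrier G. P s h \<noteq> 0}"
    and P_sum: "h \<in> space H \<Longrightarrow> (\<Sum>s\<in>{s \<in> carrier G. P s h \<noteq> 0}. P s h) = h"
    and comul_E: "a \<in> carrier G \<Longrightarrow> h \<in> E a \<Longrightarrow> keys (comul H h) \<subseteq> E a \<times> E a"
    and mul_E: "\<lbrakk>a \<in> carrier G; b \<in> carrier G; h \<in> E a; k \<in> E b\<rbrakk> \<Longrightarrow>
      h \<odot> k \<in> E (a \<otimes>\<^bsub>G\<^esub> b)"
    and unt_E: "unt H \<in> E \<one>\<^bsub>G\<^esub>"
begin

sublocale G: group G by (rule G)

lemma sw_congE:
  assumes "a \<in> carrier G" "h \<in> E a" "\<And>x y. x \<in> E a \<Longrightarrow> y \<in> E a \<Longrightarrow> F x y = K x y"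
  shows "sw H r h F = sw H r h K"
  unfolding sw_def
  by (rule lsum_cong) (use comul_E[OF assms(1,2)] in \<open>auto simp: assms(3)\<close>)

lemma homog_eq:
  assumes f: "lin (space H) (smul H) r f" and g: "lin (space H) (smul H) r g"
    and eq: "\<And>a h. a \<in> carrier G \<Longrightarrow> h \<in> E a \<Longrightarrow> f h = g h" and h: "h \<in> space H"
  shows "f h = g h"
proof -
  let ?D = "{s \<in> carrier G. P s h \<noteq> 0}"
  have P: "P s h \<in> space H" if "s \<in> ?D" for s using that h by (auto intro: endo_closed P_endo)
  have "f (\<Sum>s\<in>?D. P s h) = (\<Sum>s\<in>?D. f (P s h))"
    by (rule lin_sum[OF f H_vec]) (rule P)
  also have "\<dots> = (\<Sum>s\<in>?D. g (P s h))"
    by (rule sum.cong) (auto intro: eq P_in h)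
  also have "\<dots> = g (\<Sum>s\<in>?D. P s h)"
    by (rule lin_sum[OF g H_vec, symmetric]) (rule P)
  finally have "f (\<Sum>s\<in>?D. P s h) = g (\<Sum>s\<in>?D. P s h)" .
  thus ?thesis by (simp add: P_sum h)
qed

text \<open>The universal property of the direct sum of the components: \<open>f s\<close>
  prescribes the map in degree s. The product, the associator, its inverse, the antipode and \<beta>
  are all obtained in this way.\<close>

definition glue :: "('s \<Rightarrow> 'a \<Rightarrow> 'v) \<Rightarrow> 'a \<Rightarrow> 'v::ab_group_add" where
  "glue f h = (\<Sum>s\<in>{s \<in> carrier G. P s h \<noteq> 0}. f s (P s h))"

text \<open>The set of degrees occurring in h varies with h, so values at different elements are
  compared over a common finite index set; the additional terms are
  \<open>f s 0 = 0\<close>.\<close>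

lemma glue_on_superset:
  assumes "finite A" "A \<subseteq> carrier G" "{s \<in> carrier G. P s h \<noteq> 0} \<subseteq> A"
    and "\<And>s. s \<in> carrier G \<Longrightarrow> lin (space H) (smul H) r (f s)"
  shows "glue f h = (\<Sum>s\<in>A. f s (P s h))"
  unfolding glue_def using assms(1-3) lin_zero[OF assms(4) H_closed(1)]
  by (intro sum.mono_neutral_left) auto

lemma glue_lin:
  assumes r: "vector_space r" and f: "\<And>s. s \<in> carrier G \<Longrightarrow> lin (space H) (smul H) r (f s)"
  shows "lin (space H) (smul H) r (glue f)"
proof (rule linI)
  interpret R: vector_space r by (rule r)
  fix x y assume x: "x \<in> space H" and y: "y \<in> space H"
  let ?A = "{s \<in> carrier G. P s x \<noteq> 0} \<union> {s \<in> carrier G. P s y \<noteq> 0}"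
  have add: "P s (x + y) = P s x + P s y" if "s \<in> carrier G" for s
    by (rule lin_add[OF endo_lin[OF P_endo[OF that]] x y])
  have "glue f (x + y) = (\<Sum>s\<in>?A. f s (P s (x + y)))"
    by (rule glue_on_superset[OF _ _ _ f]) (auto simp: P_finite x y add)
  also have "\<dots> = (\<Sum>s\<in>?A. f s (P s x) + f s (P s y))"
    by (rule sum.cong) (auto simp: add intro!: lin_add[OF f] endo_closed[OF P_endo] x y)
  also have "\<dots> = glue f x + glue f y"
    unfolding sum.distrib
    by (intro arg_cong2[where f = "(+)"] glue_on_superset[symmetric, OF _ _ _ f]) (auto simp: P_finite x y)
  finally show "glue f (x + y) = glue f x + glue f y" .
next
  interpret R: vector_space r by (rule r)
  fix c x assume x: "x \<in> space H"
  let ?A = "{s \<in> carrier G. P s x \<noteq> 0}"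
  have sc: "P s (c \<cdot> x) = c \<cdot> P s x" if "s \<in> carrier G" for s
    by (rule lin_scale[OF endo_lin[OF P_endo[OF that]] x])
  have "glue f (c \<cdot> x) = (\<Sum>s\<in>?A. f s (P s (c \<cdot> x)))"
    by (rule glue_on_superset[OF _ _ _ f]) (auto simp: P_finite x sc)
  also have "\<dots> = (\<Sum>s\<in>?A. r c (f s (P s x)))"
    by (rule sum.cong) (auto simp: sc intro!: lin_scale[OF f] endo_closed[OF P_endo] x)
  also have "\<dots> = r c (glue f x)"
    by (simp add: glue_def R.scale_sum_right)
  finally show "glue f (c \<cdot> x) = r c (glue f x)" .
qed

lemma glue_E:
  assumes "a \<in> carrier G" "h \<in> E a" "\<And>s. s \<in> carrier G \<Longrightarrow> lin (space H) (smul H) r (f s)"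
  shows "glue f h = f a h"
proof -
  have z: "P s h = (if s = a then h else 0)" if "s \<in> carrier G" for s
    by (rule P_E[OF that assms(1,2)])
  have "glue f h = (\<Sum>s\<in>{a}. f s (P s h))"
    by (rule glue_on_superset[OF _ _ _ assms(3)]) (auto simp: z assms(1) split: if_splits)
  thus ?thesis using assms by (simp add: P_E)
qed

lemma glue_fun_lin:
  assumes r: "vector_space r" and f: "\<And>s. s \<in> carrier G \<Longrightarrow> lin C t r (\<lambda>x. f x s (P s h))"
  shows "lin C t r (\<lambda>x. glue (f x) h)"
proof -
  interpret R: vector_space r by (rule r)
  show ?thesis
    by (rule linI)
      (auto simp: glue_def R.scale_sum_right lin_add[OF f] lin_scale[OF f] simp flip: sum.distrib
        intro!: sum.cong)
qed

text \<open>With c = inv a this turns the degree \<one> part of S(h1) h2 into the degree inv a part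
  of S(h1), times h2.\<close>

lemma P_mul_right:
  assumes c: "c \<in> carrier G" and a: "a \<in> carrier G" and y: "y \<in> E a" and x: "x \<in> space H"
  shows "P (c \<otimes>\<^bsub>G\<^esub> a) (x \<odot> y) = P c x \<odot> y"
proof -
  note yS = E_sub[OF a y]
  have ca: "c \<otimes>\<^bsub>G\<^esub> a \<in> carrier G" using c a by simp
  show ?thesis
  proof (rule homog_eq[where f = "\<lambda>x. P (c \<otimes>\<^bsub>G\<^esub> a) (x \<odot> y)" and g = "\<lambda>x. P c x \<odot> y"])
    show "lin (space H) (smul H) (smul H) (\<lambda>x. P (c \<otimes>\<^bsub>G\<^esub> a) (x \<odot> y))"
      by (rule endo_lin[OF endo_comp[OF P_endo[OF ca]]]) (intro mul_linear_intros yS)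
    show "lin (space H) (smul H) (smul H) (\<lambda>x. P c x \<odot> y)"
      by (intro endo_lin endo_mul_left P_endo c yS)
    fix b h assume "b \<in> carrier G" "h \<in> E b"
    thus "P (c \<otimes>\<^bsub>G\<^esub> a) (h \<odot> y) = P c h \<odot> y"
      using P_E[OF ca _ mul_E[OF _ a _ y], of b h] P_E[OF c, of b h] a c
        lin_zero[OF endo_lin[OF endo_mul_left[OF endo_id yS]] H_closed(1)]
      by auto
  qed (rule x)
qed

lemma P_mul_left:
  assumes c: "c \<in> carrier G" and a: "a \<in> carrier G" and y: "y \<in> E a" and x: "x \<in> space H"
  shows "P (a \<otimes>\<^bsub>G\<^esub> c) (y \<odot> x) = y \<odot> P c x"
proof -
  note yS = E_sub[OF a y]
  have ca: "a \<otimes>\<^bsub>G\<^esub> c \<in> carrier G" using c a by simp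
  show ?thesis
  proof (rule homog_eq[where f = "\<lambda>x. P (a \<otimes>\<^bsub>G\<^esub> c) (y \<odot> x)" and g = "\<lambda>x. y \<odot> P c x"])
    show "lin (space H) (smul H) (smul H) (\<lambda>x. P (a \<otimes>\<^bsub>G\<^esub> c) (y \<odot> x))"
      by (rule endo_lin[OF endo_comp[OF P_endo[OF ca]]]) (intro mul_linear_intros yS)
    show "lin (space H) (smul H) (smul H) (\<lambda>x. y \<odot> P c x)"
      by (intro endo_lin endo_mul_right P_endo c yS)
    fix b h assume "b \<in> carrier G" "h \<in> E b"
    thus "P (a \<otimes>\<^bsub>G\<^esub> c) (y \<odot> h) = y \<odot> P c h"
      using P_E[OF ca _ mul_E[OF a _ y], of b h] P_E[OF c, of b h] a c
        lin_zero[OF endo_lin[OF endo_mul_right[OF endo_id yS]] H_closed(1)]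
      by auto
  qed (rule x)
qed

text \<open>
  The part of an antipode that sends degree \<open>a\<close> to degree \<open>inv a\<close> is again an antipode, as
  one sees by projecting the antipode equations to degree \<open>1\<close>.
\<close>

lemma graded_antipode:
  obtains A where "\<And>a. a \<in> carrier G \<Longrightarrow> endo (A a)"
    "\<And>a h. a \<in> carrier G \<Longrightarrow> h \<in> E a \<Longrightarrow> A a h \<in> E (inv\<^bsub>G\<^esub> a)"
    "\<And>a h. a \<in> carrier G \<Longrightarrow> h \<in> E a \<Longrightarrow> swH h (\<lambda>h1 h2. A a h1 \<odot> h2) = counit H h \<cdot> unt H"
    "\<And>a h. a \<in> carrier G \<Longrightarrow> h \<in> E a \<Longrightarrow> swH h (\<lambda>h1 h2. h1 \<odot> A a h2) = counit H h \<cdot> unt H"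
proof -
  obtain S where S: "antipode H S" using hopf unfolding hopf_algebra_def by blast
  have S_endo: "endo S" using S by (simp add: antipode_def endo_def)
  have S_left: "swH h (\<lambda>h1 h2. S h1 \<odot> h2) = counit H h \<cdot> unt H"
    and S_right: "swH h (\<lambda>h1 h2. h1 \<odot> S h2) = counit H h \<cdot> unt H" if "h \<in> space H" for h
    using S that by (simp_all add: antipode_def)
  have S_in: "S h \<in> space H" if "h \<in> space H" for h by (rule endo_closed[OF S_endo that])
  have P1: "P \<one>\<^bsub>G\<^esub> (c \<cdot> unt H) = c \<cdot> unt H" for c
    by (simp add: lin_scale[OF endo_lin[OF P_endo]] unt_closed P_E[OF _ _ unt_E])
  define A where "A a h = P (inv\<^bsub>G\<^esub> a) (S h)" for a h
  show thesis
  proof (rule that[of A])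
    fix a assume a: "a \<in> carrier G"
    show "endo (A a)" unfolding A_def by (rule endo_comp[OF P_endo S_endo]) (simp add: a)
    fix h assume h: "h \<in> E a"
    note hS = E_sub[OF a h]
    show "A a h \<in> E (inv\<^bsub>G\<^esub> a)" unfolding A_def by (rule P_in) (simp_all add: a S_in hS)
    have "swH h (\<lambda>h1 h2. A a h1 \<odot> h2) = swH h (\<lambda>h1 h2. P \<one>\<^bsub>G\<^esub> (S h1 \<odot> h2))"
      by (rule sw_congE[OF a h])
        (use P_mul_right[of "inv\<^bsub>G\<^esub> a" a] a S_in E_sub in \<open>simp add: A_def\<close>)
    also have "\<dots> = P \<one>\<^bsub>G\<^esub> (swH h (\<lambda>h1 h2. S h1 \<odot> h2))"
      by (rule sw_endo[OF P_endo hS, symmetric]) (simp_all add: hS mul_closed S_in)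
    finally show "swH h (\<lambda>h1 h2. A a h1 \<odot> h2) = counit H h \<cdot> unt H"
      by (simp add: S_left hS P1)
    have "swH h (\<lambda>h1 h2. h1 \<odot> A a h2) = swH h (\<lambda>h1 h2. P \<one>\<^bsub>G\<^esub> (h1 \<odot> S h2))"
      by (rule sw_congE[OF a h])
        (use P_mul_left[of "inv\<^bsub>G\<^esub> a" a] a S_in E_sub in \<open>simp add: A_def\<close>)
    also have "\<dots> = P \<one>\<^bsub>G\<^esub> (swH h (\<lambda>h1 h2. h1 \<odot> S h2))"
      by (rule sw_endo[OF P_endo hS, symmetric]) (simp_all add: hS mul_closed S_in)
    finally show "swH h (\<lambda>h1 h2. h1 \<odot> A a h2) = counit H h \<cdot> unt H"
      by (simp add: S_right hS P1)
  qed
qed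

end

section \<open>Zesting of graded Hopf algebras\<close>

text \<open>\<open>iv\<close> is an explicit inverse on the group-likes \<open>N\<close>.
  \<open>\<gamma>_comm\<close> is the commutation rule of a zesting datum multiplied by g on the
  left, so that no inverse occurs in it.\<close>

locale zesting_hopf = graded_hopf H G E P
  for H :: "('k::field, 'a::ab_group_add, 'z) hopf_data_scheme" (structure)
    and G :: "('s, 'n) monoid_scheme" and E P +
  fixes N :: "'a set" and iv :: "'a \<Rightarrow> 'a" and \<gamma> :: "'a \<Rightarrow> 'a \<Rightarrow> 'k"
    and lam :: "'s \<Rightarrow> 's \<Rightarrow> 'a" and \<omega> :: "'s \<Rightarrow> 's \<Rightarrow> 's \<Rightarrow> 'k"
  assumes N_E: "g \<in> N \<Longrightarrow> g \<in> E \<one>\<^bsub>G\<^esub>"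
    and N_comul: "g \<in> N \<Longrightarrow> comul H g \<approx> pure g g"
    and N_counit: "g \<in> N \<Longrightarrow> counit H g = 1"
    and N_mul: "g \<in> N \<Longrightarrow> g' \<in> N \<Longrightarrow> g \<odot> g' \<in> N"
    and N_comm: "g \<in> N \<Longrightarrow> g' \<in> N \<Longrightarrow> g \<odot> g' = g' \<odot> g"
    and N_unt: "unt H \<in> N"
    and N_iv: "g \<in> N \<Longrightarrow> iv g \<in> N"
    and iv_left: "g \<in> N \<Longrightarrow> iv g \<odot> g = unt H"
    and \<gamma>_form: "g \<in> N \<Longrightarrow> form (\<gamma> g)"
    and \<gamma>_unt: "g \<in> N \<Longrightarrow> \<gamma> g (unt H) = 1"
    and \<gamma>_mul: "\<lbrakk>g \<in> N; h \<in> space H; k \<in> space H\<rbrakk> \<Longrightarrow>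
      \<gamma> g (h \<odot> k) = \<gamma> g h * \<gamma> g k"
    and \<gamma>_one: "h \<in> space H \<Longrightarrow> \<gamma> (unt H) h = counit H h"
    and \<gamma>_conv: "\<lbrakk>g \<in> N; g' \<in> N; h \<in> space H\<rbrakk> \<Longrightarrow>
      \<gamma> (g \<odot> g') h = swk h (\<lambda>h1 h2. \<gamma> g h1 * \<gamma> g' h2)"
    and \<gamma>_comm: "g \<in> N \<Longrightarrow> h \<in> space H \<Longrightarrow>
      swH h (\<lambda>h1 h2. \<gamma> g h1 \<cdot> (h2 \<odot> g)) = swH h (\<lambda>h1 h2. \<gamma> g h2 \<cdot> (g \<odot> h1))"
    and lam_cocycle: "normalized_2cocycle G \<lparr>carrier = N, mult = mul H, one = unt H\<rparr> N lam"
    and \<omega>_cochain: "normalized_3cochain G \<omega>"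
    and \<omega>_eq: "\<lbrakk>a \<in> carrier G; b \<in> carrier G; c \<in> carrier G; d \<in> carrier G\<rbrakk> \<Longrightarrow>
      \<gamma> (lam a b) (lam c d) =
        (\<omega> a b c * \<omega> a (b \<otimes>\<^bsub>G\<^esub> c) d * \<omega> b c d) / (\<omega> (a \<otimes>\<^bsub>G\<^esub> b) c d * \<omega> a b (c \<otimes>\<^bsub>G\<^esub> d))"
begin

lemma lam_N: "a \<in> carrier G \<Longrightarrow> b \<in> carrier G \<Longrightarrow> lam a b \<in> N"
  and lam_assoc: "\<lbrakk>a \<in> carrier G; b \<in> carrier G; c \<in> carrier G\<rbrakk> \<Longrightarrow>
      lam a b \<odot> lam (a \<otimes>\<^bsub>G\<^esub> b) c = lam b c \<odot> lam a (b \<otimes>\<^bsub>G\<^esub> c)"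
  and lam_one_right: "a \<in> carrier G \<Longrightarrow> lam a \<one>\<^bsub>G\<^esub> = unt H"
  and lam_one_left: "a \<in> carrier G \<Longrightarrow> lam \<one>\<^bsub>G\<^esub> a = unt H"
  using lam_cocycle by (simp_all add: normalized_2cocycle_def)

lemma \<omega>_nonzero: "\<lbrakk>a \<in> carrier G; b \<in> carrier G; c \<in> carrier G\<rbrakk> \<Longrightarrow>
      \<omega> a b c \<noteq> 0"
  and \<omega>_one: "a \<in> carrier G \<Longrightarrow> b \<in> carrier G \<Longrightarrow> \<omega> \<one>\<^bsub>G\<^esub> a b = 1"
    "a \<in> carrier G \<Longrightarrow> b \<in> carrier G \<Longrightarrow> \<omega> a \<one>\<^bsub>G\<^esub> b = 1"
    "a \<in> carrier G \<Longrightarrow> b \<in> carrier G \<Longrightarrow> \<omega> a b \<one>\<^bsub>G\<^esub> = 1"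
  using \<omega>_cochain by (simp_all add: normalized_3cochain_def)

lemma N_space: "g \<in> N \<Longrightarrow> g \<in> space H"
  by (rule E_sub[OF G.one_closed N_E])

lemma iv_right: "g \<in> N \<Longrightarrow> g \<odot> iv g = unt H"
  using iv_left N_comm N_iv by metis

lemma mul_N_E: "\<lbrakk>a \<in> carrier G; h \<in> E a; g \<in> N\<rbrakk> \<Longrightarrow>
      h \<odot> g \<in> E a"
  using mul_E[of a "\<one>\<^bsub>G\<^esub>" h g] N_E by simp

lemma N_mul_E: "\<lbrakk>a \<in> carrier G; h \<in> E a; g \<in> N\<rbrakk> \<Longrightarrow>
      g \<odot> h \<in> E a"
  using mul_E[of "\<one>\<^bsub>G\<^esub>" a g h] N_E by simp

text \<open>The cocycle condition at (a, inv a, a), where normalization removes one factor on each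
  side. Hence the same element appears in S(h1) h3 and in h1 S(h3) of the antipode
  equations.\<close>

lemma lam_inv: 
  assumes a: "a \<in> carrier G" shows "lam (inv\<^bsub>G\<^esub> a) a = lam a (inv\<^bsub>G\<^esub> a)"
  using lam_assoc[of a "inv\<^bsub>G\<^esub> a" a] a
  by (simp add: lam_one_left lam_one_right unt_right N_space lam_N)

text \<open>The condition on \<omega> at (a, inv a, a, inv a): the three remaining values of
  \<omega> have the neutral element as an argument.\<close>

lemma \<omega>_inv:
  assumes a: "a \<in> carrier G"
  shows "\<omega> a (inv\<^bsub>G\<^esub> a) a * \<omega> (inv\<^bsub>G\<^esub> a) a (inv\<^bsub>G\<^esub> a) = \<gamma> (lam a (inv\<^bsub>G\<^esub> a)) (lam a (inv\<^bsub>G\<^esub> a))"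
  using \<omega>_eq[of a "inv\<^bsub>G\<^esub> a" a "inv\<^bsub>G\<^esub> a"] a by (simp add: \<omega>_one)

lemma sw_N:
  assumes r: "vector_space r" and "g \<in> N" "bilin (space H) (smul H) (space H) (smul H) r f"
  shows "sw H r g f = f g g"
proof -
  interpret R: vector_space r by (rule r)
  show ?thesis
    using R.tens_eq_lsum[OF N_comul[OF assms(2)] assms(3)] by (simp add: sw_def)
qed

lemma \<gamma>_iv: "g \<in> N \<Longrightarrow> \<gamma> g g * \<gamma> g (iv g) = 1"
  using \<gamma>_mul[of g g "iv g"] by (simp add: N_space N_iv iv_right \<gamma>_unt)

text \<open>Glued in each variable separately. The family \<open>f\<close> is linear in arbitrary
  arguments, not only in homogeneous ones of the matching degree, as gluing requires.\<close>

lemma zesting_mul_exists: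
  obtains m where "bilin (space H) (smul H) (space H) (smul H) (smul H) m"
    "\<And>a b h k. \<lbrakk>a \<in> carrier G; b \<in> carrier G; h \<in> E a; k \<in> E b\<rbrakk> \<Longrightarrow>
      m h k = h \<odot> k \<odot> lam a b"
proof -
  define f where "f a b h k = h \<odot> k \<odot> lam a b" for a b h k
  have 1: "lin (space H) (smul H) (smul H) (f a b h)"
    if "a \<in> carrier G" "b \<in> carrier G" "h \<in> space H" for a b h
    unfolding f_def by (intro endo_lin mul_linear_intros N_space lam_N that)
  have 2: "lin (space H) (smul H) (smul H) (\<lambda>h. f a b h k)"
    if "a \<in> carrier G" "b \<in> carrier G" "k \<in> space H" for a b k
    unfolding f_def by (intro endo_lin mul_linear_intros N_space lam_N that)
  have P_closed: "P s h \<in> space H" if "s \<in> carrier G" "h \<in> space H" for s h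
    using that by (rule endo_closed[OF P_endo])
  have 3: "lin (space H) (smul H) (smul H) (\<lambda>h. glue (\<lambda>b k. f a b h k) k)"
    if "a \<in> carrier G" "k \<in> space H" for a k
    by (rule glue_fun_lin[OF H_vs]) (intro 2 that P_closed)
  have "bilin (space H) (smul H) (space H) (smul H) (smul H)
      (\<lambda>h k. glue (\<lambda>a h. glue (\<lambda>b k. f a b h k) k) h)"
  proof (rule bilinI)
    fix x assume x: "x \<in> space H"
    show "lin (space H) (smul H) (smul H) (\<lambda>k. glue (\<lambda>a h. glue (\<lambda>b k. f a b h k) k) x)"
      by (intro glue_fun_lin glue_lin H_vs 1 P_closed x)
    show "lin (space H) (smul H) (smul H) (\<lambda>h. glue (\<lambda>a h. glue (\<lambda>b k. f a b h k) x) h)"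
      by (intro glue_lin H_vs 3 x)
  qed
  moreover have "glue (\<lambda>a h. glue (\<lambda>b k. f a b h k) k) h = h \<odot> k \<odot> lam a b"
    if G: "a \<in> carrier G" "b \<in> carrier G" and E: "h \<in> E a" "k \<in> E b" for a b h k
  proof -
    note S = E_sub[OF G(1) E(1)] E_sub[OF G(2) E(2)]
    have "glue (\<lambda>a h. glue (\<lambda>b k. f a b h k) k) h = glue (\<lambda>b k. f a b h k) k"
      by (rule glue_E[OF G(1) E(1), where r = "smul H"]) (intro 3 S)
    also have "\<dots> = f a b h k"
      by (rule glue_E[OF G(2) E(2), where r = "smul H"]) (intro 1 G S)
    finally show ?thesis by (simp add: f_def)
  qed
  ultimately show thesis by (rule that)
qed

text \<open>Stated for an arbitrary family because it is needed for the associator and again for its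
  convolution inverse.\<close>

lemma trilin_glue:
  assumes 1: "\<And>a b c h k. \<lbrakk>a \<in> carrier G; b \<in> carrier G; c \<in> carrier G; h \<in> space H; k \<in> space H\<rbrakk> \<Longrightarrow>
      form (\<lambda>l. f a b c h k l)"
    and 2: "\<And>a b c h l. \<lbrakk>a \<in> carrier G; b \<in> carrier G; c \<in> carrier G; h \<in> space H; l \<in> space H\<rbrakk> \<Longrightarrow>
      form (\<lambda>k. f a b c h k l)"
    and 3: "\<And>a b c k l. \<lbrakk>a \<in> carrier G; b \<in> carrier G; c \<in> carrier G; k \<in> space H; l \<in> space H\<rbrakk> \<Longrightarrow>
      form (\<lambda>h. f a b c h k l)"
  obtains F where "trilin_form (space H) (smul H) F"
    "\<And>a b c h k l. \<lbrakk>a \<in> carrier G; b \<in> carrier G; c \<in> carrier G; h \<in> E a; k \<in> E b; l \<in> E c\<rbrakk> \<Longrightarrow>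
      F h k l = f a b c h k l"
proof -
  note K = vector_space_field
  have P_closed: "P s h \<in> space H" if "s \<in> carrier G" "h \<in> space H" for s h
    using that by (rule endo_closed[OF P_endo])
  define F where "F h k l = glue (\<lambda>a h. glue (\<lambda>b k. glue (\<lambda>c l. f a b c h k l) l) k) h" for h k l
  have 4: "form (\<lambda>k. glue (\<lambda>c l. f a b c h k l) l)"
    if "a \<in> carrier G" "b \<in> carrier G" "h \<in> space H" "l \<in> space H" for a b h l
    by (intro glue_fun_lin K 2 P_closed that)
  have 5: "form (\<lambda>h. glue (\<lambda>b k. glue (\<lambda>c l. f a b c h k l) l) k)"
    if "a \<in> carrier G" "k \<in> space H" "l \<in> space H" for a k l
    by (intro glue_fun_lin K 3 P_closed that)
  have "trilin_form (space H) (smul H) F"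
    unfolding trilin_form_def F_def
    by (intro conjI ballI glue_fun_lin glue_lin K 1 4 5 P_closed)
  moreover have "F h k l = f a b c h k l"
    if G: "a \<in> carrier G" "b \<in> carrier G" "c \<in> carrier G" and E: "h \<in> E a" "k \<in> E b" "l \<in> E c"
    for a b c h k l
  proof -
    note S = E_sub[OF G(1) E(1)] E_sub[OF G(2) E(2)] E_sub[OF G(3) E(3)]
    have "F h k l = glue (\<lambda>b k. glue (\<lambda>c l. f a b c h k l) l) k"
      unfolding F_def by (rule glue_E[OF G(1) E(1), where r = "(*)"]) (intro 5 S)
    also have "\<dots> = glue (\<lambda>c l. f a b c h k l) l"
      by (rule glue_E[OF G(2) E(2), where r = "(*)"]) (intro 4 G S)
    also have "\<dots> = f a b c h k l"
      by (rule glue_E[OF G(3) E(3), where r = "(*)"]) (intro 1 G S)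
    finally show ?thesis .
  qed
  ultimately show thesis by (rule that)
qed

lemma zesting_assoc_exists:
  obtains \<Omega> where "trilin_form (space H) (smul H) \<Omega>"
    "\<And>a b c h k l. \<lbrakk>a \<in> carrier G; b \<in> carrier G; c \<in> carrier G; h \<in> E a; k \<in> E b; l \<in> E c\<rbrakk> \<Longrightarrow>
      \<Omega> h k l = counit H (h \<odot> k) * \<omega> a b c * \<gamma> (lam a b) l"
  by (rule trilin_glue[of "\<lambda>a b c h k l. counit H (h \<odot> k) * \<omega> a b c * \<gamma> (lam a b) l"])
    ((intro form_mult_left form_mult_right form_comp[OF counit_lin] mul_linear_intros \<gamma>_form lam_N; assumption)+,
      rule that)

text \<open>As \<gamma> is a homomorphism into the characters under convolution, \<gamma>(inv L)
  inverts \<gamma>(L), while the counit is the unit for convolution; this explains the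
  formula.\<close>

lemma zesting_assoc_inverse_exists:
  obtains \<Omega> where "trilin_form (space H) (smul H) \<Omega>"
    "\<And>a b c h k l. \<lbrakk>a \<in> carrier G; b \<in> carrier G; c \<in> carrier G; h \<in> E a; k \<in> E b; l \<in> E c\<rbrakk> \<Longrightarrow>
      \<Omega> h k l = counit H (h \<odot> k) * inverse (\<omega> a b c) * \<gamma> (iv (lam a b)) l"
  by (rule trilin_glue[of "\<lambda>a b c h k l. counit H (h \<odot> k) * inverse (\<omega> a b c) * \<gamma> (iv (lam a b)) l"])
    ((intro form_mult_left form_mult_right form_comp[OF counit_lin] mul_linear_intros \<gamma>_form N_iv lam_N; assumption)+,
      rule that)

text \<open>The components are not assumed to be subspaces. Closure is recovered from the
  projections: \<open>P a\<close> fixes h, hence also its multiples, and takes values in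
  \<open>E a\<close>.\<close>

lemma E_scale: "a \<in> carrier G \<Longrightarrow> h \<in> E a \<Longrightarrow> c \<cdot> h \<in> E a"
  using P_in[of a "c \<cdot> h"] lin_scale[OF endo_lin[OF P_endo], of a h c] P_E[of a a h]
  by (simp add: E_sub H_closed)

end

text \<open>Of \<open>m\<close> and \<open>\<Omega>\<close> only multilinearity and the values on
  homogeneous elements are given. Whatever is proved here thus holds for every solution of the
  specification, however it was constructed.\<close>

locale zested_hopf = zesting_hopf H G E P N iv \<gamma> lam \<omega>
  for H :: "('k::field, 'a::ab_group_add, 'z) hopf_data_scheme" (structure)
    and G :: "('s, 'n) monoid_scheme" and E P N iv \<gamma> lam \<omega> +
  fixes m \<Omega>
  assumes m_bilin: "bilin (space H) (smul H) (space H) (smul H) (smul H) m"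
    and m_E: "\<lbrakk>a \<in> carrier G; b \<in> carrier G; h \<in> E a; k \<in> E b\<rbrakk> \<Longrightarrow>
      m h k = h \<odot> k \<odot> lam a b"
    and \<Omega>_trilin: "trilin_form (space H) (smul H) \<Omega>"
    and \<Omega>_E: "\<lbrakk>a \<in> carrier G; b \<in> carrier G; c \<in> carrier G; h \<in> E a; k \<in> E b; l \<in> E c\<rbrakk> \<Longrightarrow>
      \<Omega> h k l = counit H (h \<odot> k) * \<omega> a b c * \<gamma> (lam a b) l"
begin

lemma \<Omega>_val: "\<lbrakk>a \<in> carrier G; b \<in> carrier G; c \<in> carrier G; h \<in> E a; k \<in> E b; l \<in> E c\<rbrakk> \<Longrightarrow>
      \<Omega> h k l = counit H h * counit H k * \<omega> a b c * \<gamma> (lam a b) l"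
  by (simp add: \<Omega>_E counit_mul E_sub)

lemma m_in_E:
  "\<lbrakk>a \<in> carrier G; b \<in> carrier G; h \<in> E a; k \<in> E b\<rbrakk> \<Longrightarrow>
      m h k \<in> E (a \<otimes>\<^bsub>G\<^esub> b)"
  by (simp add: m_E mul_N_E mul_E lam_N)

text \<open>The prescribed values lie in the carrier, but an inhomogeneous product does so only
  after both arguments have been decomposed.\<close>

lemma m_closed: 
  assumes h: "h \<in> space H" and k: "k \<in> space H" shows "m h k \<in> space H"
proof -
  let ?D = "\<lambda>h. {s \<in> carrier G. P s h \<noteq> 0}"
  have P: "P s h \<in> space H" if "s \<in> carrier G" "h \<in> space H" for s h
    using that by (rule endo_closed[OF P_endo])
  have "m h k = m (\<Sum>s\<in>?D h. P s h) (\<Sum>t\<in>?D k. P t k)"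
    by (simp add: P_sum h k)
  also have "\<dots> = (\<Sum>s\<in>?D h. m (P s h) (\<Sum>t\<in>?D k. P t k))"
    by (rule lin_sum[OF bilin_left[OF m_bilin] H_vec]) (auto simp: P_sum h k P)
  also have "\<dots> = (\<Sum>s\<in>?D h. \<Sum>t\<in>?D k. m (P s h) (P t k))"
    by (intro sum.cong refl lin_sum[OF bilin_right[OF m_bilin] H_vec]) (auto simp: h k P)
  also have "\<dots> \<in> space H"
    by (intro H_closed(4)) (auto intro!: E_sub[OF G.m_closed m_in_E[OF _ _ P_in P_in]] h k)
  finally show ?thesis .
qed

lemma endo_m_left: "endo f \<Longrightarrow> y \<in> space H \<Longrightarrow> endo (\<lambda>x. m (f x) y)"
  and endo_m_right: "endo f \<Longrightarrow> y \<in> space H \<Longrightarrow> endo (\<lambda>x. m y (f x))"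
  using m_bilin unfolding endo_def bilin_def lin_def by (simp_all add: m_closed)

lemma trilin_intros:
  assumes "trilin_form (space H) (smul H) F" "endo f" "x \<in> space H" "y \<in> space H"
  shows "form (\<lambda>z. F (f z) x y)" "form (\<lambda>z. F x (f z) y)" "form (\<lambda>z. F x y (f z))"
  using assms unfolding trilin_form_def by (auto intro: form_comp[of _ f])

lemmas all_intros = mul_linear_intros endo_m_left endo_m_right trilin_intros[OF \<Omega>_trilin]

lemma homog_eq3:
  assumes r: "\<And>y z. y \<in> space H \<Longrightarrow> z \<in> space H \<Longrightarrow> lin (space H) (smul H) r (\<lambda>x. f x y z)"
    "\<And>x z. x \<in> space H \<Longrightarrow> z \<in> space H \<Longrightarrow> lin (space H) (smul H) r (\<lambda>y. f x y z)"
    "\<And>x y. x \<in> space H \<Longrightarrow> y \<in> space H \<Longrightarrow> lin (space H) (smul H) r (\<lambda>z. f x y z)"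
    "\<And>y z. y \<in> space H \<Longrightarrow> z \<in> space H \<Longrightarrow> lin (space H) (smul H) r (\<lambda>x. g x y z)"
    "\<And>x z. x \<in> space H \<Longrightarrow> z \<in> space H \<Longrightarrow> lin (space H) (smul H) r (\<lambda>y. g x y z)"
    "\<And>x y. x \<in> space H \<Longrightarrow> y \<in> space H \<Longrightarrow> lin (space H) (smul H) r (\<lambda>z. g x y z)"
    and eq: "\<And>a b c x y z. \<lbrakk>a \<in> carrier G; b \<in> carrier G; c \<in> carrier G; x \<in> E a; y \<in> E b; z \<in> E c\<rbrakk> \<Longrightarrow>
      f x y z = g x y z"
    and S: "x \<in> space H" "y \<in> space H" "z \<in> space H"
  shows "f x y z = g x y z"
proof (rule homog_eq[where f = "\<lambda>x. f x y z" and g = "\<lambda>x. g x y z" and r = r])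
  fix a x assume a: "a \<in> carrier G" "x \<in> E a"
  show "f x y z = g x y z"
  proof (rule homog_eq[where f = "\<lambda>y. f x y z" and g = "\<lambda>y. g x y z" and r = r])
    fix b y assume b: "b \<in> carrier G" "y \<in> E b"
    show "f x y z = g x y z"
      by (rule homog_eq[where f = "\<lambda>z. f x y z" and g = "\<lambda>z. g x y z" and r = r])
        (intro r eq[OF a(1) b(1) _ a(2) b(2)] S E_sub[OF a] E_sub[OF b]; assumption?)+
  qed (intro r S E_sub[OF a])+
qed (intro r S)+

section \<open>The coquasi-bialgebra axioms\<close>

lemma counit_m: "h \<in> space H \<Longrightarrow> k \<in> space H \<Longrightarrow> counit H (m h k) = counit H h * counit H k"
\<comment> \<open>A dummy factor \<open>counit H l\<close>, evaluated at the unit, makes an identity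
  in two variables an instance of the principle for three.\<close>
proof (rule homog_eq3[where f = "\<lambda>h k l. counit H (m h k) * counit H l" and z = "unt H"
      and g = "\<lambda>h k l. counit H h * counit H k * counit H l" and r = "(*)",
      simplified counit_unt mult_1_right])
qed (simp_all add: m_E counit_mul closed E_sub N_space lam_N N_counit unt_closed,
  (intro all_intros form_comp[OF counit_lin]; assumption)+)

lemma unt_m: "h \<in> space H \<Longrightarrow> m (unt H) h = h"
  by (rule homog_eq[OF endo_lin[OF endo_m_right] endo_lin[OF endo_id]])
    (simp_all add: endo_id unt_closed m_E[OF _ _ unt_E] lam_one_left unt_left unt_right E_sub)

lemma m_unt: "h \<in> space H \<Longrightarrow> m h (unt H) = h"
  by (rule homog_eq[OF endo_lin[OF endo_m_left] endo_lin[OF endo_id]])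
    (simp_all add: endo_id unt_closed m_E[OF _ _ _ unt_E] lam_one_right unt_left unt_right E_sub)

text \<open>The factor \<open>lam a b\<close> is group-like, so the coproduct of h k
  \<open>lam a b\<close> has it in both tensor factors. As the factors of h and k keep the degrees a
  and b, it is also the element occurring in \<open>m h1 k1\<close> and in
  \<open>m h2 k2\<close>.\<close>

lemma sw_m:
  assumes f: "bilin (space H) (smul H) (space H) (smul H) (*) f" and hk: "h \<in> space H" "k \<in> space H"
  shows "swk (m h k) f = swk h (\<lambda>h1 h2. swk k (\<lambda>k1 k2. f (m h1 k1) (m h2 k2)))"
proof -
  note f_intros = form_comp[OF bilin_left[OF f]] form_comp[OF bilin_right[OF f]]
  have sw_f: "form (\<lambda>x. swk x f)"
    by (intro form_sw_arg bilin_left[OF f] bilin_right[OF f])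
  have homog: "swk (m h k) f = swk h (\<lambda>h1 h2. swk k (\<lambda>k1 k2. f (m h1 k1) (m h2 k2)))"
    if a: "a \<in> carrier G" and b: "b \<in> carrier G" and h: "h \<in> E a" and k: "k \<in> E b" for a b h k
  proof -
    let ?L = "lam a b"
    note L = lam_N[OF a b]
    note S = E_sub[OF a h] E_sub[OF b k] N_space[OF L]
    note K = vector_space_field
    have "swk (m h k) f = swk (h \<odot> k) (\<lambda>u v. swk ?L (\<lambda>p q. f (u \<odot> p) (v \<odot> q)))"
      unfolding m_E[OF a b h k] by (rule sw_mul[OF K _ _ f]) (intro closed S)+
    also have "\<dots> = swk (h \<odot> k) (\<lambda>u v. f (u \<odot> ?L) (v \<odot> ?L))"
    proof (rule sw_cong)
      fix u v assume "u \<in> space H" "v \<in> space H"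
      thus "swk ?L (\<lambda>p q. f (u \<odot> p) (v \<odot> q)) = f (u \<odot> ?L) (v \<odot> ?L)"
        by (intro sw_N[OF K L] bilinI f_intros mul_linear_intros closed)
    qed (intro closed S)
    also have "\<dots> = swk h (\<lambda>h1 h2. swk k (\<lambda>k1 k2. f (h1 \<odot> k1 \<odot> ?L) (h2 \<odot> k2 \<odot> ?L)))"
      by (intro sw_mul[OF K] bilinI f_intros mul_linear_intros closed S)
    also have "\<dots> = swk h (\<lambda>h1 h2. swk k (\<lambda>k1 k2. f (m h1 k1) (m h2 k2)))"
      by (rule sw_congE[OF a h], rule sw_congE[OF b k]) (simp add: m_E[OF a b])
    finally show ?thesis .
  qed
  show ?thesis
  proof (rule homog_eq[where f = "\<lambda>h. swk (m h k) f" and r = "(*)"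
      and g = "\<lambda>h. swk h (\<lambda>h1 h2. swk k (\<lambda>k1 k2. f (m h1 k1) (m h2 k2)))"])
    fix a h assume a: "a \<in> carrier G" "h \<in> E a"
    show "swk (m h k) f = swk h (\<lambda>h1 h2. swk k (\<lambda>k1 k2. f (m h1 k1) (m h2 k2)))"
    proof (rule homog_eq[where f = "\<lambda>k. swk (m h k) f" and r = "(*)"
        and g = "\<lambda>k. swk h (\<lambda>h1 h2. swk k (\<lambda>k1 k2. f (m h1 k1) (m h2 k2)))"])
      show "form (\<lambda>k. swk (m h k) f)"
        by (intro form_comp[OF sw_f] all_intros E_sub[OF a])
      show "form (\<lambda>k. swk h (\<lambda>h1 h2. swk k (\<lambda>k1 k2. f (m h1 k1) (m h2 k2))))"
        by (intro f_intros all_intros E_sub[OF a] m_closed)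
      fix b k assume b: "b \<in> carrier G" "k \<in> E b"
      show "swk (m h k) f = swk h (\<lambda>h1 h2. swk k (\<lambda>k1 k2. f (m h1 k1) (m h2 k2)))"
        by (rule homog[OF a(1) b(1) a(2) b(2)])
    qed (rule hk(2))
  qed (intro form_comp[OF sw_f] f_intros all_intros hk m_closed; assumption?)+
qed

lemma sw_counit_pair_right:
  assumes r: "vector_space r" and h: "h \<in> space H" and k: "k \<in> space H"
    and T: "\<And>k. k \<in> space H \<Longrightarrow> lin (space H) (smul H) r (\<lambda>h. T h k)"
      "\<And>h. h \<in> space H \<Longrightarrow> lin (space H) (smul H) r (\<lambda>k. T h k)"
  shows "sw H r h (\<lambda>h1 h2. sw H r k (\<lambda>k1 k2. r (counit H h2) (r (counit H k2) (T h1 k1)))) = T h k"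
proof -
  have "sw H r h (\<lambda>h1 h2. sw H r k (\<lambda>k1 k2. r (counit H h2) (r (counit H k2) (T h1 k1)))) =
      sw H r h (\<lambda>h1 h2. r (counit H h2) (T h1 k))"
    by (rule sw_cong[OF h]) (simp only: sw_scale[OF r] sw_counit_right[OF T(2) k])
  also have "\<dots> = T h k" by (rule sw_counit_right[OF T(1)[OF k] h])
  finally show ?thesis .
qed

lemma sw_counit_pair_left:
  assumes r: "vector_space r" and h: "h \<in> space H" and k: "k \<in> space H"
    and T: "\<And>k. k \<in> space H \<Longrightarrow> lin (space H) (smul H) r (\<lambda>h. T h k)"
      "\<And>h. h \<in> space H \<Longrightarrow> lin (space H) (smul H) r (\<lambda>k. T h k)"
  shows "sw H r h (\<lambda>h1 h2. sw H r k (\<lambda>k1 k2. r (counit H h1) (r (counit H k1) (T h2 k2)))) = T h k"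
proof -
  have "sw H r h (\<lambda>h1 h2. sw H r k (\<lambda>k1 k2. r (counit H h1) (r (counit H k1) (T h2 k2)))) =
      sw H r h (\<lambda>h1 h2. r (counit H h1) (T h2 k))"
    by (rule sw_cong[OF h]) (simp only: sw_scale[OF r] sw_counit_left[OF T(2) k])
  also have "\<dots> = T h k" by (rule sw_counit_left[OF T(1)[OF k] h])
  finally show ?thesis .
qed

lemma sw3_counit:
  assumes r: "vector_space r" and k: "k \<in> space H" and f: "lin (space H) (smul H) r f"
  shows "sw3 H r k (\<lambda>k1 k2 k3. r (counit H k2) (r (counit H k3) (f k1))) = f k"
proof -
  interpret R: vector_space r by (rule r)
  have "lin (space H) (smul H) r (\<lambda>a. r (counit H a) x)" for x
    by (rule linI) (simp_all add: lin_add[OF counit_lin] lin_scale[OF counit_lin] R.scale_left_distrib)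
  hence "sw3 H r k (\<lambda>k1 k2 k3. r (counit H k2) (r (counit H k3) (f k1))) = 
    sw H r k (\<lambda>k1 d. r (counit H d) (f k1))"
    unfolding sw3_def by (intro sw_cong[OF k] sw_counit_left[where f = "\<lambda>a. r (counit H a) _"])
  thus ?thesis by (simp add: sw_counit_right[OF f k])
qed

text \<open>With L = \<open>lam a b\<close> and L1 = lam(a b, c), the two products are h k L l L1
  and h k l lam(b, c) lam(a, b c), and the cocycle condition turns the tail of the second into L L1.
  It remains to exchange L with l, and the associator supplies on either side the factor \<gamma>(L)
  that the commutation rule requires.\<close>

lemma quasi_assoc:
  assumes "h \<in> space H" "k \<in> space H" "l \<in> space H"
  shows "swH h (\<lambda>h1 h2. swH k (\<lambda>k1 k2. swH l (\<lambda>l1 l2.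
          \<Omega> h2 k2 l2 \<cdot> m (m h1 k1) l1))) =
        swH h (\<lambda>h1 h2. swH k (\<lambda>k1 k2. swH l (\<lambda>l1 l2.
          \<Omega> h1 k1 l1 \<cdot> m h2 (m k2 l2))))" (is "?lhs h k l = ?rhs h k l")
proof (rule homog_eq3[where f = ?lhs and g = ?rhs and r = "smul H"])
  fix a b c h k l
  assume G: "a \<in> carrier G" "b \<in> carrier G" "c \<in> carrier G" and E: "h \<in> E a" "k \<in> E b" "l \<in> E c"
  define L L1 w where "L = lam a b" and "L1 = lam (a \<otimes>\<^bsub>G\<^esub> b) c" and "w = \<omega> a b c"
  have LN: "L \<in> N" "L1 \<in> N" unfolding L_def L1_def using G by (simp_all add: lam_N)
  note S = E_sub[OF G(1) E(1)] E_sub[OF G(2) E(2)] E_sub[OF G(3) E(3)] N_space[OF LN(1)] N_space[OF LN(2)]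
  \<comment> \<open>Everything around the slot y, common to both sides. The slot receives
    \<gamma>(L)(l2) L l1 on the left and \<gamma>(L)(l1) l2 L on the right.\<close>
  define T where "T h k y = w \<cdot> (h \<odot> k \<odot> y \<odot> L1)" for h k y
  have T_endo: "endo (T h k)" "endo (\<lambda>k. T h k y)" "endo (\<lambda>h. T h k y)"
    if "h \<in> space H" "k \<in> space H" "y \<in> space H" for h k y
    unfolding T_def by (intro mul_linear_intros closed that S)+
  have conj: "swH l (\<lambda>l1 l2. \<gamma> L l2 \<cdot> (L \<odot> l1)) = swH l (\<lambda>l1 l2. \<gamma> L l1 \<cdot> (l2 \<odot> L))"
    (is "?X = ?Y") by (rule \<gamma>_comm[symmetric]) (intro LN S)+
  have X: "?X \<in> space H" by (intro sw_closed H_vec closed S)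
  have Y: "?Y \<in> space H" by (intro sw_closed H_vec closed S)
  have mm: "m (m x y) z = x \<odot> (y \<odot> (L \<odot> (z \<odot> L1)))" if "x \<in> E a" "y \<in> E b" "z \<in> E c" for x y z
  proof -
    have 1: "m (m x y) z = m x y \<odot> z \<odot> L1"
      unfolding L1_def by (rule m_E[OF G.m_closed[OF G(1,2)] G(3) m_in_E[OF G(1,2)]]) (rule that)+
    have 2: "m x y = x \<odot> y \<odot> L" unfolding L_def by (rule m_E[OF G(1,2) that(1,2)])
    show ?thesis
      unfolding 1 unfolding 2
      using E_sub[OF G(1) that(1)] E_sub[OF G(2) that(2)] E_sub[OF G(3) that(3)] S by (simp add: mul_assoc closed)
  qed
  have "?lhs h k l = swH h (\<lambda>h1 h2. swH k (\<lambda>k1 k2. swH l (\<lambda>l1 l2.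
      counit H h2 \<cdot> counit H k2 \<cdot> T h1 k1 (\<gamma> L l2 \<cdot> (L \<odot> l1)))))"
    by (rule sw_congE[OF G(1) E(1)], rule sw_congE[OF G(2) E(2)], rule sw_congE[OF G(3) E(3)])
      (use G S in \<open>simp add: \<Omega>_val mm T_def
        E_sub closed mul_assoc mul_scale_right mul_scale_left mult_ac flip: L_def L1_def w_def\<close>)
  also have "\<dots> = swH h (\<lambda>h1 h2. swH k (\<lambda>k1 k2.
      counit H h2 \<cdot> counit H k2 \<cdot> T h1 k1 ?X))"
    by (intro sw_cong S) (simp add: sw_scale[OF H_vs] sw_endo[OF T_endo(1)[OF _ _ H_closed(1)]] closed S)
  also have "\<dots> = T h k ?X"
    by (rule sw_counit_pair_right[OF H_vs]) (intro S X endo_lin T_endo; assumption)+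
  finally have lhs: "?lhs h k l = T h k ?X" .
  have assoc: "lam b c \<odot> lam a (b \<otimes>\<^bsub>G\<^esub> c) = L \<odot> L1"
    using lam_assoc[OF G] by (simp add: L_def L1_def)
  have "?rhs h k l = swH h (\<lambda>h1 h2. swH k (\<lambda>k1 k2. swH l (\<lambda>l1 l2.
      counit H h1 \<cdot> counit H k1 \<cdot> T h2 k2 (\<gamma> L l1 \<cdot> (l2 \<odot> L)))))"
    by (rule sw_congE[OF G(1) E(1)], rule sw_congE[OF G(2) E(2)], rule sw_congE[OF G(3) E(3)])
      (use G S in \<open>simp add: \<Omega>_val m_E[OF G(2,3)] m_E[OF G(1) G.m_closed[OF G(2,3)]] mul_N_E mul_E lam_N T_def
        E_sub closed mul_assoc mul_scale_right mul_scale_left mult_ac N_space assoc flip: L_def L1_def w_def\<close>)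
  also have "\<dots> = swH h (\<lambda>h1 h2. swH k (\<lambda>k1 k2.
      counit H h1 \<cdot> counit H k1 \<cdot> T h2 k2 ?Y))"
    by (intro sw_cong S) (simp add: sw_scale[OF H_vs] sw_endo[OF T_endo(1)[OF _ _ H_closed(1)]] closed S)
  also have "\<dots> = T h k ?Y"
    by (rule sw_counit_pair_left[OF H_vs]) (intro S Y endo_lin T_endo; assumption)+
  finally show "?lhs h k l = ?rhs h k l" using lhs conj by simp
qed (intro endo_lin all_intros assms closed m_closed; assumption)+

lemma \<Omega>_unt: "h \<in> space H \<Longrightarrow> k \<in> space H \<Longrightarrow> \<Omega> h (unt H) k = counit H h * counit H k"
proof (rule homog_eq3[where f = "\<lambda>h k l. \<Omega> h (unt H) k * counit H l" and z = "unt H"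
      and g = "\<lambda>h k l. counit H h * counit H k * counit H l" and r = "(*)",
      simplified counit_unt mult_1_right])
qed (simp_all add: \<Omega>_val[OF _ G.one_closed _ _ unt_E] counit_unt lam_one_right \<omega>_one \<gamma>_one unt_closed E_sub,
  (intro all_intros form_comp[OF counit_lin] unt_closed; assumption)+)

text \<open>Three contributions are compared separately. On l both sides carry \<gamma>(lam(a, b)).
  On t they carry, by convolution, \<gamma> of the two sides of the cocycle condition. The scalars
  match by the condition on \<omega>, whose left-hand side arises when \<gamma>(lam(a, b)) is
  applied to the factor lam(c, d) of \<open>m l2 t2\<close>.\<close>

lemma pentagon:
  assumes "h \<in> space H" "k \<in> space H" "l \<in> space H" "t \<in> space H"
  shows "swk h (\<lambda>h1 h2. swk k (\<lambda>k1 k2. swk l (\<lambda>l1 l2. swk t (\<lambda>t1 t2.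
          \<Omega> (m h1 k1) l1 t1 * \<Omega> h2 k2 (m l2 t2))))) =
        swk h (\<lambda>h1 h2. sw3 H (*) k (\<lambda>k1 k2 k3. sw3 H (*) l (\<lambda>l1 l2 l3. swk t (\<lambda>t1 t2.
          \<Omega> h1 k1 l1 * \<Omega> h2 (m k2 l2) t1 * \<Omega> k3 l3 t2))))" (is "?lhs h k l t = ?rhs h k l t")
proof (rule homog_eq[where f = "\<lambda>t. ?lhs h k l t" and g = "\<lambda>t. ?rhs h k l t" and r = "(*)"])
  fix d t assume Gd: "d \<in> carrier G" and t: "t \<in> E d"
  note tS = E_sub[OF Gd t]
  show "?lhs h k l t = ?rhs h k l t"
  proof (rule homog_eq3[where f = "\<lambda>h k l. ?lhs h k l t" and g = "\<lambda>h k l. ?rhs h k l t" and r = "(*)"])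
    fix a b c h k l
    assume G: "a \<in> carrier G" "b \<in> carrier G" "c \<in> carrier G" and E: "h \<in> E a" "k \<in> E b" "l \<in> E c"
    note S = E_sub[OF G(1) E(1)] E_sub[OF G(2) E(2)] E_sub[OF G(3) E(3)] tS
    note K = vector_space_field
    have N: "lam a b \<in> N" "lam (a \<otimes>\<^bsub>G\<^esub> b) c \<in> N" "lam b c \<in> N" "lam a (b \<otimes>\<^bsub>G\<^esub> c) \<in> N" "lam c d \<in> N"
      using G Gd by (simp_all add: lam_N)
    define x where "x = \<omega> (a \<otimes>\<^bsub>G\<^esub> b) c d * \<omega> a b (c \<otimes>\<^bsub>G\<^esub> d) * \<gamma> (lam a b) (lam c d)"
    define y where "y = \<omega> a b c * \<omega> a (b \<otimes>\<^bsub>G\<^esub> c) d * \<omega> b c d"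
    define T where "T z h k l = counit H h * (counit H k * (\<gamma> (lam a b) l * z))" for z h k l
    have T_form: "form (T z h k)" "form (\<lambda>k. T z h k l)" "form (\<lambda>h. T z h k l)" for z h k l
      unfolding T_def by (intro form_mult_left form_mult_right counit_lin \<gamma>_form N)+
    have xy: "x = y"
      using G Gd unfolding x_def y_def by (simp add: \<omega>_eq \<omega>_nonzero)
    \<comment> \<open>The convolution products come with their factors in the opposite order from
      the cocycle condition, so commutativity of \<open>N\<close> enters.\<close>
    have NN: "lam (a \<otimes>\<^bsub>G\<^esub> b) c \<odot> lam a b = lam a (b \<otimes>\<^bsub>G\<^esub> c) \<odot> lam b c"
      using lam_assoc[OF G] N N_comm by metis
    define Z where "Z = \<gamma> (lam (a \<otimes>\<^bsub>G\<^esub> b) c \<odot> lam a b) t"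
    have Z1: "swk t (\<lambda>t1 t2. \<gamma> (lam (a \<otimes>\<^bsub>G\<^esub> b) c) t1 * \<gamma> (lam a b) t2) = Z"
      unfolding Z_def by (rule \<gamma>_conv[symmetric]) (intro N tS)+
    have Z2: "swk t (\<lambda>t1 t2. \<gamma> (lam a (b \<otimes>\<^bsub>G\<^esub> c)) t1 * \<gamma> (lam b c) t2) = Z"
      unfolding Z_def NN by (rule \<gamma>_conv[symmetric]) (intro N tS)+
    have \<gamma>_m: "\<gamma> (lam a b) (m u v) = \<gamma> (lam a b) u * \<gamma> (lam a b) v * \<gamma> (lam a b) (lam c d)"
      if "u \<in> E c" "v \<in> E d" for u v
      using E_sub[OF G(3) that(1)] E_sub[OF Gd that(2)] N
      by (simp add: m_E[OF G(3) Gd that] \<gamma>_mul closed N_space)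
    have "?lhs h k l t = swk h (\<lambda>h1 h2. swk k (\<lambda>k1 k2. swk l (\<lambda>l1 l2. swk t (\<lambda>t1 t2.
        counit H h2 * (counit H k2 * (counit H l1 * (T x h1 k1 l2 *
          (\<gamma> (lam (a \<otimes>\<^bsub>G\<^esub> b) c) t1 * \<gamma> (lam a b) t2))))))))"
      by (rule sw_congE[OF G(1) E(1)], rule sw_congE[OF G(2) E(2)], rule sw_congE[OF G(3) E(3)],
          rule sw_congE[OF Gd t])
        (use G Gd N in \<open>simp add: \<Omega>_val[OF G] \<Omega>_val[OF G.m_closed[OF G(1,2)] G(3) Gd m_in_E[OF G(1,2)]]
          \<Omega>_val[OF G(1,2) G.m_closed[OF G(3) Gd] _ _ m_in_E[OF G(3) Gd]] counit_m E_sub \<gamma>_m T_def x_def mult_ac\<close>)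
    also have "\<dots> = swk h (\<lambda>h1 h2. swk k (\<lambda>k1 k2. counit H h2 * (counit H k2 * (T (x * Z) h1 k1 l))))"
    proof (intro sw_cong S)
      fix h1 h2 k1 k2
      have "swk l (\<lambda>l1 l2. swk t (\<lambda>t1 t2. counit H h2 * (counit H k2 * (counit H l1 * (T x h1 k1 l2 *
          (\<gamma> (lam (a \<otimes>\<^bsub>G\<^esub> b) c) t1 * \<gamma> (lam a b) t2))))))
        = counit H h2 * (counit H k2 * swk l (\<lambda>l1 l2. counit H l1 * T (x * Z) h1 k1 l2))"
        unfolding sw_mult_left Z1 by (simp add: T_def mult_ac)
      thus "swk l (\<lambda>l1 l2. swk t (\<lambda>t1 t2. counit H h2 * (counit H k2 * (counit H l1 * (T x h1 k1 l2 *
          (\<gamma> (lam (a \<otimes>\<^bsub>G\<^esub> b) c) t1 * \<gamma> (lam a b) t2))))))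
        = counit H h2 * (counit H k2 * (T (x * Z) h1 k1 l))"
        by (simp add: sw_counit_left[OF T_form(1) S(3)])
    qed
    also have "\<dots> = T (x * Z) h k l"
      by (rule sw_counit_pair_right[OF K S(1,2)]) (rule T_form)+
    finally have lhs: "?lhs h k l t = T (x * Z) h k l" .
    have "?rhs h k l t = swk h (\<lambda>h1 h2. sw3 H (*) k (\<lambda>k1 k2 k3. sw3 H (*) l (\<lambda>l1 l2 l3. swk t (\<lambda>t1 t2.
        counit H h2 * (counit H k2 * (counit H k3 * (counit H l2 * (counit H l3 * (T y h1 k1 l1 *
          (\<gamma> (lam a (b \<otimes>\<^bsub>G\<^esub> c)) t1 * \<gamma> (lam b c) t2))))))))))"
      unfolding sw3_def
      by (rule sw_congE[OF G(1) E(1)], rule sw_congE[OF G(2) E(2)], rule sw_congE[OF G(2)], assumption,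
          rule sw_congE[OF G(3) E(3)], rule sw_congE[OF G(3)], assumption, rule sw_congE[OF Gd t])
        (use G Gd N in \<open>simp add: \<Omega>_val[OF G] \<Omega>_val[OF G(2,3) Gd]
          \<Omega>_val[OF G(1) G.m_closed[OF G(2,3)] Gd _ m_in_E[OF G(2,3)]] counit_m E_sub T_def y_def mult_ac\<close>)
    also have "\<dots> = swk h (\<lambda>h1 h2. sw3 H (*) k (\<lambda>k1 k2 k3. 
        counit H k2 * (counit H k3 * (counit H h2 * (T (y * Z) h1 k1 l)))))"
      unfolding sw3_def[of H _ k]
    proof (intro sw_cong S)
      fix h1 h2 k1 k2 k3 r assume "r \<in> space H"
      have "sw3 H (*) l (\<lambda>l1 l2 l3. swk t (\<lambda>t1 t2.
        counit H h2 * (counit H k2 * (counit H k3 * (counit H l2 * (counit H l3 * (T y h1 k1 l1 *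
          (\<gamma> (lam a (b \<otimes>\<^bsub>G\<^esub> c)) t1 * \<gamma> (lam b c) t2))))))))
        = counit H h2 * (counit H k2 * (counit H k3 * sw3 H (*) l (\<lambda>l1 l2 l3. counit H l2 * (counit H l3 * T (y * Z) h1 k1 l1))))"
        unfolding sw_mult_left sw3_def Z2 by (simp add: T_def mult_ac)
      thus "sw3 H (*) l (\<lambda>l1 l2 l3. swk t (\<lambda>t1 t2.
        counit H h2 * (counit H k2 * (counit H k3 * (counit H l2 * (counit H l3 * (T y h1 k1 l1 *
          (\<gamma> (lam a (b \<otimes>\<^bsub>G\<^esub> c)) t1 * \<gamma> (lam b c) t2))))))))
        = counit H k2 * (counit H k3 * (counit H h2 * (T (y * Z) h1 k1 l)))"
        by (simp add: sw3_counit[OF K S(3) T_form(1)])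
    qed
    also have "\<dots> = swk h (\<lambda>h1 h2. counit H h2 * T (y * Z) h1 k l)"
      by (intro sw_cong S sw3_counit[OF K S(2), where f = "\<lambda>k. counit H _ * T (y * Z) _ k l"] form_mult_left T_form)
    also have "\<dots> = T (y * Z) h k l"
      by (rule sw_counit_right[OF T_form(3) S(1)])
    finally show "?lhs h k l t = ?rhs h k l t" using lhs xy by simp
  qed (unfold sw3_def, (intro all_intros assms closed m_closed tS; assumption?)+)
qed (unfold sw3_def, (intro all_intros assms closed m_closed; assumption?)+)

section \<open>Inverse associator and antipode\<close>

lemma inverse_assoc:
  assumes Q: "trilin_form (space H) (smul H) Q"
    and Q_E: "\<And>a b c h k l. \<lbrakk>a \<in> carrier G; b \<in> carrier G; c \<in> carrier G; h \<in> E a; k \<in> E b; l \<in> E c\<rbrakk> \<Longrightarrow>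
      Q h k l = counit H (h \<odot> k) * inverse (\<omega> a b c) * \<gamma> (iv (lam a b)) l"
    and S: "h \<in> space H" "k \<in> space H" "l \<in> space H"
  shows "swk h (\<lambda>h1 h2. swk k (\<lambda>k1 k2. swk l (\<lambda>l1 l2. \<Omega> h1 k1 l1 * Q h2 k2 l2))) =
      counit H h * counit H k * counit H l" (is "?lhs h k l = ?eps h k l")
    and "swk h (\<lambda>h1 h2. swk k (\<lambda>k1 k2. swk l (\<lambda>l1 l2. Q h1 k1 l1 * \<Omega> h2 k2 l2))) =
      counit H h * counit H k * counit H l" (is "?rhs h k l = _")
proof -
  note K = vector_space_field
  have eps: "form (\<lambda>h. ?eps h k l)" "form (\<lambda>k. ?eps h k l)" "form (\<lambda>l. ?eps h k l)" for h k l
    by (intro form_mult_left form_mult_right counit_lin)+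
  have "?lhs h k l = ?eps h k l \<and> ?rhs h k l = ?eps h k l"
    if G: "a \<in> carrier G" "b \<in> carrier G" "c \<in> carrier G" and E: "h \<in> E a" "k \<in> E b" "l \<in> E c"
    for a b c h k l
  proof -
    note S = E_sub[OF G(1) E(1)] E_sub[OF G(2) E(2)] E_sub[OF G(3) E(3)]
    note L = lam_N[OF G(1,2)] N_iv[OF lam_N[OF G(1,2)]]
    have g1: "swk l (\<lambda>l1 l2. \<gamma> (lam a b) l1 * \<gamma> (iv (lam a b)) l2) = counit H l"
      using \<gamma>_conv[OF L S(3)] by (simp add: iv_right L \<gamma>_one S)
    have g2: "swk l (\<lambda>l1 l2. \<gamma> (iv (lam a b)) l1 * \<gamma> (lam a b) l2) = counit H l"
      using \<gamma>_conv[OF L(2,1) S(3)] by (simp add: iv_left L \<gamma>_one S)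
    have "?lhs h k l = swk h (\<lambda>h1 h2. swk k (\<lambda>k1 k2. swk l (\<lambda>l1 l2.
        counit H h2 * (counit H k2 * ((counit H h1 * counit H k1) * (\<gamma> (lam a b) l1 * \<gamma> (iv (lam a b)) l2))))))"
      by (rule sw_congE[OF G(1) E(1)], rule sw_congE[OF G(2) E(2)], rule sw_congE[OF G(3) E(3)])
        (use G in \<open>simp add: \<Omega>_val Q_E counit_mul E_sub \<omega>_nonzero\<close>)
    also have "\<dots> = swk h (\<lambda>h1 h2. swk k (\<lambda>k1 k2. counit H h2 * (counit H k2 * ?eps h1 k1 l)))"
      by (simp only: sw_mult_left g1)
    also have "\<dots> = ?eps h k l"
      by (rule sw_counit_pair_right[OF K S(1,2)]) (rule eps)+
    finally have "?lhs h k l = ?eps h k l" .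
    moreover have "?rhs h k l = swk h (\<lambda>h1 h2. swk k (\<lambda>k1 k2. swk l (\<lambda>l1 l2.
        counit H h2 * (counit H k2 * ((counit H h1 * counit H k1) * (\<gamma> (iv (lam a b)) l1 * \<gamma> (lam a b) l2))))))"
      by (rule sw_congE[OF G(1) E(1)], rule sw_congE[OF G(2) E(2)], rule sw_congE[OF G(3) E(3)])
        (use G in \<open>simp add: \<Omega>_val Q_E counit_mul E_sub \<omega>_nonzero\<close>)
    moreover have "\<dots> = swk h (\<lambda>h1 h2. swk k (\<lambda>k1 k2. counit H h2 * (counit H k2 * ?eps h1 k1 l)))"
      by (simp only: sw_mult_left g2)
    moreover have "\<dots> = ?eps h k l"
      by (rule sw_counit_pair_right[OF K S(1,2)]) (rule eps)+
    ultimately show ?thesis by simp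
  qed
  note homog = conjunct1[OF this] conjunct2[OF this]
  show "?lhs h k l = ?eps h k l"
    by (rule homog_eq3[where f = ?lhs and g = ?eps and r = "(*)"])
      (intro eps all_intros trilin_intros[OF Q] S homog(1); assumption)+
  show "?rhs h k l = ?eps h k l"
    by (rule homog_eq3[where f = ?rhs and g = ?eps and r = "(*)"])
      (intro eps all_intros trilin_intros[OF Q] S homog(2); assumption)+
qed

text \<open>In degree a, both products of S with an element of degree a carry a trailing L. In the
  first equation the leading inv L of S cancels it, once A(h1) h2 has collapsed to a scalar. In the
  second one inv L stands between h1 and A(h3) and has first to be moved to the front; the factor
  \<gamma>(L) in \<beta> is what the commutation rule needs for this. In the last two equations only
  scalars and values of \<gamma>(L) and \<gamma>(inv L) remain.\<close>

lemma zested_antipode: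
  assumes Q: "trilin_form (space H) (smul H) Q"
    and Q_E: "\<And>a b c h k l. \<lbrakk>a \<in> carrier G; b \<in> carrier G; c \<in> carrier G; h \<in> E a; k \<in> E b; l \<in> E c\<rbrakk> \<Longrightarrow>
      Q h k l = counit H (h \<odot> k) * inverse (\<omega> a b c) * \<gamma> (iv (lam a b)) l"
  shows "\<exists>S \<alpha> \<beta>. (\<forall>h\<in>space H. S h \<in> space H) \<and> lin (space H) (smul H) (smul H) S \<and> form \<alpha> \<and> form \<beta> \<and>
    (\<forall>h\<in>space H. sw3 H (smul H) h (\<lambda>h1 h2 h3. \<alpha> h2 \<cdot> m (S h1) h3) = \<alpha> h \<cdot> unt H \<and>
      sw3 H (smul H) h (\<lambda>h1 h2 h3. \<beta> h2 \<cdot> m h1 (S h3)) = \<beta> h \<cdot> unt H \<and>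
      sw5 H (*) h (\<lambda>h1 h2 h3 h4 h5. Q (\<beta> h2 \<cdot> h1) (S h3) (\<alpha> h4 \<cdot> h5)) = counit H h \<and>
      sw5 H (*) h (\<lambda>h1 h2 h3 h4 h5. \<Omega> (S h1) ((\<alpha> h2 * \<beta> h4) \<cdot> h3) (S h5)) = counit H h)"
proof -
  obtain A where A_endo: "\<And>a. a \<in> carrier G \<Longrightarrow> endo (A a)"
    and A_E: "\<And>a h. a \<in> carrier G \<Longrightarrow> h \<in> E a \<Longrightarrow> A a h \<in> E (inv\<^bsub>G\<^esub> a)"
    and A_left: "\<And>a h. a \<in> carrier G \<Longrightarrow> h \<in> E a \<Longrightarrow> swH h (\<lambda>h1 h2. A a h1 \<odot> h2) = counit H h \<cdot> unt H"
    and A_right: "\<And>a h. a \<in> carrier G \<Longrightarrow> h \<in> E a \<Longrightarrow> swH h (\<lambda>h1 h2. h1 \<odot> A a h2) = counit H h \<cdot> unt H"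
    by (rule graded_antipode) (rule that)
  define L where "L a = lam a (inv\<^bsub>G\<^esub> a)" for a
  have L: "L a \<in> N" "iv (L a) \<in> N" if "a \<in> carrier G" for a
    using that by (simp_all add: L_def lam_N N_iv)
  define S where "S = glue (\<lambda>a h. iv (L a) \<odot> A a h)"
  \<comment> \<open>Dictated by the third equation: the inverse associator contributes the inverse
    of \<omega>(a, inv a, a) times \<gamma>(inv L), and \<beta> is the convolution inverse of
    that.\<close>
  define \<beta> where "\<beta> = glue (\<lambda>a h. \<omega> a (inv\<^bsub>G\<^esub> a) a * \<gamma> (L a) h)"
  have S_lin: "lin (space H) (smul H) (smul H) (\<lambda>h. iv (L a) \<odot> A a h)" if "a \<in> carrier G" for a
    by (intro endo_lin endo_mul_right A_endo N_space L that)
  have S_val: "S h = iv (L a) \<odot> A a h" if "a \<in> carrier G" "h \<in> E a" for a h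
    unfolding S_def by (rule glue_E[OF that, where r = "smul H"]) (rule S_lin)
  have \<beta>_lin: "form (\<lambda>h. \<omega> a (inv\<^bsub>G\<^esub> a) a * \<gamma> (L a) h)" if "a \<in> carrier G" for a
    by (intro form_mult_left \<gamma>_form L that)
  have \<beta>_val: "\<beta> h = \<omega> a (inv\<^bsub>G\<^esub> a) a * \<gamma> (L a) h" if "a \<in> carrier G" "h \<in> E a" for a h
    unfolding \<beta>_def by (rule glue_E[OF that, where r = "(*)"]) (rule \<beta>_lin)
  have \<beta>_form: "form \<beta>" unfolding \<beta>_def by (intro glue_lin vector_space_field \<beta>_lin)
  have S_E: "S h \<in> E (inv\<^bsub>G\<^esub> a)" if "a \<in> carrier G" "h \<in> E a" for a h
    using that by (simp add: S_val N_mul_E A_E L)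
  have S_endo: "endo S"
  proof (rule endoI)
    show lin: "lin (space H) (smul H) (smul H) S" unfolding S_def by (intro glue_lin H_vs S_lin)
    fix x assume x: "x \<in> space H"
    have "S x = S (\<Sum>s\<in>{s \<in> carrier G. P s x \<noteq> 0}. P s x)" by (simp add: P_sum x)
    also have "\<dots> = (\<Sum>s\<in>{s \<in> carrier G. P s x \<noteq> 0}. S (P s x))"
      by (rule lin_sum[OF lin H_vec]) (auto intro: endo_closed P_endo x)
    also have "\<dots> \<in> space H"
      by (intro H_closed(4)) (auto intro!: E_sub[OF _ S_E] P_in x)
    finally show "S x \<in> space H" .
  qed
  \<comment> \<open>Obtained by applying the counit to the equation that A(h1) h2 is the counit of h
    times the unit.\<close>
  have A_counit: "counit H (A a h) = counit H h" if a: "a \<in> carrier G" and h: "h \<in> E a" for a h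
  proof -
    note hS = E_sub[OF a h]
    have A_S: "A a x \<in> space H" if "x \<in> space H" for x by (rule endo_closed[OF A_endo[OF a] that])
    have "counit H h = counit H (swH h (\<lambda>h1 h2. A a h1 \<odot> h2))"
      by (simp add: A_left a h lin_scale[OF counit_lin] unt_closed counit_unt)
    also have "\<dots> = swk h (\<lambda>h1 h2. counit H (A a h1 \<odot> h2))"
      by (rule sw_form[OF counit_lin hS]) (intro closed A_S)
    also have "\<dots> = swk h (\<lambda>h1 h2. counit H h2 * counit H (A a h1))"
      by (rule sw_cong[OF hS]) (simp add: counit_mul A_S)
    also have "\<dots> = counit H (A a h)"
      by (rule sw_counit_right[OF form_comp[OF counit_lin A_endo[OF a]] hS])
    finally show ?thesis by simp
  qed
  note intros = all_intros endo_comp[OF S_endo] form_comp[OF \<beta>_form] form_comp[OF counit_lin]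
    trilin_intros[OF Q]
  have S_closed: "S x \<in> space H" if "x \<in> space H" for x by (rule endo_closed[OF S_endo that])
  have iv_cancel: "L a \<odot> (iv (L a) \<odot> x) = x" "iv (L a) \<odot> (L a \<odot> x) = x"
    if "a \<in> carrier G" "x \<in> space H" for a x
    using that by (simp_all add: L N_space iv_left iv_right unt_left flip: mul_assoc)
  have L_inv: "lam (inv\<^bsub>G\<^esub> a) a = L a" if "a \<in> carrier G" for a
    using that by (simp add: L_def lam_inv)
  have m_S: "m (S x) y = iv (L a) \<odot> A a x \<odot> y \<odot> L a" "m y (S x) = y \<odot> (iv (L a) \<odot> A a x) \<odot> L a"
    if a: "a \<in> carrier G" and x: "x \<in> E a" and y: "y \<in> E a" for a x y
    using m_E[OF G.inv_closed[OF a] a S_E[OF a x] y] m_E[OF a G.inv_closed[OF a] y S_E[OF a x]]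
    by (simp_all only: L_inv[OF a] S_val[OF a x] L_def[symmetric])
  have counit_S: "counit H (S x) = counit H x" if a: "a \<in> carrier G" and x: "x \<in> E a" for a x
    using a x by (simp add: S_val counit_mul N_counit A_counit L N_space E_sub endo_closed[OF A_endo])
  have \<gamma>_S: "\<gamma> (L a) (S x) = \<gamma> (L a) (iv (L a)) * \<gamma> (L a) (A a x)"
    if a: "a \<in> carrier G" and x: "x \<in> E a" for a x
    using a x by (simp add: S_val \<gamma>_mul L N_space E_sub endo_closed[OF A_endo])
  show ?thesis
  proof (rule exI[of _ S], rule exI[of _ "counit H"], rule exI[of _ \<beta>],
      intro conjI ballI S_closed endo_lin[OF S_endo] counit_lin \<beta>_form)
    fix h assume hS: "h \<in> space H"
    show "sw3 H (smul H) h (\<lambda>h1 h2 h3. counit H h2 \<cdot> m (S h1) h3) = counit H h \<cdot> unt H" (is "?l h = ?r h")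
    proof (rule homog_eq[where f = ?l and g = ?r and r = "smul H"])
      fix a h assume a: "a \<in> carrier G" and h: "h \<in> E a"
      note hS = E_sub[OF a h]
      have A_S: "A a x \<in> space H" if "x \<in> space H" for x by (rule endo_closed[OF A_endo[OF a] that])
      note LS = L[OF a, THEN N_space]
      have T: "endo (\<lambda>y. iv (L a) \<odot> y \<odot> L a)" by (intro mul_linear_intros LS)
      have "?l h = swH h (\<lambda>h1 h2. m (S h1) h2)"
        unfolding sw3_def
        by (intro sw_cong hS sw_counit_left_endo[where f = "m (S _)"] endo_m_right endo_id S_closed)
      also have "\<dots> = swH h (\<lambda>h1 h2. iv (L a) \<odot> (A a h1 \<odot> h2) \<odot> L a)"
        by (rule sw_congE[OF a h])
          (use a in \<open>simp add: m_S mul_assoc closed A_S LS E_sub\<close>)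
      also have "\<dots> = iv (L a) \<odot> swH h (\<lambda>h1 h2. A a h1 \<odot> h2) \<odot> L a"
        by (rule sw_endo[OF T hS, symmetric]) (intro closed A_S)
      also have "\<dots> = counit H h \<cdot> unt H"
        by (simp add: A_left a h mul_scale_left mul_scale_right closed LS unt_right iv_left L)
      finally show "?l h = ?r h" .
    qed (unfold sw3_def, (intro endo_lin intros hS closed m_closed S_closed; assumption?)+)
    show "sw3 H (smul H) h (\<lambda>h1 h2 h3. \<beta> h2 \<cdot> m h1 (S h3)) = \<beta> h \<cdot> unt H" (is "?l h = ?r h")
    proof (rule homog_eq[where f = ?l and g = ?r and r = "smul H"])
      fix a h assume a: "a \<in> carrier G" and h: "h \<in> E a"
      note hS = E_sub[OF a h]
      have A_S: "A a x \<in> space H" if "x \<in> space H" for x by (rule endo_closed[OF A_endo[OF a] that])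
      note LS = L[OF a, THEN N_space]
      define w where "w = \<omega> a (inv\<^bsub>G\<^esub> a) a"
      define g where "g = \<gamma> (L a)"
      have g: "form g" unfolding g_def by (intro \<gamma>_form L a)
      \<comment> \<open>Prepared for the commutation rule. Filling the slot with L x cancels the inv
        L before it and leaves x inv L A(z) L; filling it with y L cancels the inv L after it and
        leaves inv L y A(z) L.\<close>
      define T where "T z y = w \<cdot> (iv (L a) \<odot> y \<odot> iv (L a) \<odot> A a z \<odot> L a)" for z y
      have T: "endo (T z)" if "z \<in> space H" for z
        unfolding T_def by (intro mul_linear_intros closed LS A_S that)
      have conj: "swH d (\<lambda>x y. (w * g y) \<cdot> (x \<odot> (iv (L a) \<odot> A a z) \<odot> L a)) =
          swH d (\<lambda>x y. (w * g x) \<cdot> (iv (L a) \<odot> (y \<odot> A a z) \<odot> L a))"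
        if d: "d \<in> space H" and z: "z \<in> space H" for d z
      proof -
        have "swH d (\<lambda>x y. (w * g y) \<cdot> (x \<odot> (iv (L a) \<odot> A a z) \<odot> L a)) =
            swH d (\<lambda>x y. T z (g y \<cdot> (L a \<odot> x)))"
          by (rule sw_cong[OF d])
            (simp add: T_def mul_assoc closed LS A_S z mul_scale_left mul_scale_right iv_cancel a)
        also have "\<dots> = T z (swH d (\<lambda>x y. g y \<cdot> (L a \<odot> x)))"
          by (rule sw_endo[OF T[OF z] d, symmetric]) (intro closed LS)
        also have "\<dots> = T z (swH d (\<lambda>x y. g x \<cdot> (y \<odot> L a)))"
          unfolding g_def by (simp only: \<gamma>_comm[OF L(1)[OF a] d])
        also have "\<dots> = swH d (\<lambda>x y. T z (g x \<cdot> (y \<odot> L a)))"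
          by (rule sw_endo[OF T[OF z] d]) (intro closed LS)
        also have "\<dots> = swH d (\<lambda>x y. (w * g x) \<cdot> (iv (L a) \<odot> (y \<odot> A a z) \<odot> L a))"
          by (rule sw_cong[OF d])
            (simp add: T_def mul_assoc closed LS A_S z mul_scale_left mul_scale_right iv_cancel a)
        finally show ?thesis .
      qed
      have U: "endo (\<lambda>y. (w * g x) \<cdot> (iv (L a) \<odot> y \<odot> L a))" for x by (intro mul_linear_intros LS)
      have "?l h =
          swH h (\<lambda>x d. swH d (\<lambda>y z. (w * g y) \<cdot> (x \<odot> (iv (L a) \<odot> A a z) \<odot> L a)))"
        unfolding sw3_def
        by (rule sw_congE[OF a h], rule sw_congE[OF a], assumption)
          (simp add: m_S[OF a] \<beta>_val[OF a] w_def g_def)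
      \<comment> \<open>\<open>conj\<close> acts on the pair x, y, whereas the antipode equation for
        A concerns the pair y, z. Coassociativity regroups the three factors before and
        after.\<close>
      also have "\<dots> = swH h (\<lambda>d z. swH d (\<lambda>x y. (w * g y) \<cdot> (x \<odot> (iv (L a) \<odot> A a z) \<odot> L a)))"
        by (rule sw_coassoc[OF H_vs hS, symmetric])
          (intro endo_lin mul_linear_intros endo_comp[OF A_endo] form_comp[OF g] a LS closed A_S; assumption?)+
      also have "\<dots> = swH h (\<lambda>d z. swH d (\<lambda>x y. (w * g x) \<cdot> (iv (L a) \<odot> (y \<odot> A a z) \<odot> L a)))"
        by (intro sw_cong hS conj)
      also have "\<dots> = swH h (\<lambda>x d. swH d (\<lambda>y z. (w * g x) \<cdot> (iv (L a) \<odot> (y \<odot> A a z) \<odot> L a)))"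
        by (rule sw_coassoc[OF H_vs hS])
          (intro endo_lin mul_linear_intros endo_comp[OF A_endo] form_comp[OF g] a LS closed A_S; assumption?)+
      also have "\<dots> = swH h (\<lambda>x d. counit H d \<cdot> (w * g x) \<cdot> unt H)"
      proof (rule sw_congE[OF a h])
        fix x d assume "x \<in> E a" and d: "d \<in> E a"
        have "swH d (\<lambda>y z. (w * g x) \<cdot> (iv (L a) \<odot> (y \<odot> A a z) \<odot> L a)) =
            (w * g x) \<cdot> (iv (L a) \<odot> swH d (\<lambda>y z. y \<odot> A a z) \<odot> L a)"
          by (rule sw_endo[OF U E_sub[OF a d], symmetric]) (intro closed A_S)
        also have "\<dots> = counit H d \<cdot> (w * g x) \<cdot> unt H"
          by (simp add: A_right a d mul_scale_left mul_scale_right closed LS unt_right iv_left L mult_ac)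
        finally show "swH d (\<lambda>y z. (w * g x) \<cdot> (iv (L a) \<odot> (y \<odot> A a z) \<odot> L a)) =
          counit H d \<cdot> (w * g x) \<cdot> unt H" .
      qed
      also have "\<dots> = \<beta> h \<cdot> unt H"
        by (subst sw_counit_right_endo[where f = "\<lambda>x. (w * g x) \<cdot> unt H"])
          (auto simp: \<beta>_val[OF a h] w_def g_def hS unt_closed a intro!: endo_form form_mult_left \<gamma>_form L)
      finally show "?l h = ?r h" .
    qed (unfold sw3_def, (intro endo_lin intros hS closed m_closed S_closed; assumption?)+)
    show "sw5 H (*) h (\<lambda>h1 h2 h3 h4 h5. Q (\<beta> h2 \<cdot> h1) (S h3) (counit H h4 \<cdot> h5)) = counit H h" (is "?l h = ?r h")
    proof (rule homog_eq[where f = ?l and g = ?r and r = "(*)"])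
      fix a h assume a: "a \<in> carrier G" and h: "h \<in> E a"
      let ?g = "\<gamma> (L a)" and ?g' = "\<gamma> (iv (L a))"
      \<comment> \<open>The \<gamma>(L) of \<beta> meets the \<gamma>(inv L) of the inverse
        associator; the factors between them enter through their counits only.\<close>
      have pair: "swk d (\<lambda>x y. ?g x * ?g' y) = counit H d" if "d \<in> E a" for d
        using \<gamma>_conv[OF L[OF a] E_sub[OF a that]] E_sub[OF a that] by (simp add: iv_right L a \<gamma>_one)
      have cg: "swk d (\<lambda>x y. counit H x * ?g' y) = ?g' d" if "d \<in> E a" for d
        by (rule sw_counit_left[OF \<gamma>_form[OF L(2)[OF a]] E_sub[OF a that]])
      have "?l h =
          sw5 H (*) h (\<lambda>h1 h2 h3 h4 h5. counit H h1 * (?g h2 * (counit H h3 * (counit H h4 * ?g' h5))))"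
        unfolding sw5_def sw4_def sw3_def
        by (rule sw_congE[OF a h], rule sw_congE[OF a], assumption, rule sw_congE[OF a], assumption,
            rule sw_congE[OF a], assumption)
          (use a in \<open>simp add: Q_E[OF a G.inv_closed[OF a] a E_scale[OF a] S_E[OF a] E_scale[OF a]]
            \<beta>_val[OF a] counit_S counit_mul L closed E_sub endo_closed[OF S_endo]
            lin_scale[OF counit_lin] lin_scale[OF \<gamma>_form] \<omega>_nonzero flip: L_def\<close>)
      also have "\<dots> = swk h (\<lambda>h1 d. counit H h1 * counit H d)"
        unfolding sw5_def sw4_def sw3_def
      proof (rule sw_congE[OF a h])
        fix h1 d assume d: "d \<in> E a"
        have "swk d (\<lambda>h2 d. swk d (\<lambda>h3 d. swk d
            (\<lambda>h4 h5. counit H h1 * (?g h2 * (counit H h3 * (counit H h4 * ?g' h5)))))) =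
          swk d (\<lambda>h2 d. swk d (\<lambda>h3 d. counit H h1 * (?g h2 * (counit H h3 * ?g' d))))"
          by (rule sw_congE[OF a d], rule sw_congE[OF a], assumption) (simp only: sw_mult_left cg)
        also have "\<dots> = swk d (\<lambda>h2 d. counit H h1 * (?g h2 * ?g' d))"
          by (rule sw_congE[OF a d]) (simp only: sw_mult_left cg)
        also have "\<dots> = counit H h1 * counit H d" by (simp only: sw_mult_left pair[OF d])
        finally show "swk d (\<lambda>h2 d. swk d (\<lambda>h3 d. swk d
            (\<lambda>h4 h5. counit H h1 * (?g h2 * (counit H h3 * (counit H h4 * ?g' h5)))))) =
          counit H h1 * counit H d" .
      qed
      also have "\<dots> = counit H h" by (rule sw_counit_left[OF counit_lin E_sub[OF a h]])
      finally show "?l h = ?r h" .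
    qed (unfold sw5_def sw4_def sw3_def, (intro intros hS closed m_closed S_closed; assumption?)+)
    show "sw5 H (*) h (\<lambda>h1 h2 h3 h4 h5. \<Omega> (S h1) ((counit H h2 * \<beta> h4) \<cdot> h3) (S h5)) = counit H h" (is "?l h = ?r h")
    proof (rule homog_eq[where f = ?l and g = ?r and r = "(*)"])
      fix a h assume a: "a \<in> carrier G" and h: "h \<in> E a"
      let ?g = "\<gamma> (L a)"
      have A_S: "A a x \<in> space H" if "x \<in> space H" for x by (rule endo_closed[OF A_endo[OF a] that])
      \<comment> \<open>Collects the value of \<gamma>(L) at the factor inv L of S, the scalar of
        \<beta> and the scalar of the associator.\<close>
      have one: "?g (iv (L a)) * (\<omega> a (inv\<^bsub>G\<^esub> a) a * \<omega> (inv\<^bsub>G\<^esub> a) a (inv\<^bsub>G\<^esub> a)) = 1"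
        using \<omega>_inv[OF a] \<gamma>_iv[OF L(1)[OF a]] by (simp add: L_def mult.commute)
      \<comment> \<open>As \<gamma>(L) is an algebra map, composing it with A inverts it for
        convolution.\<close>
      have pair: "swk d (\<lambda>x y. ?g x * ?g (A a y)) = counit H d" if d: "d \<in> E a" for d
      proof -
        note dS = E_sub[OF a d]
        have "swk d (\<lambda>x y. ?g x * ?g (A a y)) = swk d (\<lambda>x y. ?g (x \<odot> A a y))"
          by (rule sw_cong[OF dS]) (simp add: \<gamma>_mul L a A_S)
        also have "\<dots> = ?g (swH d (\<lambda>x y. x \<odot> A a y))"
          by (rule sw_form[OF \<gamma>_form[OF L(1)[OF a]] dS, symmetric]) (intro closed A_S)
        also have "\<dots> = counit H d"
          by (simp add: A_right a d lin_scale[OF \<gamma>_form] L unt_closed \<gamma>_unt)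
        finally show ?thesis .
      qed
      have ce: "swk d (\<lambda>x y. counit H x * counit H y) = counit H d" if "d \<in> E a" for d
        by (rule sw_counit_left[OF counit_lin E_sub[OF a that]])
      have "?l h =
          sw5 H (*) h (\<lambda>h1 h2 h3 h4 h5. counit H h1 * (counit H h2 * (counit H h3 * (?g h4 * ?g (A a h5)))))"
        unfolding sw5_def sw4_def sw3_def
        by (rule sw_congE[OF a h], rule sw_congE[OF a], assumption, rule sw_congE[OF a], assumption,
            rule sw_congE[OF a], assumption)
          (use a in \<open>simp add: \<Omega>_val[OF G.inv_closed[OF a] a G.inv_closed[OF a] S_E[OF a] E_scale[OF a] S_E[OF a]]
            \<beta>_val[OF a] counit_S \<gamma>_S E_sub L_inv lin_scale[OF counit_lin] mult_ac one\<close>)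
      also have "\<dots> = counit H h"
      proof -
        have 1: "swk d (\<lambda>h3 d. swk d (\<lambda>h4 h5. u * (v * (counit H h3 * (?g h4 * ?g (A a h5)))))) =
            u * (v * counit H d)" if d: "d \<in> E a" for d u v
        proof -
          have "swk d (\<lambda>h3 d. swk d (\<lambda>h4 h5. u * (v * (counit H h3 * (?g h4 * ?g (A a h5)))))) =
             swk d (\<lambda>h3 d. u * (v * (counit H h3 * counit H d)))"
            by (rule sw_congE[OF a d]) (simp only: sw_mult_left pair)
          also have "\<dots> = u * (v * counit H d)" by (simp only: sw_mult_left ce[OF d])
          finally show ?thesis .
        qed
        have "sw5 H (*) h (\<lambda>h1 h2 h3 h4 h5. counit H h1 * (counit H h2 * (counit H h3 * (?g h4 * ?g (A a h5))))) =
          swk h (\<lambda>h1 d. swk d (\<lambda>h2 d. counit H h1 * (counit H h2 * counit H d)))"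
          unfolding sw5_def sw4_def sw3_def
          by (rule sw_congE[OF a h], rule sw_congE[OF a], assumption, rule 1)
        also have "\<dots> = swk h (\<lambda>h1 d. counit H h1 * counit H d)"
          by (rule sw_congE[OF a h]) (simp only: sw_mult_left ce)
        also have "\<dots> = counit H h" by (rule ce[OF h])
        finally show ?thesis .
      qed
      finally show "?l h = ?r h" .
    qed (unfold sw5_def sw4_def sw3_def, (intro intros hS closed m_closed S_closed; assumption?)+)
  qed
qed

lemma mul_update:
  "sw (H\<lparr>mul := m\<rparr>) = sw H" "sw3 (H\<lparr>mul := m\<rparr>) = sw3 H" "sw5 (H\<lparr>mul := m\<rparr>) = sw5 H"
  "space (H\<lparr>mul := m\<rparr>) = space H" "smul (H\<lparr>mul := m\<rparr>) = smul H" "unt (H\<lparr>mul := m\<rparr>) = unt H"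
  "comul (H\<lparr>mul := m\<rparr>) = comul H" "counit (H\<lparr>mul := m\<rparr>) = counit H" "mul (H\<lparr>mul := m\<rparr>) = m"
  by (simp_all add: fun_eq_iff sw_def sw3_def sw4_def sw5_def)

lemma comul_m:
  assumes "h \<in> space H" "k \<in> space H"
  shows "comul H (m h k) \<approx> sw H fscale h (\<lambda>h1 h2. sw H fscale k (\<lambda>k1 k2. pure (m h1 k1) (m h2 k2)))"
  unfolding tens_eq_def using sw_m[OF _ assms]
  by (auto simp: sw_lsum[OF vector_space_field] sw_def[of H _ "m h k"])

theorem zested_coquasi_hopf: "coquasi_hopf (H\<lparr>mul := m\<rparr>) \<Omega>"
proof -
  obtain Q where Q: "trilin_form (space H) (smul H) Q"
    and Q_E: "\<And>a b c h k l. \<lbrakk>a \<in> carrier G; b \<in> carrier G; c \<in> carrier G; h \<in> E a; k \<in> E b; l \<in> E c\<rbrakk> \<Longrightarrow>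
      Q h k l = counit H (h \<odot> k) * inverse (\<omega> a b c) * \<gamma> (iv (lam a b)) l"
    by (rule zesting_assoc_inverse_exists) (rule that)
  have inv: "swk h (\<lambda>h1 h2. swk k (\<lambda>k1 k2. swk l (\<lambda>l1 l2. \<Omega> h1 k1 l1 * Q h2 k2 l2))) =
        counit H h * counit H k * counit H l"
      "swk h (\<lambda>h1 h2. swk k (\<lambda>k1 k2. swk l (\<lambda>l1 l2. Q h1 k1 l1 * \<Omega> h2 k2 l2))) =
        counit H h * counit H k * counit H l"
    if "h \<in> space H" "k \<in> space H" "l \<in> space H" for h k l
    by (rule inverse_assoc[OF Q _ that]; rule Q_E; assumption)+
  have "coalgebra (H\<lparr>mul := m\<rparr>)"
    using coalgebra by (simp add: coalgebra_def sw_def)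
  moreover note zested_antipode[OF Q Q_E]
  ultimately show ?thesis
    unfolding coquasi_hopf_def mul_update
    by (intro conjI ballI exI[of _ Q])
      (assumption | (rule m_bilin m_closed unt_closed comul_m counit_m comul_unt counit_unt unt_m m_unt
        \<Omega>_trilin quasi_assoc pentagon \<Omega>_unt Q inv; assumption))+
qed

end

section \<open>Bosonizations\<close>

lemma poly_mapping_sum_single: "(\<Sum>g\<in>keys t. single g (lookup t g)) = t"
  by (rule poly_mapping_eqI) (auto simp: lookup_sum lookup_single when_def in_keys_iff)

lemma keys_fscale: "keys (fscale c u) \<subseteq> keys u"
  by (auto simp: in_keys_iff)

lemma keys_lsum_fscale: 
  assumes "\<And>x. x \<in> keys u \<Longrightarrow> keys (F x) \<subseteq> A"
  shows "keys (lsum fscale u F) \<subseteq> A"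
proof -
  have "keys (lsum fscale u F) \<subseteq> (\<Union>x\<in>keys u. keys (fscale (lookup u x) (F x)))"
    unfolding lsum_def by (rule keys_sum)
  also have "\<dots> \<subseteq> A" by (intro UN_least subset_trans[OF keys_fscale assms])
  finally show ?thesis .
qed

locale boson =
  fixes \<Gamma> :: "('g, 'm) monoid_scheme" and B :: "('k::field, 'b::ab_group_add, 'g) yd_hopf_data"
  assumes \<Gamma>: "group \<Gamma>" and B: "yd_graded_hopf \<Gamma> B" and H_hopf: "hopf_algebra (bosonization \<Gamma> B)"
begin

abbreviation H :: "('k, 'g \<Rightarrow>\<^sub>0 'b) hopf_data" where "H \<equiv> bosonization \<Gamma> B"

sublocale \<Gamma>: group \<Gamma> by (rule \<Gamma>)

sublocale hopf H
proof
  show "hopf_algebra H" by (rule H_hopf)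
  thus "coalgebra H" by (simp add: hopf_algebra_def bialgebra_def)
qed

sublocale CB: coalg B
  by unfold_locales (use B in \<open>simp add: yd_graded_hopf_def\<close>)

lemma yd: "yd_module \<Gamma> (space B) (smul B) (act B) (coact B)"
  using B by (simp add: yd_graded_hopf_def)

lemma act_closed: "g \<in> carrier \<Gamma> \<Longrightarrow> x \<in> space B \<Longrightarrow> act B g x \<in> space B"
  and act_lin: "g \<in> carrier \<Gamma> \<Longrightarrow> lin (space B) (smul B) (smul B) (act B g)"
  and coact_keys: "x \<in> space B \<Longrightarrow> u \<in> keys (coact B x) \<Longrightarrow> u \<in> carrier \<Gamma>"
  and coact_closed: "x \<in> space B \<Longrightarrow> lookup (coact B x) u \<in> space B"
  and coact_lin: "lin (space B) (smul B) (smul B) (\<lambda>v. lookup (coact B v) u)"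
  and coact_sum: "x \<in> space B \<Longrightarrow> (\<Sum>u\<in>keys (coact B x). lookup (coact B x) u) = x"
  using yd unfolding yd_module_def by blast+

lemma B_alg: "algebra B"
  using B unfolding yd_graded_hopf_def by blast

lemma B_mul_closed: "x \<in> space B \<Longrightarrow> y \<in> space B \<Longrightarrow> mul B x y \<in> space B"
  and B_mul_bilin: "bilin (space B) (smul B) (space B) (smul B) (smul B) (mul B)"
  and B_unt_closed: "unt B \<in> space B"
  and B_unt_left: "x \<in> space B \<Longrightarrow> mul B (unt B) x = x"
  and B_unt_right: "x \<in> space B \<Longrightarrow> mul B x (unt B) = x"
  using B_alg unfolding algebra_def by blast+

lemmas B_equivariance = B[unfolded yd_graded_hopf_def, THEN conjunct2, THEN conjunct2, THEN conjunct2, THEN conjunct1]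
lemmas B_braided = B[unfolded yd_graded_hopf_def, THEN conjunct2, THEN conjunct2, THEN conjunct2, THEN conjunct2, THEN conjunct1]

lemma counit_coact: "\<lbrakk>x \<in> space B; g \<in> carrier \<Gamma>; g \<noteq> \<one>\<^bsub>\<Gamma>\<^esub>\<rbrakk> \<Longrightarrow>
      counit B (lookup (coact B x) g) = 0"
  using B_equivariance[THEN conjunct2, THEN conjunct2, THEN conjunct2, THEN conjunct2, THEN conjunct2, THEN conjunct2, THEN conjunct2] by blast

lemma counit_act: "g \<in> carrier \<Gamma> \<Longrightarrow> x \<in> space B \<Longrightarrow> counit B (act B g x) = counit B x"
  using B_equivariance[THEN conjunct2, THEN conjunct2, THEN conjunct2, THEN conjunct2, THEN conjunct2, THEN conjunct2, THEN conjunct1] by blast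

lemma act_unt: "g \<in> carrier \<Gamma> \<Longrightarrow> act B g (unt B) = unt B"
  using B_equivariance[THEN conjunct2, THEN conjunct2, THEN conjunct1] by blast

lemma coact_B_unt: "coact B (unt B) = single \<one>\<^bsub>\<Gamma>\<^esub> (unt B)"
  by (rule B_equivariance[THEN conjunct2, THEN conjunct2, THEN conjunct2, THEN conjunct1])

lemma comul_B_unt: "comul B (unt B) \<approx>\<^bsub>B\<^esub> pure (unt B) (unt B)"
  by (rule B_braided[THEN conjunct2, THEN conjunct1])

lemma B_counit_mul: "x \<in> space B \<Longrightarrow> y \<in> space B \<Longrightarrow> counit B (mul B x y) = counit B x * counit B y"
  using B_braided[THEN conjunct2, THEN conjunct2, THEN conjunct1] by blast

lemma B_counit_unt: "counit B (unt B) = 1"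
  by (rule B_braided[THEN conjunct2, THEN conjunct2, THEN conjunct2])

lemma B_zero: "0 \<in> space B" by (rule CB.H_closed)

lemma B_unt_nonzero: "unt B \<noteq> 0"
  using B_counit_unt lin_zero[OF CB.counit_lin B_zero] by auto

text \<open>The counit of \<open>B\<close> vanishes on all components of the coaction except that of
  degree \<one>, so that component carries the whole counit of y.\<close>

lemma coact_counit_sum:
  assumes r: "vector_space r" and y: "y \<in> space B"
  shows "(\<Sum>u\<in>keys (coact B y). r (counit B (lookup (coact B y) u)) (f u)) = r (counit B y) (f \<one>\<^bsub>\<Gamma>\<^esub>)"
proof -
  interpret R: vector_space r by (rule r)
  have "(\<Sum>u\<in>keys (coact B y). r (counit B (lookup (coact B y) u)) (f u)) =
      (\<Sum>u\<in>keys (coact B y). r (counit B (lookup (coact B y) u)) (f \<one>\<^bsub>\<Gamma>\<^esub>))"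
    by (rule sum.cong) (use counit_coact[OF y] coact_keys[OF y] in force)+
  also have "\<dots> = r (counit B (\<Sum>u\<in>keys (coact B y). lookup (coact B y) u)) (f \<one>\<^bsub>\<Gamma>\<^esub>)"
    unfolding R.scale_sum_left[symmetric]
    by (subst lin_sum[OF CB.counit_lin CB.H_vec]) (auto intro: coact_closed y)
  finally show ?thesis by (simp add: coact_sum y)
qed

lemma H_space: "space H = {t. keys t \<subseteq> carrier \<Gamma> \<and> (\<forall>g. lookup t g \<in> space B)}"
  and H_counit: "counit H t = (\<Sum>g\<in>keys t. counit B (lookup t g))"
  and H_unt: "unt H = unt B #\<^sub>b \<one>\<^bsub>\<Gamma>\<^esub>"
  by (simp_all add: bosonization_def)

lemma lookup_smul: "lookup (smul H c t) g = smul B c (lookup t g)"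
  using CB.V.scale_zero_right[of c]
  by (simp add: bosonization_def Poly_Mapping.map.rep_eq when_def)

lemma H_lookup: "t \<in> space H \<Longrightarrow> lookup t g \<in> space B"
  and H_keys: "t \<in> space H \<Longrightarrow> g \<in> keys t \<Longrightarrow> g \<in> carrier \<Gamma>"
  by (auto simp: H_space)

lemma single_H: "g \<in> carrier \<Gamma> \<Longrightarrow> x \<in> space B \<Longrightarrow> x #\<^sub>b g \<in> space H"
  by (auto simp: H_space lookup_single when_def B_zero)

lemma smul_single: "smul H c (x #\<^sub>b g) = smul B c x #\<^sub>b g"
  using CB.V.scale_zero_right[of c] by (intro poly_mapping_eqI) (auto simp: lookup_smul lookup_single when_def)

lemma keys_sum_on_superset:
  assumes "finite A" "keys t \<subseteq> A" "\<And>g. lin (space B) (smul B) r (F g)"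
  shows "(\<Sum>g\<in>keys t. F g (lookup t g)) = (\<Sum>g\<in>A. F g (lookup t g))"
  using assms(1,2) lin_zero[OF assms(3) B_zero]
  by (intro sum.mono_neutral_left) (auto simp: in_keys_iff)

lemma keys_sum_lin:
  assumes r: "vector_space r" and F: "\<And>g. lin (space B) (smul B) r (F g)"
  shows "lin (space H) (smul H) r (\<lambda>t. \<Sum>g\<in>keys t. F g (lookup t g))"
proof (rule linI)
  fix t u assume t: "t \<in> space H" and u: "u \<in> space H"
  let ?A = "keys t \<union> keys u"
  have "(\<Sum>g\<in>keys (t + u). F g (lookup (t + u) g)) = (\<Sum>g\<in>?A. F g (lookup (t + u) g))"
    by (rule keys_sum_on_superset[OF _ Poly_Mapping.keys_add F]) simp
  also have "\<dots> = (\<Sum>g\<in>?A. F g (lookup t g)) + (\<Sum>g\<in>?A. F g (lookup u g))"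
    by (simp add: lookup_add lin_add[OF F] H_lookup t u sum.distrib)
  finally show "(\<Sum>g\<in>keys (t + u). F g (lookup (t + u) g)) =
      (\<Sum>g\<in>keys t. F g (lookup t g)) + (\<Sum>g\<in>keys u. F g (lookup u g))"
    by (simp add: keys_sum_on_superset[of ?A, OF _ _ F])
next
  interpret R: vector_space r by (rule r)
  fix c t assume t: "t \<in> space H"
  have "keys (smul H c t) \<subseteq> keys t" by (auto simp: in_keys_iff lookup_smul)
  hence "(\<Sum>g\<in>keys (smul H c t). F g (lookup (smul H c t) g)) = (\<Sum>g\<in>keys t. F g (lookup (smul H c t) g))"
    by (intro keys_sum_on_superset[OF _ _ F]) simp_all
  thus "(\<Sum>g\<in>keys (smul H c t). F g (lookup (smul H c t) g)) = r c (\<Sum>g\<in>keys t. F g (lookup t g))"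
    by (simp add: lookup_smul lin_scale[OF F] H_lookup t R.scale_sum_right)
qed

lemma sw_boson:
  assumes r: "vector_space r"
  shows "sw H r t F = (\<Sum>g\<in>keys t. sw B r (lookup t g) (\<lambda>x1 x2.
    \<Sum>u\<in>keys (coact B x2). F (x1 #\<^sub>b (u \<otimes>\<^bsub>\<Gamma>\<^esub> g)) (lookup (coact B x2) u #\<^sub>b g)))"
proof -
  interpret R: vector_space r by (rule r)
  have "comul H t = (\<Sum>g\<in>keys t. sw B fscale (lookup t g) (\<lambda>x1 x2.
        \<Sum>u\<in>keys (coact B x2). pure (x1 #\<^sub>b (u \<otimes>\<^bsub>\<Gamma>\<^esub> g)) (lookup (coact B x2) u #\<^sub>b g)))"
    by (simp add: bosonization_def)
  thus ?thesis by (simp add: sw_def[of H] R.lsum_Sum sw_lsum[OF r])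
qed

text \<open>The second factor of the coproduct is x(2)(0) # g. A counit applied to it leaves only u
  = \<one>, after which the counit axiom of \<open>B\<close> removes x(2). All sums in which \<pi>
  or \<gamma> falls on the second factor are computed in this way.\<close>

lemma sw_boson_counit_right:
  assumes r: "vector_space r" and f: "\<And>k. k \<in> carrier \<Gamma> \<Longrightarrow> lin (space B) (smul B) r (\<lambda>x. f k x)"
    and h: "h \<in> space H"
    and F_one: "\<And>g x. g \<in> carrier \<Gamma> \<Longrightarrow> x \<in> space B \<Longrightarrow> F \<one>\<^bsub>\<Gamma>\<^esub> g x = f g x"
  shows "(\<Sum>g\<in>keys h. sw B r (lookup h g) (\<lambda>x1 x2.
    \<Sum>u\<in>keys (coact B x2). r (counit B (lookup (coact B x2) u)) (F u g x1))) =
    (\<Sum>g\<in>keys h. f g (lookup h g))"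
proof (rule sum.cong)
  fix g assume g: "g \<in> keys h"
  note gS = H_keys[OF h g]
  note x = H_lookup[OF h, of g]
  have "sw B r (lookup h g) (\<lambda>x1 x2. \<Sum>u\<in>keys (coact B x2). r (counit B (lookup (coact B x2) u)) (F u g x1)) =
      sw B r (lookup h g) (\<lambda>x1 x2. r (counit B x2) (f g x1))"
    by (rule CB.sw_cong[OF x]) (simp add: coact_counit_sum[OF r, where f = "\<lambda>u. F u g _"] F_one gS)
  also have "\<dots> = f g (lookup h g)" by (rule CB.sw_counit_right[OF f[OF gS] x])
  finally show "sw B r (lookup h g) (\<lambda>x1 x2. \<Sum>u\<in>keys (coact B x2). r (counit B (lookup (coact B x2) u)) (F u g x1)) =
      f g (lookup h g)" .
qed simp

text \<open>The index set is the support of the coaction, which depends on y; linearity is checked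
  over a finite set containing all supports involved.\<close>

lemma coact_fun_lin:
  assumes r: "vector_space r" and f: "\<And>u. u \<in> carrier \<Gamma> \<Longrightarrow> lin (space B) (smul B) r (f u)"
  shows "lin (space B) (smul B) r (\<lambda>y. \<Sum>u\<in>keys (coact B y). f u (lookup (coact B y) u))"
proof (rule linI)
  have sup: "(\<Sum>u\<in>keys (coact B y). f u (lookup (coact B y) u)) = (\<Sum>u\<in>A. f u (lookup (coact B y) u))"
    if "finite A" "A \<subseteq> carrier \<Gamma>" "keys (coact B y) \<subseteq> A" for A y
    using that lin_zero[OF f B_zero] by (intro sum.mono_neutral_left) (auto simp: in_keys_iff)
  {
    fix x y assume x: "x \<in> space B" and y: "y \<in> space B"
    let ?A = "keys (coact B x) \<union> keys (coact B y) \<union> keys (coact B (x + y))"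
    have A: "finite ?A" "?A \<subseteq> carrier \<Gamma>" using coact_keys x y CB.H_closed(2)[OF x y] by auto
    have "(\<Sum>u\<in>keys (coact B (x + y)). f u (lookup (coact B (x + y)) u)) =
        (\<Sum>u\<in>?A. f u (lookup (coact B (x + y)) u))"
      by (rule sup[OF A]) auto
    also have "\<dots> = (\<Sum>u\<in>?A. f u (lookup (coact B x) u) + f u (lookup (coact B y) u))"
      by (rule sum.cong)
        (use A(2) in \<open>auto simp: lin_add[OF coact_lin] x y intro!: lin_add[OF f] coact_closed\<close>)
    also have "\<dots> = (\<Sum>u\<in>keys (coact B x). f u (lookup (coact B x) u)) + (\<Sum>u\<in>keys (coact B y). f u (lookup (coact B y) u))"
      unfolding sum.distrib by (intro arg_cong2[where f = "(+)"] sup[symmetric] A) auto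
    finally show "(\<Sum>u\<in>keys (coact B (x + y)). f u (lookup (coact B (x + y)) u)) =
      (\<Sum>u\<in>keys (coact B x). f u (lookup (coact B x) u)) + (\<Sum>u\<in>keys (coact B y). f u (lookup (coact B y) u))" .
  next
    interpret R: vector_space r by (rule r)
    fix c x assume x: "x \<in> space B"
    let ?A = "keys (coact B x) \<union> keys (coact B (smul B c x))"
    have A: "finite ?A" "?A \<subseteq> carrier \<Gamma>" using coact_keys x CB.H_closed(3)[OF x] by auto
    have "(\<Sum>u\<in>keys (coact B (smul B c x)). f u (lookup (coact B (smul B c x)) u)) =
        (\<Sum>u\<in>?A. f u (lookup (coact B (smul B c x)) u))"
      by (rule sup[OF A]) auto
    also have "\<dots> = (\<Sum>u\<in>?A. r c (f u (lookup (coact B x) u)))"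
      by (rule sum.cong)
        (use A(2) in \<open>auto simp: lin_scale[OF coact_lin] x intro!: lin_scale[OF f] coact_closed\<close>)
    also have "\<dots> = r c (\<Sum>u\<in>keys (coact B x). f u (lookup (coact B x) u))"
      unfolding R.scale_sum_right[symmetric] by (intro arg_cong[where f = "r c"] sup[symmetric] A) auto
    finally show "(\<Sum>u\<in>keys (coact B (smul B c x)). f u (lookup (coact B (smul B c x)) u)) =
      r c (\<Sum>u\<in>keys (coact B x). f u (lookup (coact B x) u))" .
  }
qed

lemma H_mul: "mul H t u = (\<Sum>g\<in>keys t. \<Sum>h\<in>keys u.
    mul B (lookup t g) (act B g (lookup u h)) #\<^sub>b (g \<otimes>\<^bsub>\<Gamma>\<^esub> h))"
  by (simp add: bosonization_def)

text \<open>Here the counit falls on x(1), and the coaction of x survives in full; this is how x(-1)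
  enters the commutation rule.\<close>

lemma sw_boson_counit_left:
  assumes r: "vector_space r"
    and f: "\<And>k u. k \<in> carrier \<Gamma> \<Longrightarrow> u \<in> carrier \<Gamma> \<Longrightarrow> lin (space B) (smul B) r (f k u)"
    and h: "h \<in> space H"
  shows "(\<Sum>g\<in>keys h. sw B r (lookup h g) (\<lambda>x1 x2.
    \<Sum>u\<in>keys (coact B x2). r (counit B x1) (f g u (lookup (coact B x2) u)))) =
    (\<Sum>g\<in>keys h. \<Sum>u\<in>keys (coact B (lookup h g)). f g u (lookup (coact B (lookup h g)) u))"
proof (rule sum.cong)
  interpret R: vector_space r by (rule r)
  fix g assume g: "g \<in> keys h"
  show "sw B r (lookup h g) (\<lambda>x1 x2. \<Sum>u\<in>keys (coact B x2). r (counit B x1) (f g u (lookup (coact B x2) u))) =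
      (\<Sum>u\<in>keys (coact B (lookup h g)). f g u (lookup (coact B (lookup h g)) u))"
    unfolding R.scale_sum_right[symmetric]
    by (rule CB.sw_counit_left[OF coact_fun_lin[OF r f[OF H_keys[OF h g]]] H_lookup[OF h]])
qed simp

lemma lin_mul:
  assumes F: "lin (space H) (smul H) r F" and t: "t \<in> space H" and u: "u \<in> space H"
  shows "F (mul H t u) = (\<Sum>g\<in>keys t. \<Sum>h\<in>keys u.
    F (mul B (lookup t g) (act B g (lookup u h)) #\<^sub>b (g \<otimes>\<^bsub>\<Gamma>\<^esub> h)))"
proof -
  have c: "mul B (lookup t g) (act B g (lookup u h)) #\<^sub>b (g \<otimes>\<^bsub>\<Gamma>\<^esub> h) \<in> space H"
    if "g \<in> keys t" "h \<in> keys u" for g h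
    using that by (intro single_H B_mul_closed act_closed H_lookup t u \<Gamma>.m_closed H_keys[OF t] H_keys[OF u])
  have "F (mul H t u) = (\<Sum>g\<in>keys t. F (\<Sum>h\<in>keys u.
      mul B (lookup t g) (act B g (lookup u h)) #\<^sub>b (g \<otimes>\<^bsub>\<Gamma>\<^esub> h)))"
    unfolding H_mul by (intro lin_sum[OF F H_vec] H_closed(4) c)
  also have "\<dots> = (\<Sum>g\<in>keys t. \<Sum>h\<in>keys u.
      F (mul B (lookup t g) (act B g (lookup u h)) #\<^sub>b (g \<otimes>\<^bsub>\<Gamma>\<^esub> h)))"
    by (intro sum.cong refl lin_sum[OF F H_vec] c)
  finally show ?thesis .
qed

lemma mul_single:
  assumes "g \<in> carrier \<Gamma>" "h \<in> carrier \<Gamma>" "x \<in> space B" "y \<in> space B"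
  shows "mul H (x #\<^sub>b g) (y #\<^sub>b h) = mul B x (act B g y) #\<^sub>b (g \<otimes>\<^bsub>\<Gamma>\<^esub> h)"
proof -
  have z: "mul B 0 z = 0" "mul B x 0 = 0" if "z \<in> space B" for z
    using lin_zero[OF bilin_left[OF B_mul_bilin that] B_zero] lin_zero[OF bilin_right[OF B_mul_bilin assms(3)] B_zero]
    by simp_all
  have a: "act B g 0 = 0" by (rule lin_zero[OF act_lin[OF assms(1)] B_zero])
  show ?thesis
    using z[OF act_closed[OF assms(1,4)]] a by (simp add: H_mul lookup_single when_def)
qed

abbreviation grp :: "'g \<Rightarrow> ('g \<Rightarrow>\<^sub>0 'b)" where "grp \<equiv> grp_emb B"

lemma grp_H: "g \<in> carrier \<Gamma> \<Longrightarrow> grp g \<in> space H"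
  by (simp add: single_H B_unt_closed)

lemma grp_mul: "g \<in> carrier \<Gamma> \<Longrightarrow> h \<in> carrier \<Gamma> \<Longrightarrow> mul H (grp g) (grp h) = grp (g \<otimes>\<^bsub>\<Gamma>\<^esub> h)"
  by (simp add: mul_single B_unt_closed act_unt B_unt_left)

lemma single_mul_grp: "\<lbrakk>g \<in> carrier \<Gamma>; h \<in> carrier \<Gamma>; x \<in> space B\<rbrakk> \<Longrightarrow>
      mul H (x #\<^sub>b g) (grp h) = x #\<^sub>b (g \<otimes>\<^bsub>\<Gamma>\<^esub> h)"
  by (simp add: mul_single B_unt_closed act_unt B_unt_right)

lemma grp_mul_single: "\<lbrakk>g \<in> carrier \<Gamma>; h \<in> carrier \<Gamma>; x \<in> space B\<rbrakk> \<Longrightarrow>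
      mul H (grp g) (x #\<^sub>b h) = act B g x #\<^sub>b (g \<otimes>\<^bsub>\<Gamma>\<^esub> h)"
  by (simp add: mul_single B_unt_closed act_closed B_unt_left)

lemma counit_single: "counit H (x #\<^sub>b g) = counit B x"
  using lin_zero[OF CB.counit_lin B_zero] by (simp add: H_counit)

text \<open>Rests on the unit of \<open>B\<close> being nonzero, which its counit shows. It allows
  data indexed by group elements to be read as data indexed by group-likes.\<close>

lemma inj_grp: "inj_on grp A"
proof (rule inj_onI)
  fix g h assume "grp g = grp h"
  hence "lookup (grp g) h = unt B" by simp
  thus "g = h" using B_unt_nonzero by (auto simp: lookup_single when_def split: if_splits)
qed

lemma single_lin: "lin (space B) (smul B) (smul H) (\<lambda>x. x #\<^sub>b g)"
  by (rule linI) (simp_all add: single_add smul_single)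

lemma comp_single_lin:
  assumes "lin (space H) (smul H) r f" "g \<in> carrier \<Gamma>"
  shows "lin (space B) (smul B) r (\<lambda>x. f (x #\<^sub>b g))"
  by (rule linI) 
    (simp_all add: single_add lin_add[OF assms(1)] lin_scale[OF assms(1)] single_H assms(2) flip: smul_single)

text \<open>The unit of \<open>B\<close> is coinvariant and group-like. The latter is only an
  equality of tensors, so the remaining part of the coproduct formula is packed into a bilinear form
  \<open>F\<close> on \<open>B\<close>.\<close>

lemma grp_grouplike: 
  assumes g: "g \<in> carrier \<Gamma>" shows "comul H (grp g) \<approx>\<^bsub>H\<^esub> pure (grp g) (grp g)"
  unfolding tens_eq_def
proof (intro allI impI)
  note K = vector_space_field
  fix f :: "('g \<Rightarrow>\<^sub>0 'b) \<Rightarrow> ('g \<Rightarrow>\<^sub>0 'b) \<Rightarrow> 'k" assume f: "bilin (space H) (smul H) (space H) (smul H) (*) f"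
  define F where "F x1 x2 = (\<Sum>u\<in>keys (coact B x2). f (x1 #\<^sub>b (u \<otimes>\<^bsub>\<Gamma>\<^esub> g)) (lookup (coact B x2) u #\<^sub>b g))" for x1 x2
  have F1: "lin (space B) (smul B) (*) (F x1)" if "x1 \<in> space B" for x1
    unfolding F_def by (intro coact_fun_lin K comp_single_lin bilin_right[OF f] single_H g that \<Gamma>.m_closed)
  have F2: "lin (space B) (smul B) (*) (\<lambda>x1. F x1 x2)" if x2: "x2 \<in> space B" for x2
  proof (rule linI)
    have 1: "lin (space B) (smul B) (*) (\<lambda>x1. f (x1 #\<^sub>b (u \<otimes>\<^bsub>\<Gamma>\<^esub> g)) (lookup (coact B x2) u #\<^sub>b g))"
      if "u \<in> keys (coact B x2)" for u
      by (intro comp_single_lin bilin_left[OF f] single_H g \<Gamma>.m_closed coact_keys[OF x2 that] coact_closed x2)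
    fix x y c assume "x \<in> space B" "y \<in> space B"
    thus "F (x + y) x2 = F x x2 + F y x2" by (simp add: F_def lin_add[OF 1] sum.distrib)
  next
    have 1: "lin (space B) (smul B) (*) (\<lambda>x1. f (x1 #\<^sub>b (u \<otimes>\<^bsub>\<Gamma>\<^esub> g)) (lookup (coact B x2) u #\<^sub>b g))"
      if "u \<in> keys (coact B x2)" for u
      by (intro comp_single_lin bilin_left[OF f] single_H g \<Gamma>.m_closed coact_keys[OF x2 that] coact_closed x2)
    fix x c assume "x \<in> space B"
    thus "F (smul B c x) x2 = c * F x x2" by (simp add: F_def lin_scale[OF 1] sum_distrib_left)
  qed
  have "lsum (*) (comul H (grp g)) (\<lambda>(a, b). f a b) = sw B (*) (unt B) F"
    using sw_boson[OF K, of "grp g" f] B_unt_nonzero by (simp add: sw_def[of H] F_def[abs_def])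
  also have "\<dots> = F (unt B) (unt B)"
    using vector_space.tens_eq_lsum[OF K comul_B_unt bilinI[OF F1 F2]] by (simp add: sw_def)
  also have "\<dots> = f (grp g) (grp g)"
    using B_unt_nonzero by (simp add: F_def coact_B_unt g)
  finally show "lsum (*) (comul H (grp g)) (\<lambda>(a, b). f a b) = lsum (*) (pure (grp g) (grp g)) (\<lambda>(a, b). f a b)"
    by simp
qed

end

lemma fscale_single: "fscale c (single x d) = single x (c * d)"
  by (rule poly_mapping_eqI) (simp add: lookup_single when_def)

text \<open>The support enters through \<open>\<iota>_coact\<close>: every degree occurring in the
  coaction of \<open>B\<close> is sent to the neutral element.\<close>

locale boson_graded = boson \<Gamma> B
  for \<Gamma> :: "('g, 'm) monoid_scheme" and B :: "('k::field, 'b::ab_group_add, 'g) yd_hopf_data" +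
  fixes G :: "('s, 'n) monoid_scheme" and \<iota> :: "'g \<Rightarrow> 's"
  assumes group_G: "group G" and \<iota>_hom: "\<iota> \<in> hom \<Gamma> G" and \<iota>_surj: "\<iota> ` carrier \<Gamma> = carrier G"
    and \<iota>_coact: "x \<in> space B \<Longrightarrow> u \<in> keys (coact B x) \<Longrightarrow> \<iota> u = \<one>\<^bsub>G\<^esub>"
begin

definition E :: "'s \<Rightarrow> ('g \<Rightarrow>\<^sub>0 'b) set" where
  "E s = {h \<in> space H. \<forall>g\<in>keys h. \<iota> g = s}"

definition P :: "'s \<Rightarrow> ('g \<Rightarrow>\<^sub>0 'b) \<Rightarrow> ('g \<Rightarrow>\<^sub>0 'b)" where
  "P s h = (\<Sum>g\<in>keys h. if \<iota> g = s then lookup h g #\<^sub>b g else 0)"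

lemma lookup_P: "lookup (P s h) g = (if \<iota> g = s then lookup h g else 0)"
proof -
  have "lookup (P s h) g = (\<Sum>g'\<in>keys h. if g' = g then (if \<iota> g = s then lookup h g else 0) else 0)"
    unfolding P_def lookup_sum by (rule sum.cong) (auto simp: lookup_single when_def)
  thus ?thesis by (auto simp: in_keys_iff)
qed

lemma keys_P: "keys (P s h) = {g \<in> keys h. \<iota> g = s}"
  by (auto simp: in_keys_iff lookup_P split: if_splits)

lemma P_H: "h \<in> space H \<Longrightarrow> P s h \<in> space H"
  by (auto simp: H_space keys_P lookup_P B_zero)

lemma \<iota>_closed: "g \<in> carrier \<Gamma> \<Longrightarrow> \<iota> g \<in> carrier G"
  and \<iota>_mult: "g \<in> carrier \<Gamma> \<Longrightarrow> h \<in> carrier \<Gamma> \<Longrightarrow> \<iota> (g \<otimes>\<^bsub>\<Gamma>\<^esub> h) = \<iota> g \<otimes>\<^bsub>G\<^esub> \<iota> h"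
  using \<iota>_hom by (auto simp: hom_def)

lemma \<iota>_one: "\<iota> \<one>\<^bsub>\<Gamma>\<^esub> = \<one>\<^bsub>G\<^esub>"
  by (rule hom_one[OF \<iota>_hom \<Gamma> group_G])

lemma \<iota>_coact_mult: "\<lbrakk>x \<in> space B; u \<in> keys (coact B x); g \<in> carrier \<Gamma>\<rbrakk> \<Longrightarrow>
      \<iota> (u \<otimes>\<^bsub>\<Gamma>\<^esub> g) = \<iota> g"
  using \<iota>_closed[of g] by (simp add: \<iota>_mult coact_keys \<iota>_coact group.is_monoid[OF group_G] monoid.l_one)

lemma single_E: "g \<in> carrier \<Gamma> \<Longrightarrow> x \<in> space B \<Longrightarrow> x #\<^sub>b g \<in> E (\<iota> g)"
  by (auto simp: E_def single_H split: if_splits)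

sublocale graded_hopf H G E P
proof (rule graded_hopf.intro[OF hopf_axioms graded_hopf_axioms.intro])
  show "group G" by (rule group_G)
  show "h \<in> space H" if "h \<in> E s" for s h using that by (simp add: E_def)
  show "P s h \<in> E s" if "h \<in> space H" for s h
    using that by (simp add: E_def P_H keys_P)
  show "P s h = (if s = a then h else 0)" if "h \<in> E a" for s a h
    using that by (intro poly_mapping_eqI) (auto simp: E_def lookup_P in_keys_iff)
  show "endo (P s)" for s
  proof (rule endoI)
    show "P s x \<in> space H" if "x \<in> space H" for x
      using that by (rule P_H)
    show "lin (space H) (smul H) (smul H) (P s)"
      unfolding P_def
      by (rule keys_sum_lin[OF H_vs]) (simp add: lin_def single_add smul_single)
  qed
  fix h assume h: "h \<in> space H"
  have D: "{s \<in> carrier G. P s h \<noteq> 0} \<subseteq> \<iota> ` keys h"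
  proof
    fix s assume "s \<in> {s \<in> carrier G. P s h \<noteq> 0}"
    then obtain g where "lookup (P s h) g \<noteq> 0" by (auto simp: poly_mapping_eq_iff fun_eq_iff)
    thus "s \<in> \<iota> ` keys h" by (auto simp: lookup_P in_keys_iff split: if_splits)
  qed
  show fin: "finite {s \<in> carrier G. P s h \<noteq> 0}" by (rule finite_subset[OF D]) simp
  show "(\<Sum>s\<in>{s \<in> carrier G. P s h \<noteq> 0}. P s h) = h"
  proof (rule poly_mapping_eqI)
    fix g
    have "P (\<iota> g) h \<noteq> 0" if "lookup h g \<noteq> 0"
      using that lookup_P[of "\<iota> g" h g] by auto
    hence "lookup h g = 0 \<or> \<iota> g \<in> {s \<in> carrier G. P s h \<noteq> 0}"
      using \<iota>_closed H_keys[OF h] by (auto simp: in_keys_iff)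
    moreover have "lookup (\<Sum>s\<in>{s \<in> carrier G. P s h \<noteq> 0}. P s h) g =
        (\<Sum>s\<in>{s \<in> carrier G. P s h \<noteq> 0}. if \<iota> g = s then lookup h g else 0)"
      by (simp add: lookup_sum lookup_P)
    ultimately show "lookup (\<Sum>s\<in>{s \<in> carrier G. P s h \<noteq> 0}. P s h) g = lookup h g"
      using fin by (auto simp: sum.delta)
  qed
next
  fix a h assume h: "h \<in> E a"
  hence hS: "h \<in> space H" by (simp add: E_def)
  have "keys (sw B fscale (lookup h g) (\<lambda>x1 x2. \<Sum>u\<in>keys (coact B x2).
      1 #\<^sub>b (x1 #\<^sub>b (u \<otimes>\<^bsub>\<Gamma>\<^esub> g), lookup (coact B x2) u #\<^sub>b g))) \<subseteq> E a \<times> E a" if g: "g \<in> keys h" for g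
  proof (unfold sw_def, rule keys_lsum_fscale, clarify)
    note gS = H_keys[OF hS g]
    have ga: "\<iota> g = a" using h g by (simp add: E_def)
    fix x1 x2 p q assume "(x1, x2) \<in> keys (comul B (lookup h g))"
    hence x: "x1 \<in> space B" "x2 \<in> space B" using CB.comul_keys[OF H_lookup[OF hS]] by blast+
    assume "(p, q) \<in> keys (\<Sum>u\<in>keys (coact B x2). 1 #\<^sub>b (x1 #\<^sub>b (u \<otimes>\<^bsub>\<Gamma>\<^esub> g), lookup (coact B x2) u #\<^sub>b g))"
    then obtain u where u: "u \<in> keys (coact B x2)" and "p = x1 #\<^sub>b (u \<otimes>\<^bsub>\<Gamma>\<^esub> g)" "q = lookup (coact B x2) u #\<^sub>b g"
      using subsetD[OF keys_sum] by (fastforce split: if_splits)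
    thus "p \<in> E a \<and> q \<in> E a"
      using single_E[of "u \<otimes>\<^bsub>\<Gamma>\<^esub> g" x1] single_E[OF gS coact_closed[OF x(2)], of u] x gS ga
      by (simp add: \<iota>_coact_mult coact_keys)
  qed
  hence "(\<Union>g\<in>keys h. keys (sw B fscale (lookup h g) (\<lambda>x1 x2. \<Sum>u\<in>keys (coact B x2).
      1 #\<^sub>b (x1 #\<^sub>b (u \<otimes>\<^bsub>\<Gamma>\<^esub> g), lookup (coact B x2) u #\<^sub>b g)))) \<subseteq> E a \<times> E a"
    by (rule UN_least)
  thus "keys (comul H h) \<subseteq> E a \<times> E a"
    unfolding bosonization_def by (simp add: subset_trans[OF keys_sum])
next
  fix a b h k assume h: "h \<in> E a" and k: "k \<in> E b"
  hence S: "h \<in> space H" "k \<in> space H" by (simp_all add: E_def)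
  have "\<iota> g = a \<otimes>\<^bsub>G\<^esub> b" if g: "g \<in> keys (mul H h k)" for g
  proof -
    obtain x where x: "x \<in> keys h"
      "g \<in> keys (\<Sum>y\<in>keys k. mul B (lookup h x) (act B x (lookup k y)) #\<^sub>b (x \<otimes>\<^bsub>\<Gamma>\<^esub> y))"
      using g subsetD[OF keys_sum] unfolding H_mul by fast
    then obtain y where y: "y \<in> keys k" "g \<in> keys (mul B (lookup h x) (act B x (lookup k y)) #\<^sub>b (x \<otimes>\<^bsub>\<Gamma>\<^esub> y))"
      using subsetD[OF keys_sum] by fast
    hence "g = x \<otimes>\<^bsub>\<Gamma>\<^esub> y" by (simp split: if_splits)
    thus ?thesis using x(1) y(1) h k H_keys[OF S(1)] H_keys[OF S(2)] by (simp add: \<iota>_mult E_def)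
  qed
  thus "mul H h k \<in> E (a \<otimes>\<^bsub>G\<^esub> b)" by (simp add: E_def mul_closed S)
next
  show "unt H \<in> E \<one>\<^bsub>G\<^esub>"
    using single_E[OF \<Gamma>.one_closed B_unt_closed] by (simp add: H_unt \<iota>_one)
qed

section \<open>The cocentral projection onto the group algebra\<close>

abbreviation GA :: "('k, 's \<Rightarrow>\<^sub>0 'k) hopf_data" where "GA \<equiv> group_algebra G"
abbreviation \<pi> :: "('g \<Rightarrow>\<^sub>0 'b) \<Rightarrow> ('s \<Rightarrow>\<^sub>0 'k)" where "\<pi> \<equiv> boson_pi B \<iota>"

lemma GA_smul: "smul GA = fscale" by (simp add: group_algebra_def)

lemma GA_single: "s \<in> carrier G \<Longrightarrow> single s c \<in> space GA"
  by (simp add: group_algebra_def)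

lemma GA_mul: "mul GA u v = lsum fscale u (\<lambda>a. lsum fscale v (\<lambda>b. single (a \<otimes>\<^bsub>G\<^esub> b) 1))"
proof -
  interpret F: vector_space "fscale :: 'k \<Rightarrow> ('s \<Rightarrow>\<^sub>0 'k) \<Rightarrow> _" by (rule vector_space_fscale)
  show ?thesis
    by (simp add: group_algebra_def lsum_def F.scale_sum_right fscale_single mult.commute)
qed

lemma GA_comul: "comul GA u = lsum fscale u (\<lambda>a. pure (single a 1) (single a 1))"
  by (simp add: group_algebra_def lsum_def fscale_single)

lemma GA_counit: "counit GA u = lsum (*) u (\<lambda>_. 1)"
  by (simp add: group_algebra_def lsum_def)

lemma pi_single: "\<pi> (x #\<^sub>b g) = single (\<iota> g) (counit B x)"
  using lin_zero[OF CB.counit_lin B_zero] by (simp add: boson_pi_def)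

lemma lsum_pi: "vector_space r \<Longrightarrow> lsum r (\<pi> t) F = (\<Sum>g\<in>keys t. r (counit B (lookup t g)) (F (\<iota> g)))"
  by (simp add: boson_pi_def vector_space.lsum_Sum vector_space.lsum_of_single)

lemma pi_lin: "lin (space H) (smul H) fscale \<pi>"
  unfolding boson_pi_def
  by (rule keys_sum_lin[OF vector_space_fscale], rule linI)
    (simp_all add: lin_add[OF CB.counit_lin] lin_scale[OF CB.counit_lin] single_add fscale_single)

lemma pi_closed: "t \<in> space H \<Longrightarrow> \<pi> t \<in> space GA"
  using subsetD[OF keys_sum[of "\<lambda>g. single (\<iota> g) (counit B (lookup t g))" "keys t"]] \<iota>_closed H_keys[of t]
  by (fastforce simp: group_algebra_def boson_pi_def split: if_splits)

text \<open>As \<iota>(u g) = \<iota>(g) for a coaction degree u, the map \<pi> sees only the counit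
  of x(1) # u g, and the components of the coaction add up to x again. The companion for the right
  factor has the same value, which is cocentrality.\<close>

lemma sw_pi_left:
  assumes r: "vector_space r" and f: "bilin (space GA) fscale (space H) (smul H) r f" and h: "h \<in> space H"
  shows "sw H r h (\<lambda>a b. f (\<pi> a) b) = (\<Sum>g\<in>keys h. f (single (\<iota> g) 1) (lookup h g #\<^sub>b g))"
proof -
  have f1: "f (single s c) y = r c (f (single s 1) y)" if "s \<in> carrier G" "y \<in> space H" for s c y
    using lin_scale[OF bilin_left[OF f that(2)] GA_single[OF that(1)], of c 1] by (simp add: fscale_single)
  have f2: "lin (space B) (smul B) r (\<lambda>x. f (single (\<iota> g) 1) (x #\<^sub>b g))" if "g \<in> carrier \<Gamma>" for g
    using that by (intro comp_single_lin bilin_right[OF f] GA_single \<iota>_closed)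
  have "sw H r h (\<lambda>a b. f (\<pi> a) b) = (\<Sum>g\<in>keys h. sw B r (lookup h g) (\<lambda>x1 x2.
    \<Sum>u\<in>keys (coact B x2). r (counit B x1) (f (single (\<iota> g) 1) (lookup (coact B x2) u #\<^sub>b g))))"
    unfolding sw_boson[OF r]
    by (intro sum.cong refl CB.sw_cong H_lookup h)
      (simp add: pi_single \<iota>_coact_mult H_keys[OF h] f1[of _ _ "counit B _"] \<iota>_closed single_H coact_closed)
  also have "\<dots> = (\<Sum>g\<in>keys h. \<Sum>u\<in>keys (coact B (lookup h g)).
      f (single (\<iota> g) 1) (lookup (coact B (lookup h g)) u #\<^sub>b g))"
    by (rule sw_boson_counit_left[OF r f2 h])
  also have "\<dots> = (\<Sum>g\<in>keys h. f (single (\<iota> g) 1) ((\<Sum>u\<in>keys (coact B (lookup h g)). lookup (coact B (lookup h g)) u) #\<^sub>b g))"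
    by (intro sum.cong refl lin_sum[OF f2 CB.H_vec, symmetric] coact_closed H_keys[OF h] H_lookup[OF h])
  finally show ?thesis by (simp add: coact_sum H_lookup h)
qed

lemma sw_pi_right:
  assumes r: "vector_space r" and f: "bilin (space H) (smul H) (space GA) fscale r f" and h: "h \<in> space H"
  shows "sw H r h (\<lambda>a b. f a (\<pi> b)) = (\<Sum>g\<in>keys h. f (lookup h g #\<^sub>b g) (single (\<iota> g) 1))"
proof -
  have f1: "f y (single s c) = r c (f y (single s 1))" if "s \<in> carrier G" "y \<in> space H" for s c y
    using lin_scale[OF bilin_right[OF f that(2)] GA_single[OF that(1)], of c 1] by (simp add: fscale_single)
  have f2: "lin (space B) (smul B) r (\<lambda>x. f (x #\<^sub>b g) (single (\<iota> g) 1))" if "g \<in> carrier \<Gamma>" for g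
    using that by (intro comp_single_lin bilin_left[OF f] GA_single \<iota>_closed)
  have "sw H r h (\<lambda>a b. f a (\<pi> b)) = (\<Sum>g\<in>keys h. sw B r (lookup h g) (\<lambda>x1 x2.
    \<Sum>u\<in>keys (coact B x2). r (counit B (lookup (coact B x2) u)) (f (x1 #\<^sub>b (u \<otimes>\<^bsub>\<Gamma>\<^esub> g)) (single (\<iota> g) 1))))"
    unfolding sw_boson[OF r]
    by (intro sum.cong refl CB.sw_cong H_lookup h)
      (simp add: pi_single H_keys[OF h] f1[of _ _ "counit B _"] \<iota>_closed single_H coact_keys)
  also have "\<dots> = (\<Sum>g\<in>keys h. f (lookup h g #\<^sub>b g) (single (\<iota> g) 1))"
    by (rule sw_boson_counit_right[OF r f2 h]) simp_all
  finally show ?thesis .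
qed

lemma homog_E: 
  assumes s: "s \<in> carrier G" shows "homog H G \<pi> s = E s"
proof (intro equalityI subsetI)
  fix h assume "h \<in> homog H G \<pi> s"
  hence h: "h \<in> space H" and eq: "tens_eq (space GA) (smul GA) (space H) (smul H)
      (sw H fscale h (\<lambda>h1 h2. pure (\<pi> h1) h2)) (pure (single s 1) h)"
    by (simp_all add: homog_def)
  have "\<iota> k = s" if k: "k \<in> keys h" for k
  proof (rule ccontr)
    assume ne: "\<iota> k \<noteq> s"
    \<comment> \<open>Reads off the coefficient of \<open>\<iota> k\<close> in the group algebra and
      the component at k in the bosonization. On the left-hand tensor it yields
      \<open>lookup h k\<close>, on the right-hand one 0.\<close>
    define f where "f = (\<lambda>w t. smul B (lookup w (\<iota> k)) (lookup (t :: 'g \<Rightarrow>\<^sub>0 'b) k))"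
    have f: "bilin (space GA) fscale (space H) (smul H) (smul B) f"
      unfolding f_def by (intro bilinI linI)
        (simp_all add: lookup_add lookup_smul CB.V.scale_left_distrib CB.V.scale_right_distrib mult.commute)
    have "sw H (smul B) h (\<lambda>a b. f (\<pi> a) b) = f (single s 1) h"
      using CB.V.tens_eq_lsum[OF eq[unfolded GA_smul] f] by (simp add: sw_lsum[OF CB.H_vs])
    hence "(\<Sum>g\<in>keys h. f (single (\<iota> g) 1) (lookup h g #\<^sub>b g)) = 0"
      using ne unfolding sw_pi_left[OF CB.H_vs f h] by (simp add: f_def lookup_single)
    moreover have "(\<Sum>g\<in>keys h. f (single (\<iota> g) 1) (lookup h g #\<^sub>b g)) =
        (\<Sum>g\<in>keys h. if g = k then lookup h k else 0)"
      by (rule sum.cong) (auto simp: f_def lookup_single when_def)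
    ultimately show False using k by (simp add: in_keys_iff)
  qed
  thus "h \<in> E s" using h by (simp add: E_def)
next
  fix h assume "h \<in> E s"
  hence h: "h \<in> space H" and hs: "\<And>g. g \<in> keys h \<Longrightarrow> \<iota> g = s" by (simp_all add: E_def)
  show "h \<in> homog H G \<pi> s"
    unfolding homog_def tens_eq_def GA_smul
  proof (intro CollectI conjI h allI impI)
    fix f :: "('s \<Rightarrow>\<^sub>0 'k) \<Rightarrow> ('g \<Rightarrow>\<^sub>0 'b) \<Rightarrow> 'k" assume f: "bilin (space GA) fscale (space H) (smul H) (*) f"
    have "swk h (\<lambda>a b. f (\<pi> a) b) = (\<Sum>g\<in>keys h. f (single s 1) (lookup h g #\<^sub>b g))"
      using sw_pi_left[OF vector_space_field f h] by (simp add: hs)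
    also have "\<dots> = f (single s 1) (\<Sum>g\<in>keys h. lookup h g #\<^sub>b g)"
      by (rule lin_sum[OF bilin_right[OF f GA_single[OF s]] H_vec, symmetric])
        (intro single_H H_keys[OF h] H_lookup[OF h])
    finally show "lsum (*) (sw H fscale h (\<lambda>h1. pure (\<pi> h1))) (\<lambda>(a, b). f a b) =
        lsum (*) (pure (single s 1) h) (\<lambda>(a, b). f a b)"
      by (simp add: sw_lsum[OF vector_space_field] poly_mapping_sum_single)
  qed
qed

lemma pi_bialgebra_map: "bialgebra_map H GA \<pi>"
  unfolding bialgebra_map_def GA_smul
proof (intro conjI ballI pi_lin)
  fix h k assume h: "h \<in> space H" and k: "k \<in> space H"
  have "mul GA (\<pi> h) (\<pi> k) = (\<Sum>a\<in>keys h. \<Sum>b\<in>keys k.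
      single (\<iota> a \<otimes>\<^bsub>G\<^esub> \<iota> b) (counit B (lookup h a) * counit B (lookup k b)))"
  proof -
    interpret F: vector_space "fscale :: 'k \<Rightarrow> ('s \<Rightarrow>\<^sub>0 'k) \<Rightarrow> _" by (rule vector_space_fscale)
    show ?thesis
      by (simp add: GA_mul lsum_pi[OF vector_space_fscale] F.scale_sum_right fscale_single)
  qed
  also have "\<dots> = \<pi> (mul H h k)"
    unfolding lin_mul[OF pi_lin h k]
    by (intro sum.cong refl)
      (simp add: pi_single B_counit_mul counit_act act_closed H_lookup h k H_keys[OF h] H_keys[OF k] \<iota>_mult)
  finally show "\<pi> (mul H h k) = mul GA (\<pi> h) (\<pi> k)" by simp
next
  show "\<pi> (unt H) = unt GA" by (simp add: H_unt pi_single B_counit_unt \<iota>_one group_algebra_def)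
next
  fix h assume h: "h \<in> space H"
  show "\<pi> h \<in> space GA" by (rule pi_closed[OF h])
  show "tens_eq (space GA) fscale (space GA) fscale (comul GA (\<pi> h)) (sw H fscale h (\<lambda>h1 h2. pure (\<pi> h1) (\<pi> h2)))"
    unfolding tens_eq_def
  proof (intro allI impI)
    fix f :: "('s \<Rightarrow>\<^sub>0 'k) \<Rightarrow> ('s \<Rightarrow>\<^sub>0 'k) \<Rightarrow> 'k" assume f: "bilin (space GA) fscale (space GA) fscale (*) f"
    have f': "bilin (space GA) fscale (space H) (smul H) (*) (\<lambda>a b. f a (\<pi> b))"
      by (intro bilinI linI)
        (simp_all add: lin_add[OF pi_lin] lin_scale[OF pi_lin] lin_add[OF bilin_left[OF f]] lin_scale[OF bilin_left[OF f]]
          lin_add[OF bilin_right[OF f]] lin_scale[OF bilin_right[OF f]] pi_closed)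
    have f1: "f y (single s c) = c * f y (single s 1)" if "s \<in> carrier G" "y \<in> space GA" for s c y
      using lin_scale[OF bilin_right[OF f that(2)] GA_single[OF that(1)], of c 1] by (simp add: fscale_single)
    have "swk h (\<lambda>a b. f (\<pi> a) (\<pi> b)) = (\<Sum>g\<in>keys h. counit B (lookup h g) * f (single (\<iota> g) 1) (single (\<iota> g) 1))"
      unfolding sw_pi_left[OF vector_space_field f' h]
      by (rule sum.cong) (simp_all add: pi_single f1[of _ _ "counit B _"] \<iota>_closed H_keys[OF h] GA_single)
    thus "lsum (*) (comul GA (\<pi> h)) (\<lambda>(a, b). f a b) =
        lsum (*) (sw H fscale h (\<lambda>h1 h2. pure (\<pi> h1) (\<pi> h2))) (\<lambda>(a, b). f a b)"
      by (simp add: GA_comul vector_space.lsum_lsum[OF vector_space_field] lsum_pi[OF vector_space_field]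
          sw_lsum[OF vector_space_field])
  qed
  show "counit GA (\<pi> h) = counit H h"
    by (simp add: GA_counit lsum_pi[OF vector_space_field] H_counit)
qed

lemma pi_surj: "\<pi> ` space H = space GA"
proof (intro equalityI subsetI)
  fix u :: "'s \<Rightarrow>\<^sub>0 'k" assume u: "u \<in> space GA"
  have "keys u \<subseteq> \<iota> ` carrier \<Gamma>"
    using u unfolding \<iota>_surj by (simp add: group_algebra_def)
  hence "\<forall>a\<in>keys u. \<exists>g\<in>carrier \<Gamma>. \<iota> g = a" by blast
  then obtain j where j: "\<And>a. a \<in> keys u \<Longrightarrow> j a \<in> carrier \<Gamma> \<and> \<iota> (j a) = a" by metis
  have "\<pi> (\<Sum>a\<in>keys u. smul B (lookup u a) (unt B) #\<^sub>b j a) = (\<Sum>a\<in>keys u. \<pi> (smul B (lookup u a) (unt B) #\<^sub>b j a))"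
    by (rule lin_sum[OF pi_lin H_vec]) (simp add: single_H j CB.H_closed B_unt_closed)
  also have "\<dots> = (\<Sum>a\<in>keys u. single a (lookup u a))"
    by (rule sum.cong) (simp_all add: pi_single j lin_scale[OF CB.counit_lin] B_unt_closed B_counit_unt)
  also have "\<dots> = u" by (rule poly_mapping_sum_single)
  finally have "u = \<pi> (\<Sum>a\<in>keys u. smul B (lookup u a) (unt B) #\<^sub>b j a)" by simp
  moreover have "(\<Sum>a\<in>keys u. smul B (lookup u a) (unt B) #\<^sub>b j a) \<in> space H"
    by (intro H_closed(4)) (simp add: single_H j CB.H_closed B_unt_closed)
  ultimately show "u \<in> \<pi> ` space H" by (rule image_eqI)
qed (auto intro: pi_closed)

lemma cocentral: "cocentral_epi H G \<pi>"
  unfolding cocentral_epi_def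
proof (intro conjI ballI pi_bialgebra_map pi_surj)
  fix h assume h: "h \<in> space H"
  show "tens_eq (space H) (smul H) (space GA) (smul GA)
      (sw H fscale h (\<lambda>h1 h2. pure h1 (\<pi> h2))) (sw H fscale h (\<lambda>h1 h2. pure h2 (\<pi> h1)))"
    unfolding tens_eq_def GA_smul
  proof (intro allI impI)
    fix f :: "('g \<Rightarrow>\<^sub>0 'b) \<Rightarrow> ('s \<Rightarrow>\<^sub>0 'k) \<Rightarrow> 'k" assume f: "bilin (space H) (smul H) (space GA) fscale (*) f"
    have "bilin (space GA) fscale (space H) (smul H) (*) (\<lambda>a b. f b a)"
      using f by (simp add: bilin_def)
    from sw_pi_left[OF vector_space_field this h] sw_pi_right[OF vector_space_field f h]
    show "lsum (*) (sw H fscale h (\<lambda>h1 h2. pure h1 (\<pi> h2))) (\<lambda>(a, b). f a b) =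
        lsum (*) (sw H fscale h (\<lambda>h1 h2. pure h2 (\<pi> h1))) (\<lambda>(a, b). f a b)"
      by (simp add: sw_lsum[OF vector_space_field])
  qed
qed

end

section \<open>Zesting of bosonizations\<close>

text \<open>\<open>act_coact\<close> is the hypothesis on the action of \<Gamma>0 in the form it
  takes on all of \<open>B\<close>: g x = \<Phi>(g)(x(-1)) x(0). The homomorphism \<Phi> is
  described by its values, with the character group unfolded.\<close>

locale boson_zesting = boson_graded \<Gamma> B G \<iota>
  for \<Gamma> :: "('g, 'm) monoid_scheme" and B :: "('k::field, 'b::ab_group_add, 'g) yd_hopf_data"
    and G :: "('s, 'n) monoid_scheme" and \<iota> :: "'g \<Rightarrow> 's" +
  fixes \<Gamma>0 :: "'g set" and \<Phi> :: "'g \<Rightarrow> 'g \<Rightarrow> 'k"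
    and lam :: "'s \<Rightarrow> 's \<Rightarrow> 'g" and \<omega> :: "'s \<Rightarrow> 's \<Rightarrow> 's \<Rightarrow> 'k"
  assumes \<Gamma>0: "subgroup \<Gamma>0 \<Gamma>"
    and \<Gamma>0_ker: "g \<in> \<Gamma>0 \<Longrightarrow> \<iota> g = \<one>\<^bsub>G\<^esub>"
    and \<Gamma>0_central: "g \<in> \<Gamma>0 \<Longrightarrow> h \<in> carrier \<Gamma> \<Longrightarrow> g \<otimes>\<^bsub>\<Gamma>\<^esub> h = h \<otimes>\<^bsub>\<Gamma>\<^esub> g"
    and \<Phi>_hom: "\<lbrakk>g \<in> \<Gamma>0; h \<in> carrier \<Gamma>; k \<in> carrier \<Gamma>\<rbrakk> \<Longrightarrow>
      \<Phi> g (h \<otimes>\<^bsub>\<Gamma>\<^esub> k) = \<Phi> g h * \<Phi> g k"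
    and \<Phi>_one: "g \<in> \<Gamma>0 \<Longrightarrow> \<Phi> g \<one>\<^bsub>\<Gamma>\<^esub> = 1"
    and \<Phi>_mult: "\<lbrakk>g \<in> \<Gamma>0; g' \<in> \<Gamma>0; h \<in> carrier \<Gamma>\<rbrakk> \<Longrightarrow>
      \<Phi> (g \<otimes>\<^bsub>\<Gamma>\<^esub> g') h = \<Phi> g h * \<Phi> g' h"
    and \<Phi>_unit: "h \<in> carrier \<Gamma> \<Longrightarrow> \<Phi> \<one>\<^bsub>\<Gamma>\<^esub> h = 1"
    and act_coact: "g \<in> \<Gamma>0 \<Longrightarrow> x \<in> space B \<Longrightarrow>
      act B g x = (\<Sum>u\<in>keys (coact B x). smul B (\<Phi> g u) (lookup (coact B x) u))"
    and lam: "normalized_2cocycle G \<Gamma> \<Gamma>0 lam"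
    and \<omega>: "normalized_3cochain G \<omega>"
    and \<omega>_lam: "\<lbrakk>a \<in> carrier G; b \<in> carrier G; c \<in> carrier G; d \<in> carrier G\<rbrakk> \<Longrightarrow>
      \<Phi> (lam a b) (lam c d) =
        (\<omega> a b c * \<omega> a (b \<otimes>\<^bsub>G\<^esub> c) d * \<omega> b c d) / (\<omega> (a \<otimes>\<^bsub>G\<^esub> b) c d * \<omega> a b (c \<otimes>\<^bsub>G\<^esub> d))"
begin

abbreviation \<gamma> :: "'g \<Rightarrow> ('g \<Rightarrow>\<^sub>0 'b) \<Rightarrow> 'k" where "\<gamma> \<equiv> boson_gamma B \<Phi>"
abbreviation \<gamma>H :: "('g \<Rightarrow>\<^sub>0 'b) \<Rightarrow> ('g \<Rightarrow>\<^sub>0 'b) \<Rightarrow> 'k" where "\<gamma>H \<equiv> boson_gamma_H \<Gamma> B \<Phi>"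
abbreviation N :: "('g \<Rightarrow>\<^sub>0 'b) set" where "N \<equiv> grp ` \<Gamma>0"
abbreviation lamH :: "'s \<Rightarrow> 's \<Rightarrow> ('g \<Rightarrow>\<^sub>0 'b)" where "lamH \<equiv> \<lambda>a b. grp (lam a b)"

text \<open>Inversion belongs to \<Gamma>; on group-likes it is obtained by pulling back along the
  injective embedding, as for \<open>\<gamma>H\<close>.\<close>

definition iv :: "('g \<Rightarrow>\<^sub>0 'b) \<Rightarrow> ('g \<Rightarrow>\<^sub>0 'b)" where
  "iv u = grp (inv\<^bsub>\<Gamma>\<^esub> (inv_into (carrier \<Gamma>) grp u))"

lemma \<Gamma>0_closed: "g \<in> \<Gamma>0 \<Longrightarrow> g \<in> carrier \<Gamma>"
  by (rule subgroup.mem_carrier[OF \<Gamma>0])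

lemma inv_into_grp: "g \<in> carrier \<Gamma> \<Longrightarrow> inv_into (carrier \<Gamma>) grp (grp g) = g"
  by (rule inv_into_f_f[OF inj_grp])

lemma \<gamma>H_grp: "g \<in> carrier \<Gamma> \<Longrightarrow> \<gamma>H (grp g) = \<gamma> g"
  by (simp add: boson_gamma_H_def inv_into_grp)

lemma iv_grp: "g \<in> carrier \<Gamma> \<Longrightarrow> iv (grp g) = grp (inv\<^bsub>\<Gamma>\<^esub> g)"
  by (simp add: iv_def inv_into_grp)

lemma \<gamma>_single: "\<gamma> g (x #\<^sub>b k) = counit B x * \<Phi> g k"
  using lin_zero[OF CB.counit_lin B_zero] by (simp add: boson_gamma_def)

lemma gamma_form: "form (\<gamma> g)"
  unfolding boson_gamma_def
  by (rule keys_sum_lin[OF vector_space_field])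
    (rule linI, simp_all add: lin_add[OF CB.counit_lin] lin_scale[OF CB.counit_lin] algebra_simps)

lemma gamma_mul:
  assumes g: "g \<in> \<Gamma>0" and h: "h \<in> space H" and k: "k \<in> space H"
  shows "\<gamma> g (mul H h k) = \<gamma> g h * \<gamma> g k"
proof -
  have "\<gamma> g (mul H h k) = (\<Sum>a\<in>keys h. \<Sum>b\<in>keys k.
      (counit B (lookup h a) * \<Phi> g a) * (counit B (lookup k b) * \<Phi> g b))"
    unfolding lin_mul[OF gamma_form h k]
    by (intro sum.cong refl)
      (simp add: \<gamma>_single B_counit_mul counit_act act_closed H_lookup h k H_keys[OF h] H_keys[OF k] \<Phi>_hom g mult_ac)
  thus ?thesis by (simp add: boson_gamma_def sum_product)
qed

lemma gamma_conv:
  assumes g: "g \<in> \<Gamma>0" and g': "g' \<in> \<Gamma>0" and h: "h \<in> space H"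
  shows "\<gamma> (g \<otimes>\<^bsub>\<Gamma>\<^esub> g') h = swk h (\<lambda>h1 h2. \<gamma> g h1 * \<gamma> g' h2)"
proof -
  have f: "lin (space B) (smul B) (*) (\<lambda>x. counit B x * (\<Phi> g k * \<Phi> g' k))" for k
    by (rule linI) (simp_all add: lin_add[OF CB.counit_lin] lin_scale[OF CB.counit_lin] algebra_simps)
  have "swk h (\<lambda>h1 h2. \<gamma> g h1 * \<gamma> g' h2) = (\<Sum>k\<in>keys h. sw B (*) (lookup h k) (\<lambda>x1 x2.
      \<Sum>u\<in>keys (coact B x2). counit B (lookup (coact B x2) u) * (counit B x1 * (\<Phi> g (u \<otimes>\<^bsub>\<Gamma>\<^esub> k) * \<Phi> g' k))))"
    unfolding sw_boson[OF vector_space_field] by (simp add: \<gamma>_single mult_ac)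
  also have "\<dots> = (\<Sum>k\<in>keys h. counit B (lookup h k) * (\<Phi> g k * \<Phi> g' k))"
    by (rule sw_boson_counit_right[OF vector_space_field f h]) simp
  also have "\<dots> = \<gamma> (g \<otimes>\<^bsub>\<Gamma>\<^esub> g') h"
    unfolding boson_gamma_def by (rule sum.cong) (simp_all add: \<Phi>_mult g g' H_keys[OF h])
  finally show ?thesis by simp
qed

text \<open>On x # k the left side is the sum of \<Phi>(g)(u) \<Phi>(g)(k) x(0) # k g over the
  coaction degrees u of x, and the right side is \<Phi>(g)(k) (g x) # g k. Centrality of g matches
  the group elements, \<open>act_coact\<close> the rest.\<close>

lemma gamma_comm:
  assumes g: "g \<in> \<Gamma>0" and h: "h \<in> space H"
  shows "swH h (\<lambda>h1 h2. smul H (\<gamma> g h1) (mul H h2 (grp g))) =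
    swH h (\<lambda>h1 h2. smul H (\<gamma> g h2) (mul H (grp g) h1))"
proof -
  note gS = \<Gamma>0_closed[OF g]
  have f1: "lin (space B) (smul B) (smul H) (\<lambda>x. smul H (\<Phi> g u * \<Phi> g k) (x #\<^sub>b (k \<otimes>\<^bsub>\<Gamma>\<^esub> g)))" for u k
    by (rule linI) (simp_all add: single_add smul_single mult.commute V.scale_right_distrib CB.V.scale_right_distrib)
  have f2: "lin (space B) (smul B) (smul H) (\<lambda>x. smul H (\<Phi> g k) (mul H (grp g) (x #\<^sub>b k)))" if "k \<in> carrier \<Gamma>" for k
    by (rule comp_single_lin[OF endo_lin that]) (intro mul_linear_intros grp_H gS)
  have "swH h (\<lambda>h1 h2. smul H (\<gamma> g h1) (mul H h2 (grp g))) =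
      (\<Sum>k\<in>keys h. sw B (smul H) (lookup h k) (\<lambda>x1 x2. \<Sum>u\<in>keys (coact B x2).
        smul H (counit B x1) (smul H (\<Phi> g u * \<Phi> g k) (lookup (coact B x2) u #\<^sub>b (k \<otimes>\<^bsub>\<Gamma>\<^esub> g)))))"
    unfolding sw_boson[OF H_vs]
    by (intro sum.cong refl CB.sw_cong H_lookup h)
      (simp add: \<gamma>_single single_mul_grp gS H_keys[OF h] coact_closed coact_keys \<Phi>_hom g)
  also have "\<dots> = (\<Sum>k\<in>keys h. \<Sum>u\<in>keys (coact B (lookup h k)).
      smul H (\<Phi> g u * \<Phi> g k) (lookup (coact B (lookup h k)) u #\<^sub>b (k \<otimes>\<^bsub>\<Gamma>\<^esub> g)))"
    by (rule sw_boson_counit_left[OF H_vs f1 h])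
  also have "\<dots> = (\<Sum>k\<in>keys h. smul H (\<Phi> g k) (mul H (grp g) (lookup h k #\<^sub>b k)))"
  proof (rule sum.cong)
    fix k assume k: "k \<in> keys h"
    note x = H_lookup[OF h, of k]
    have "mul H (grp g) (lookup h k #\<^sub>b k) = act B g (lookup h k) #\<^sub>b (k \<otimes>\<^bsub>\<Gamma>\<^esub> g)"
      by (simp add: grp_mul_single gS H_keys[OF h k] x \<Gamma>0_central[OF g H_keys[OF h k]])
    also have "\<dots> = (\<Sum>u\<in>keys (coact B (lookup h k)).
        smul B (\<Phi> g u) (lookup (coact B (lookup h k)) u) #\<^sub>b (k \<otimes>\<^bsub>\<Gamma>\<^esub> g))"
      unfolding act_coact[OF g x] by (rule lin_sum[OF single_lin CB.H_vec]) (simp add: CB.H_closed coact_closed x)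
    finally show "(\<Sum>u\<in>keys (coact B (lookup h k)).
        smul H (\<Phi> g u * \<Phi> g k) (lookup (coact B (lookup h k)) u #\<^sub>b (k \<otimes>\<^bsub>\<Gamma>\<^esub> g))) =
        smul H (\<Phi> g k) (mul H (grp g) (lookup h k #\<^sub>b k))"
      by (simp add: V.scale_sum_right smul_single mult.commute)
  qed simp
  also have "\<dots> = (\<Sum>k\<in>keys h. sw B (smul H) (lookup h k) (\<lambda>x1 x2. \<Sum>u\<in>keys (coact B x2).
        smul H (counit B (lookup (coact B x2) u)) (smul H (\<Phi> g k) (mul H (grp g) (x1 #\<^sub>b (u \<otimes>\<^bsub>\<Gamma>\<^esub> k))))))"
    by (rule sw_boson_counit_right[OF H_vs f2 h, symmetric]) simp_all
  also have "\<dots> = swH h (\<lambda>h1 h2. smul H (\<gamma> g h2) (mul H (grp g) h1))"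
    unfolding sw_boson[OF H_vs] by (simp add: \<gamma>_single)
  finally show ?thesis .
qed

lemma lam_\<Gamma>0: "a \<in> carrier G \<Longrightarrow> b \<in> carrier G \<Longrightarrow> lam a b \<in> \<Gamma>0"
  using lam by (simp add: normalized_2cocycle_def)

text \<open>The carrier \<open>M\<close> is left open because two monoids are meant:
  \<open>N\<close> for the abstract zesting locale, and the coinvariant group-likes for the
  definition of a zesting datum.\<close>

lemma lamH_cocycle:
  "normalized_2cocycle G \<lparr>carrier = M, mult = mul H, one = unt H\<rparr> N lamH"
  using lam unfolding normalized_2cocycle_def by (simp add: grp_mul \<Gamma>0_closed H_unt)

lemma gamma_lam: "\<lbrakk>a \<in> carrier G; b \<in> carrier G; c \<in> carrier G; d \<in> carrier G\<rbrakk> \<Longrightarrow>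
      \<gamma>H (lamH a b) (lamH c d) =
      (\<omega> a b c * \<omega> a (b \<otimes>\<^bsub>G\<^esub> c) d * \<omega> b c d) / (\<omega> (a \<otimes>\<^bsub>G\<^esub> b) c d * \<omega> a b (c \<otimes>\<^bsub>G\<^esub> d))"
  by (simp add: \<gamma>H_grp lam_\<Gamma>0 \<Gamma>0_closed \<gamma>_single B_counit_unt \<omega>_lam)

lemma grp_inv_left: "g \<in> \<Gamma>0 \<Longrightarrow> mul H (grp (inv\<^bsub>\<Gamma>\<^esub> g)) (grp g) = unt H"
  and grp_inv_right: "g \<in> \<Gamma>0 \<Longrightarrow> mul H (grp g) (grp (inv\<^bsub>\<Gamma>\<^esub> g)) = unt H"
  by (simp_all add: grp_mul \<Gamma>0_closed H_unt)

sublocale Zt: zesting_hopf H G E P N iv \<gamma>H lamH \<omega>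
proof (rule zesting_hopf.intro[OF graded_hopf_axioms zesting_hopf_axioms.intro])
  show "normalized_2cocycle G \<lparr>carrier = N, mult = mul H, one = unt H\<rparr> N lamH" by (rule lamH_cocycle)
  show "normalized_3cochain G \<omega>" by (rule \<omega>)
  show "unt H \<in> N" using subgroup.one_closed[OF \<Gamma>0] by (simp add: H_unt)
  show "\<gamma>H (unt H) h = counit H h" if "h \<in> space H" for h
    unfolding H_unt \<gamma>H_grp[OF \<Gamma>.one_closed] boson_gamma_def H_counit
    by (rule sum.cong) (simp_all add: \<Phi>_unit H_keys[OF that])
  fix u assume "u \<in> N"
  then obtain g where g: "g \<in> \<Gamma>0" and u: "u = grp g" by blast
  note gS = \<Gamma>0_closed[OF g]
  show "u \<in> E \<one>\<^bsub>G\<^esub>" using single_E[OF gS B_unt_closed] by (simp add: u \<Gamma>0_ker g)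
  show "comul H u \<approx>\<^bsub>H\<^esub> pure u u" unfolding u by (rule grp_grouplike[OF gS])
  show "counit H u = 1" by (simp add: u counit_single B_counit_unt)
  show "iv u \<in> N" by (simp add: u iv_grp gS subgroup.m_inv_closed[OF \<Gamma>0 g])
  show "mul H (iv u) u = unt H" by (simp add: u iv_grp gS grp_inv_left g)
  show "form (\<gamma>H u)" by (simp add: u \<gamma>H_grp gS gamma_form)
  show "\<gamma>H u (unt H) = 1" by (simp add: u \<gamma>H_grp gS H_unt \<gamma>_single B_counit_unt \<Phi>_one g)
  show "\<gamma>H u (mul H h k) = \<gamma>H u h * \<gamma>H u k" if "h \<in> space H" "k \<in> space H" for h k
    by (simp add: u \<gamma>H_grp gS gamma_mul g that)
  show "swH h (\<lambda>h1 h2. smul H (\<gamma>H u h1) (mul H h2 u)) =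
      swH h (\<lambda>h1 h2. smul H (\<gamma>H u h2) (mul H u h1))" if "h \<in> space H" for h
    unfolding u \<gamma>H_grp[OF gS] by (rule gamma_comm[OF g that])
  fix v assume "v \<in> N"
  then obtain g' where g': "g' \<in> \<Gamma>0" and v: "v = grp g'" by blast
  note g'S = \<Gamma>0_closed[OF g']
  show "mul H u v \<in> N" by (simp add: u v grp_mul gS g'S subgroup.m_closed[OF \<Gamma>0 g g'])
  show "mul H u v = mul H v u" by (simp add: u v grp_mul gS g'S \<Gamma>0_central[OF g])
  show "\<gamma>H (mul H u v) h = swk h (\<lambda>h1 h2. \<gamma>H u h1 * \<gamma>H v h2)" if "h \<in> space H" for h
    by (simp add: u v grp_mul gS g'S \<gamma>H_grp gamma_conv g g' that)
qed (rule gamma_lam)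

section \<open>Zesting datum and zested structure of the bosonization\<close>

lemma N_grouplike: "u \<in> N \<Longrightarrow> u \<in> carrier (coinv_grouplikes H G \<pi>)"
  using Zt.N_space Zt.N_comul Zt.N_counit Zt.N_E homog_E[OF G.one_closed]
  by (simp add: coinv_grouplikes_def grouplikes_def)

text \<open>The coinvariant group-likes are not established as a group here, so the inverse is
  identified from its description as the unique two-sided inverse, using associativity of the
  bosonization.\<close>

lemma inv_coinv_grouplikes:
  assumes g: "g \<in> \<Gamma>0"
  shows "inv\<^bsub>coinv_grouplikes H G \<pi>\<^esub> (grp g) = grp (inv\<^bsub>\<Gamma>\<^esub> g)"
  unfolding m_inv_def[of "coinv_grouplikes H G \<pi>"]
proof (rule the_equality)
  have "grp (inv\<^bsub>\<Gamma>\<^esub> g) \<in> N" using subgroup.m_inv_closed[OF \<Gamma>0 g] by blast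
  thus "grp (inv\<^bsub>\<Gamma>\<^esub> g) \<in> carrier (coinv_grouplikes H G \<pi>) \<and>
      grp g \<otimes>\<^bsub>coinv_grouplikes H G \<pi>\<^esub> grp (inv\<^bsub>\<Gamma>\<^esub> g) = \<one>\<^bsub>coinv_grouplikes H G \<pi>\<^esub> \<and>
      grp (inv\<^bsub>\<Gamma>\<^esub> g) \<otimes>\<^bsub>coinv_grouplikes H G \<pi>\<^esub> grp g = \<one>\<^bsub>coinv_grouplikes H G \<pi>\<^esub>"
    using N_grouplike by (simp add: coinv_grouplikes_def grp_inv_left grp_inv_right g)
  fix y assume "y \<in> carrier (coinv_grouplikes H G \<pi>) \<and>
      grp g \<otimes>\<^bsub>coinv_grouplikes H G \<pi>\<^esub> y = \<one>\<^bsub>coinv_grouplikes H G \<pi>\<^esub> \<and>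
      y \<otimes>\<^bsub>coinv_grouplikes H G \<pi>\<^esub> grp g = \<one>\<^bsub>coinv_grouplikes H G \<pi>\<^esub>"
  hence y: "y \<in> space H" "mul H (grp g) y = unt H" by (simp_all add: coinv_grouplikes_def grouplikes_def)
  have "mul H (mul H (grp (inv\<^bsub>\<Gamma>\<^esub> g)) (grp g)) y = mul H (grp (inv\<^bsub>\<Gamma>\<^esub> g)) (mul H (grp g) y)"
    by (rule mul_assoc) (simp_all add: grp_H \<Gamma>0_closed g y(1))
  thus "y = grp (inv\<^bsub>\<Gamma>\<^esub> g)"
    unfolding y(2) grp_inv_left[OF g] by (simp add: unt_left unt_right y(1) grp_H \<Gamma>0_closed g)
qed

lemma zesting_datum: "zesting_datum H G \<pi> N \<gamma>H lamH \<omega>"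
  unfolding zesting_datum_def
proof (intro conjI ballI \<omega> gamma_lam)
  show "subgroup N (coinv_grouplikes H G \<pi>)"
  proof (rule subgroup.intro)
    fix u assume u: "u \<in> N"
    then obtain g where g: "g \<in> \<Gamma>0" "u = grp g" by blast
    show "inv\<^bsub>coinv_grouplikes H G \<pi>\<^esub> u \<in> N"
      using subgroup.m_inv_closed[OF \<Gamma>0 g(1)] by (simp add: g inv_coinv_grouplikes)
  qed (use N_grouplike Zt.N_mul Zt.N_unt in \<open>auto simp: coinv_grouplikes_def\<close>)
  show "normalized_2cocycle G (coinv_grouplikes H G \<pi>) N lamH"
    unfolding coinv_grouplikes_def by (rule lamH_cocycle)
  fix u assume u: "u \<in> N"
  show "\<gamma>H u \<in> alg_chars H"
    using u by (simp add: alg_chars_def Zt.\<gamma>_form Zt.\<gamma>_unt Zt.\<gamma>_mul)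
  fix h assume h: "h \<in> space H"
  show "\<gamma>H (mul H u v) h = swk h (\<lambda>h1 h2. \<gamma>H u h1 * \<gamma>H v h2)" if "v \<in> N" for v
    by (rule Zt.\<gamma>_conv[OF u that h])
  obtain g where g: "g \<in> \<Gamma>0" "u = grp g" using u by blast
  have i: "inv\<^bsub>coinv_grouplikes H G \<pi>\<^esub> u = iv u"
    by (simp add: g inv_coinv_grouplikes iv_grp \<Gamma>0_closed)
  note S = Zt.N_space[OF u] Zt.N_space[OF Zt.N_iv[OF u]]
  have T: "endo (\<lambda>y. mul H (iv u) y)" by (intro mul_linear_intros S)
  \<comment> \<open>Multiplying the inverse-free commutation rule by the inverse of u gives the form
    with conjugation.\<close>
  have "swH h (\<lambda>h1 h2. smul H (\<gamma>H u h1) (mul H (mul H (iv u) h2) u)) =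
      swH h (\<lambda>h1 h2. mul H (iv u) (smul H (\<gamma>H u h1) (mul H h2 u)))"
    by (rule sw_cong[OF h]) (simp add: mul_scale_right mul_assoc closed S)
  also have "\<dots> = mul H (iv u) (swH h (\<lambda>h1 h2. smul H (\<gamma>H u h2) (mul H u h1)))"
    unfolding Zt.\<gamma>_comm[OF u h, symmetric] by (rule sw_endo[OF T h, symmetric]) (intro closed S)
  also have "\<dots> = swH h (\<lambda>h1 h2. mul H (iv u) (smul H (\<gamma>H u h2) (mul H u h1)))"
    by (rule sw_endo[OF T h]) (intro closed S)
  also have "\<dots> = swH h (\<lambda>h1 h2. smul H (\<gamma>H u h2) h1)"
    by (rule sw_cong[OF h])
      (simp add: mul_scale_right closed S Zt.iv_left u unt_left flip: mul_assoc)
  finally show "swH h (\<lambda>h1 h2. smul H (\<gamma>H u h1)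
      (mul H (mul H (inv\<^bsub>coinv_grouplikes H G \<pi>\<^esub> u) h2) u)) = swH h (\<lambda>h1 h2. smul H (\<gamma>H u h2) h1)"
    unfolding i .
qed

text \<open>Links the abstract results to the specification: both prescribe the same values, since
  \<open>homog\<close> and \<open>E\<close> agree on all degrees of \<open>G\<close>.\<close>

lemma zesting_iff:
  "zesting H G \<pi> \<gamma>H lamH \<omega> m \<Omega> \<longleftrightarrow> zested_hopf H G E P N iv \<gamma>H lamH \<omega> m \<Omega>"
proof
  assume z: "zesting H G \<pi> \<gamma>H lamH \<omega> m \<Omega>"
  show "zested_hopf H G E P N iv \<gamma>H lamH \<omega> m \<Omega>"
    by (rule zested_hopf.intro[OF Zt.zesting_hopf_axioms zested_hopf_axioms.intro])
      (use z in \<open>simp_all add: zesting_def homog_E\<close>)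
next
  assume "zested_hopf H G E P N iv \<gamma>H lamH \<omega> m \<Omega>"
  then interpret Z: zested_hopf H G E P N iv \<gamma>H lamH \<omega> m \<Omega> .
  show "zesting H G \<pi> \<gamma>H lamH \<omega> m \<Omega>"
    unfolding zesting_def
    by (intro conjI ballI Z.m_bilin Z.\<Omega>_trilin) (simp_all add: homog_E Z.m_E Z.\<Omega>_E)
qed

lemma zesting_exists: "\<exists>m \<Omega>. zesting H G \<pi> \<gamma>H lamH \<omega> m \<Omega>"
proof -
  obtain m where m: "bilin (space H) (smul H) (space H) (smul H) (smul H) m"
    "\<And>a b h k. \<lbrakk>a \<in> carrier G; b \<in> carrier G; h \<in> E a; k \<in> E b\<rbrakk> \<Longrightarrow>
      m h k = mul H (mul H h k) (lamH a b)"
    by (rule Zt.zesting_mul_exists) (rule that)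
  obtain \<Omega> where \<Omega>: "trilin_form (space H) (smul H) \<Omega>"
    "\<And>a b c h k l. \<lbrakk>a \<in> carrier G; b \<in> carrier G; c \<in> carrier G; h \<in> E a; k \<in> E b; l \<in> E c\<rbrakk> \<Longrightarrow>
      \<Omega> h k l = counit H (mul H h k) * \<omega> a b c * \<gamma>H (lamH a b) l"
    by (rule Zt.zesting_assoc_exists) (rule that)
  have "zesting H G \<pi> \<gamma>H lamH \<omega> m \<Omega>"
    unfolding zesting_def by (intro conjI ballI m(1) \<Omega>(1)) (simp_all add: homog_E m(2) \<Omega>(2))
  thus ?thesis by blast
qed

context
  fixes m \<Omega> assumes z: "zesting H G \<pi> \<gamma>H lamH \<omega> m \<Omega>"
begin

interpretation Z: zested_hopf H G E P N iv \<gamma>H lamH \<omega> m \<Omega>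
  using z by (simp add: zesting_iff)

lemma zesting_coquasi_hopf: "coquasi_hopf (H\<lparr>mul := m\<rparr>) \<Omega>"
  by (rule Z.zested_coquasi_hopf)

lemma zesting_mul_single:
  assumes "y \<in> space B" "z \<in> space B" "g \<in> carrier \<Gamma>" "h \<in> carrier \<Gamma>"
  shows "m (y #\<^sub>b g) (z #\<^sub>b h) = mul B y (act B g z) #\<^sub>b (g \<otimes>\<^bsub>\<Gamma>\<^esub> h \<otimes>\<^bsub>\<Gamma>\<^esub> lam (\<iota> g) (\<iota> h))"
proof -
  have "lam (\<iota> g) (\<iota> h) \<in> carrier \<Gamma>" using assms by (simp add: \<Gamma>0_closed lam_\<Gamma>0 \<iota>_closed)
  thus ?thesis
    using assms by (simp add: Z.m_E[OF \<iota>_closed \<iota>_closed single_E single_E] mul_single single_mul_grp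
        B_mul_closed act_closed)
qed

lemma zesting_assoc_single:
  assumes "w \<in> space B" "y \<in> space B" "z \<in> space B" "g \<in> carrier \<Gamma>" "h \<in> carrier \<Gamma>" "k \<in> carrier \<Gamma>"
  shows "\<Omega> (w #\<^sub>b g) (y #\<^sub>b h) (z #\<^sub>b k) = counit B w * counit B y * counit B z * \<omega> (\<iota> g) (\<iota> h) (\<iota> k) *
    \<gamma> (lam (\<iota> g) (\<iota> h)) (grp k)"
proof -
  have "lam (\<iota> g) (\<iota> h) \<in> carrier \<Gamma>" using assms by (simp add: \<Gamma>0_closed lam_\<Gamma>0 \<iota>_closed)
  thus ?thesis
    using assms
    by (simp add: Z.\<Omega>_val[OF \<iota>_closed \<iota>_closed \<iota>_closed single_E single_E single_E] counit_single \<gamma>H_grp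
        \<gamma>_single B_counit_unt)
qed

end

text \<open>The formula for \<open>rform\<close> makes sense for all second arguments, not only for those in the span of \<open>N\<close>.\<close>

definition rform :: "('g \<Rightarrow>\<^sub>0 'b) \<Rightarrow> ('g \<Rightarrow>\<^sub>0 'b) \<Rightarrow> 'k" where
  "rform h k = (\<Sum>g\<in>keys k. counit B (lookup k g) * \<gamma> g h)"

section \<open>The relative r-form on the span of the group-likes\<close>

lemma rform_grp: "rform h (grp g) = \<gamma> g h"
  using B_unt_nonzero by (simp add: rform_def B_counit_unt)

lemma rform_form: "form (rform h)" "form (\<lambda>h. rform h k)"
proof -
  show "form (rform h)"
    unfolding rform_def by (rule keys_sum_lin[OF vector_space_field], rule linI)
      (simp_all add: lin_add[OF CB.counit_lin] lin_scale[OF CB.counit_lin] algebra_simps)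
  show "form (\<lambda>h. rform h k)"
    unfolding rform_def
    by (rule linI) (simp_all add: lin_add[OF gamma_form] lin_scale[OF gamma_form] sum.distrib algebra_simps sum_distrib_left)
qed

abbreviation K :: "('g \<Rightarrow>\<^sub>0 'b) set" where "K \<equiv> module.span (smul H) N"

lemma K_space: "k \<in> K \<Longrightarrow> k \<in> space H"
proof -
  have "N \<subseteq> space H" using Zt.N_space by blast
  hence "K \<subseteq> space H" using H_vec by (intro V.span_minimal) (simp_all add: vec_sp_def)
  thus "k \<in> K \<Longrightarrow> k \<in> space H" by blast
qed

lemma K_eq:
  assumes f: "lin (space H) (smul H) r f" and g: "lin (space H) (smul H) r g"
    and eq: "\<And>u. u \<in> N \<Longrightarrow> f u = g u" and k: "k \<in> K"
  shows "f k = g k"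
proof -
  have "k \<in> space H \<and> f k = g k"
    using k
  proof (induction rule: V.span_induct_alt)
    case base show ?case using lin_zero[OF f] lin_zero[OF g] by (simp add: H_closed)
  next
    case (step c x y)
    thus ?case using Zt.N_space[OF step(1)] eq[OF step(1)]
      by (simp add: H_closed lin_add[OF f] lin_add[OF g] lin_scale[OF f] lin_scale[OF g])
  qed
  thus ?thesis by simp
qed

lemma K_subcoalgebra: "subcoalgebra H K"
  unfolding subcoalgebra_def
proof (intro conjI ballI)
  show "K \<subseteq> space H" using K_space by blast
  show "module.subspace (smul H) K" by (rule V.subspace_span)
  fix k assume "k \<in> K"
  hence "k \<in> space H \<and> (\<exists>u. keys u \<subseteq> K \<times> K \<and> comul H k \<approx>\<^bsub>H\<^esub> u)"
  proof (induction rule: V.span_induct_alt)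
    case base
    have "lsum (*) (comul H 0) (\<lambda>(a, b). f a b) = 0" if "bilin (space H) (smul H) (space H) (smul H) (*) f" for f
      using lin_zero[OF sw_arg_lin[OF vector_space_field that] H_closed(1)] by (simp add: sw_def)
    thus ?case by (intro conjI exI[of _ 0]) (simp_all add: H_closed tens_eq_def lsum_def)
  next
    case (step c x y)
    then obtain u where u: "keys u \<subseteq> K \<times> K" "comul H y \<approx>\<^bsub>H\<^esub> u" by blast
    have yS: "y \<in> space H" using step(2) by blast
    note xS = Zt.N_space[OF step(1)]
    \<comment> \<open>The given formal sum for a coproduct need not consist of pairs from
      \<open>K\<close>, even at a group-like x; a representative inside \<open>K \<times> K\<close>
      is assembled along the induction.\<close>
    have "comul H (smul H c x + y) \<approx>\<^bsub>H\<^esub> fscale c (pure x x) + u"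
      unfolding tens_eq_def
    proof (intro allI impI)
      fix f assume f: "bilin (space H) (smul H) (space H) (smul H) (*) f"
      note sw_lin = sw_arg_lin[OF vector_space_field f]
      have "swk (smul H c x + y) f = c * swk x f + swk y f"
        by (simp add: lin_add[OF sw_lin] lin_scale[OF sw_lin] H_closed xS yS)
      also have "swk x f = f x x" by (rule Zt.sw_N[OF vector_space_field step(1) f])
      also have "swk y f = lsum (*) u (\<lambda>(a, b). f a b)"
        using u(2) f by (simp add: tens_eq_def sw_def)
      finally show "lsum (*) (comul H (smul H c x + y)) (\<lambda>(a, b). f a b) =
          lsum (*) (fscale c (pure x x) + u) (\<lambda>(a, b). f a b)"
        by (simp add: sw_def lsum_add lsum_fscale)
    qed
    moreover have "x \<in> K" using step(1) by (rule V.span_base)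
    hence "keys (fscale c (pure x x) + u) \<subseteq> K \<times> K"
      using u(1) Poly_Mapping.keys_add[of "fscale c (pure x x)" u] by (auto simp: fscale_single split: if_splits)
    moreover have "smul H c x + y \<in> space H" by (intro H_closed xS yS)
    ultimately show ?case by blast
  qed
  thus "\<exists>u. keys u \<subseteq> K \<times> K \<and> comul H k \<approx>\<^bsub>H\<^esub> u" by blast
qed

lemma K_map:
  assumes f: "endo f" and N: "\<And>u. u \<in> N \<Longrightarrow> f u \<in> K" and k: "k \<in> K"
  shows "f k \<in> K"
proof -
  have "k \<in> space H \<and> f k \<in> K"
    using k
  proof (induction rule: V.span_induct_alt)
    case base show ?case using lin_zero[OF endo_lin[OF f] H_closed(1)] by (simp add: H_closed V.span_zero)
  next
    case (step c x y)
    thus ?case using Zt.N_space[OF step(1)] N[OF step(1)]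
      by (simp add: H_closed lin_add[OF endo_lin[OF f]] lin_scale[OF endo_lin[OF f]] V.span_add V.span_scale)
  qed
  thus ?thesis by simp
qed

text \<open>S(g) g is the unit and g is invertible. Proved for an arbitrary antipode, as
  \<open>hopf_subalgebra\<close> quantifies over all of them.\<close>

lemma antipode_grp:
  assumes S: "antipode H S" and g: "g \<in> \<Gamma>0"
  shows "S (grp g) = grp (inv\<^bsub>\<Gamma>\<^esub> g)"
proof -
  note gS = grp_H[OF \<Gamma>0_closed[OF g]]
  have gN: "grp g \<in> N" using g by blast
  have S_endo: "endo S" using S by (simp add: antipode_def endo_def)
  have Sg: "S (grp g) \<in> space H" by (rule endo_closed[OF S_endo gS])
  have "bilin (space H) (smul H) (space H) (smul H) (smul H) (\<lambda>h1 h2. mul H (S h1) h2)"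
    by (intro bilinI endo_lin mul_linear_intros S_endo endo_closed[OF S_endo])
  from Zt.sw_N[OF H_vs gN this] have "mul H (S (grp g)) (grp g) = unt H"
    using S gS by (simp add: antipode_def counit_single B_counit_unt)
  hence "mul H (mul H (S (grp g)) (grp g)) (grp (inv\<^bsub>\<Gamma>\<^esub> g)) = grp (inv\<^bsub>\<Gamma>\<^esub> g)"
    by (simp add: unt_left grp_H \<Gamma>0_closed g)
  thus ?thesis
    by (simp add: mul_assoc Sg gS grp_H \<Gamma>0_closed g grp_inv_right unt_right)
qed

lemma K_hopf_subalgebra: "hopf_subalgebra H K"
  unfolding hopf_subalgebra_def
proof (intro conjI ballI allI impI K_subcoalgebra)
  show "unt H \<in> K" by (rule V.span_base[OF Zt.N_unt])
  fix x y assume x: "x \<in> K" and y: "y \<in> K"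
  show "mul H x y \<in> K"
  proof (rule K_map[OF endo_mul_left[OF endo_id K_space[OF y]] _ x])
    fix u assume u: "u \<in> N"
    show "mul H u y \<in> K"
      by (rule K_map[OF endo_mul_right[OF endo_id Zt.N_space[OF u]] _ y]) (rule V.span_base[OF Zt.N_mul[OF u]])
  qed
next
  fix S assume S: "antipode H S"
  have S_endo: "endo S" using S by (simp add: antipode_def endo_def)
  have "S u \<in> K" if u: "u \<in> N" for u
  proof -
    obtain g where g: "g \<in> \<Gamma>0" "u = grp g" using u by blast
    thus ?thesis using subgroup.m_inv_closed[OF \<Gamma>0 g(1)] by (simp add: antipode_grp[OF S] V.span_base)
  qed
  thus "S ` K \<subseteq> K" using K_map[OF S_endo] by blast
qed

text \<open>Every axiom is linear in the arguments from \<open>K\<close>, hence has to be checked on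
  group-likes only. There the axioms say that \<gamma>(g) is multiplicative and unital, that
  \<gamma> turns products into convolution, and that the commutation rule holds.\<close>

lemma relative_r_form: "relative_r_form H K rform"
  unfolding relative_r_form_def
proof (intro conjI ballI allI impI K_hopf_subalgebra)
  note intros = mul_linear_intros rform_form form_comp[OF rform_form(1)] form_comp[OF rform_form(2)]
  note F = vector_space_field
  show "bilin (space H) (smul H) K (smul H) (*) rform"
    by (intro bilinI linI)
      (simp_all add: lin_add[OF rform_form(1)] lin_scale[OF rform_form(1)]
        lin_add[OF rform_form(2)] lin_scale[OF rform_form(2)] K_space)
  have bil: "bilin (space H) (smul H) (space H) (smul H) (*) (\<lambda>k1 k2. rform h' k1 * rform h k2)" for h h'
    by (intro bilinI intros)
  {
    fix h h' k u assume h: "h \<in> space H" and h': "h' \<in> space H" and k: "k \<in> K"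
      and u: "keys u \<subseteq> K \<times> K \<and> comul H k \<approx>\<^bsub>H\<^esub> u"
    have "rform (mul H h h') k = swk k (\<lambda>k1 k2. rform h' k1 * rform h k2)"
    proof (rule K_eq[OF rform_form(1) sw_arg_lin[OF F bil] _ k])
      fix v assume v: "v \<in> N"
      then obtain g where g: "g \<in> \<Gamma>0" "v = grp g" by blast
      show "rform (mul H h h') v = swk v (\<lambda>k1 k2. rform h' k1 * rform h k2)"
        by (simp add: Zt.sw_N[OF F v bil]) (simp add: g rform_grp gamma_mul h h')
    qed
    \<comment> \<open>The expansion \<open>u\<close> equals the coproduct as a tensor over the whole
      bosonization. Since \<open>rform\<close> is bilinear there and not only on \<open>K\<close>,
      either of them may be evaluated.\<close>
    also have "\<dots> = lsum (*) u (\<lambda>(k1, k2). rform h' k1 * rform h k2)"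
      using u bil by (simp add: tens_eq_def sw_def)
    finally show "rform (mul H h h') k = lsum (*) u (\<lambda>(k1, k2). rform h' k1 * rform h k2)" .
  next
    fix h k k' assume h: "h \<in> space H" and k: "k \<in> K" and k': "k' \<in> K"
    show "rform h (mul H k k') = swk h (\<lambda>h1 h2. rform h1 k * rform h2 k')"
    proof (rule K_eq[where f = "\<lambda>k. rform h (mul H k k')" and r = "(*)"
          and g = "\<lambda>k. swk h (\<lambda>h1 h2. rform h1 k * rform h2 k')"])
      fix u assume u: "u \<in> N"
      show "rform h (mul H u k') = swk h (\<lambda>h1 h2. rform h1 u * rform h2 k')"
      proof (rule K_eq[where f = "\<lambda>k'. rform h (mul H u k')" and r = "(*)"
          and g = "\<lambda>k'. swk h (\<lambda>h1 h2. rform h1 u * rform h2 k')"])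
        fix v assume "v \<in> N"
        then obtain g' where g': "g' \<in> \<Gamma>0" "v = grp g'" by blast
        obtain g where g: "g \<in> \<Gamma>0" "u = grp g" using u by blast
        show "rform h (mul H u v) = swk h (\<lambda>h1 h2. rform h1 u * rform h2 v)"
          by (simp add: g g' grp_mul \<Gamma>0_closed rform_grp gamma_conv h)
      qed (intro intros h k' Zt.N_space u; assumption?)+
    qed (intro intros h k K_space k'; assumption?)+
  next
    fix h assume h: "h \<in> space H"
    show "rform h (unt H) = counit H h"
      using Zt.\<gamma>_one[OF h] by (simp add: H_unt rform_grp \<gamma>H_grp)
  next
    fix k assume k: "k \<in> K"
    show "rform (unt H) k = counit H k"
    proof (rule K_eq[OF rform_form(1) counit_lin _ k])
      fix u assume u: "u \<in> N"
      then obtain g where g: "g \<in> \<Gamma>0" "u = grp g" by blast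
      show "rform (unt H) u = counit H u"
        using Zt.\<gamma>_unt[OF u] Zt.N_counit[OF u] by (simp add: g rform_grp \<gamma>H_grp \<Gamma>0_closed)
    qed
  next
    fix h k u assume h: "h \<in> space H" and k: "k \<in> K"
      and u: "keys u \<subseteq> K \<times> K \<and> comul H k \<approx>\<^bsub>H\<^esub> u"
    have bl: "bilin (space H) (smul H) (space H) (smul H) (smul H) (\<lambda>k1 k2. smul H (rform h1 k1) (mul H h2 k2))"
      and br: "bilin (space H) (smul H) (space H) (smul H) (smul H) (\<lambda>k1 k2. smul H (rform h2 k2) (mul H k1 h1))"
      if "h1 \<in> space H" "h2 \<in> space H" for h1 h2
      by (intro bilinI endo_lin intros that mul_closed; assumption)+
    have "swH h (\<lambda>h1 h2. lsum (smul H) u (\<lambda>(k1, k2). smul H (rform h1 k1) (mul H h2 k2))) =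
        swH h (\<lambda>h1 h2. swH k (\<lambda>k1 k2. smul H (rform h1 k1) (mul H h2 k2)))"
      by (rule sw_cong[OF h]) (simp add: sw_def V.tens_eq_lsum[OF conjunct2[OF u] bl])
    also have "\<dots> = swH h (\<lambda>h1 h2. swH k (\<lambda>k1 k2. smul H (rform h2 k2) (mul H k1 h1)))"
    proof (rule K_eq[where f = "\<lambda>k. swH h (\<lambda>h1 h2. swH k (\<lambda>k1 k2. smul H (rform h1 k1) (mul H h2 k2)))"
          and g = "\<lambda>k. swH h (\<lambda>h1 h2. swH k (\<lambda>k1 k2. smul H (rform h2 k2) (mul H k1 h1)))"
          and r = "smul H"])
      fix v assume v: "v \<in> N"
      then obtain g where g: "g \<in> \<Gamma>0" "v = grp g" by blast
      have "swH h (\<lambda>h1 h2. swH v (\<lambda>k1 k2. smul H (rform h1 k1) (mul H h2 k2))) =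
          swH h (\<lambda>h1 h2. smul H (\<gamma> g h1) (mul H h2 (grp g)))"
        by (rule sw_cong[OF h]) (simp add: Zt.sw_N[OF H_vs v bl], simp add: g rform_grp)
      also have "\<dots> = swH h (\<lambda>h1 h2. smul H (\<gamma> g h2) (mul H (grp g) h1))"
        by (rule gamma_comm[OF g(1) h])
      also have "\<dots> = swH h (\<lambda>h1 h2. swH v (\<lambda>k1 k2. smul H (rform h2 k2) (mul H k1 h1)))"
        by (rule sw_cong[OF h]) (simp add: Zt.sw_N[OF H_vs v br], simp add: g rform_grp)
      finally show "swH h (\<lambda>h1 h2. swH v (\<lambda>k1 k2. smul H (rform h1 k1) (mul H h2 k2))) =
          swH h (\<lambda>h1 h2. swH v (\<lambda>k1 k2. smul H (rform h2 k2) (mul H k1 h1)))" .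
    qed (intro endo_lin intros h k mul_closed; assumption?)+
    also have "\<dots> = swH h (\<lambda>h1 h2. lsum (smul H) u (\<lambda>(k1, k2). smul H (rform h2 k2) (mul H k1 h1)))"
      by (rule sw_cong[OF h]) (simp add: sw_def V.tens_eq_lsum[OF conjunct2[OF u] br])
    finally show "swH h (\<lambda>h1 h2. lsum (smul H) u (\<lambda>(k1, k2). smul H (rform h1 k1) (mul H h2 k2))) =
        swH h (\<lambda>h1 h2. lsum (smul H) u (\<lambda>(k1, k2). smul H (rform h2 k2) (mul H k1 h1)))" .
  }
qed

end

section \<open>Pre-Nichols algebras\<close>

text \<open>The Yetter-Drinfeld condition gives g x_i the degree g g_i inv(g). This vector is
  nonzero, and a combination of the x_j has components only in the degrees g_j; so conjugation maps
  the set of the g_j into itself.\<close>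

lemma normal_generate_degrees:
  assumes \<Gamma>: "group \<Gamma>" and yd: "yd_module \<Gamma> UNIV s a coactV"
    and indep: "\<not> module.dependent s (x ` I)" and span: "module.span s (x ` I) = UNIV"
    and gd: "\<And>i. i \<in> I \<Longrightarrow> gd i \<in> carrier \<Gamma> \<and> coactV (x i) = single (gd i) (x i)"
  shows "generate \<Gamma> (gd ` I) \<lhd> \<Gamma>"
proof -
  interpret \<Gamma>: group \<Gamma> by (rule \<Gamma>)
  have vec: "vec_sp UNIV s" using yd by (simp add: yd_module_def)
  interpret V: vector_space s using vec by (simp add: vec_sp_def)
  have coact_lin: "lin UNIV s s (\<lambda>v. lookup (coactV v) u)" for u
    using yd by (simp add: yd_module_def)
  have act_lin: "lin UNIV s s (a g)" if "g \<in> carrier \<Gamma>" for g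
    using yd that by (simp add: yd_module_def)
  have act_one: "a \<one>\<^bsub>\<Gamma>\<^esub> v = v" for v using yd by (simp add: yd_module_def)
  have act_mult: "a (g \<otimes>\<^bsub>\<Gamma>\<^esub> h) v = a g (a h v)" if "g \<in> carrier \<Gamma>" "h \<in> carrier \<Gamma>" for g h v
    using yd that by (simp add: yd_module_def)
  have coact_act: "lookup (coactV (a h v)) (h \<otimes>\<^bsub>\<Gamma>\<^esub> g \<otimes>\<^bsub>\<Gamma>\<^esub> inv\<^bsub>\<Gamma>\<^esub> h) = a h (lookup (coactV v) g)"
    if "g \<in> carrier \<Gamma>" "h \<in> carrier \<Gamma>" for g h v
    using yd that unfolding yd_module_def by blast
  show ?thesis
  proof (rule \<Gamma>.normal_generateI)
    show "gd ` I \<subseteq> carrier \<Gamma>" using gd by blast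
    fix h g assume "h \<in> gd ` I" and g: "g \<in> carrier \<Gamma>"
    then obtain i where i: "i \<in> I" "h = gd i" by blast
    define u where "u = g \<otimes>\<^bsub>\<Gamma>\<^esub> h \<otimes>\<^bsub>\<Gamma>\<^esub> inv\<^bsub>\<Gamma>\<^esub> g"
    have hS: "h \<in> carrier \<Gamma>" using gd i by blast
    have "x i \<noteq> 0" using indep V.dependent_zero[of "x ` I"] i by (metis imageI)
    moreover have "a (inv\<^bsub>\<Gamma>\<^esub> g) (a g (x i)) = x i"
      using act_mult[of "inv\<^bsub>\<Gamma>\<^esub> g" g "x i"] g by (simp add: act_one)
    moreover have "a (inv\<^bsub>\<Gamma>\<^esub> g) 0 = 0" using g by (intro lin_zero[OF act_lin]) simp_all
    ultimately have nz: "a g (x i) \<noteq> 0" by metis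
    have lu: "lookup (coactV (a g (x i))) u = a g (x i)"
      unfolding u_def using coact_act[OF hS g, of "x i"] gd[OF i(1)] i by simp
    show "g \<otimes>\<^bsub>\<Gamma>\<^esub> h \<otimes>\<^bsub>\<Gamma>\<^esub> inv\<^bsub>\<Gamma>\<^esub> g \<in> gd ` I"
    proof (rule ccontr)
      assume "g \<otimes>\<^bsub>\<Gamma>\<^esub> h \<otimes>\<^bsub>\<Gamma>\<^esub> inv\<^bsub>\<Gamma>\<^esub> g \<notin> gd ` I"
      hence u: "u \<notin> gd ` I" by (simp add: u_def)
      have "a g (x i) \<in> V.span (x ` I)" by (simp add: span)
      hence "lookup (coactV (a g (x i))) u = 0"
      proof (induction rule: V.span_induct_alt)
        case base show ?case by (rule lin_zero[OF coact_lin]) simp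
      next
        case (step c y z)
        then obtain j where "j \<in> I" "y = x j" by blast
        hence "lookup (coactV y) u = 0" using gd u by (auto simp: lookup_single when_def)
        thus ?case using step by (simp add: lin_add[OF coact_lin] lin_scale[OF coact_lin])
      qed
      thus False using nz lu by simp
    qed
  qed
qed

section \<open>Words in the tensor algebra and their images in a pre-Nichols algebra\<close>

lemma word_deg_generate: "set w \<subseteq> I \<Longrightarrow> word_deg \<Gamma> gd w \<in> generate \<Gamma> (gd ` I)"
  by (induction w) (auto intro: generate.one generate.eng generate.incl)

lemma word_deg_closed:
  assumes "group \<Gamma>" "\<And>i. i \<in> I \<Longrightarrow> gd i \<in> carrier \<Gamma>" "set w \<subseteq> I"
  shows "word_deg \<Gamma> gd w \<in> carrier \<Gamma>"
proof -
  interpret \<Gamma>: group \<Gamma> by (rule assms(1))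
  show ?thesis using assms(3) by (induction w) (auto intro: assms(2))
qed

lemma tmul_single: "tmul (single v c) (single w d) = single (v @ w) (c * d)"
  by (simp add: tmul_def)

lemma vec_sp_keys: "vec_sp {t. \<forall>w\<in>keys t. R w} (fscale :: 'k::field \<Rightarrow> _)"
proof -
  interpret F: vector_space "fscale :: 'k \<Rightarrow> ('x \<Rightarrow>\<^sub>0 'k) \<Rightarrow> _" by (rule vector_space_fscale)
  show ?thesis
    unfolding vec_sp_def F.subspace_def
    by (auto simp: vector_space_fscale dest!: subsetD[OF Poly_Mapping.keys_add] subsetD[OF keys_fscale])
qed

lemma tvec_scaled_basis:
  assumes V: "vector_space s" and inj: "inj_on x {1..\<theta>}" and indep: "\<not> module.dependent s (x ` {1..\<theta>})"
    and i: "i \<in> {1..\<theta>}"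
  shows "tvec s \<theta> x (s c (x i)) = single [i] c"
proof -
  interpret V: vector_space s by (rule V)
  have rep: "V.representation (x ` {1..\<theta>}) (s c (x i)) (x j) = (if j = i then c else 0)" if "j \<in> {1..\<theta>}" for j
    using V.representation_scale[OF indep V.span_base, of "x i" c] V.representation_basis[OF indep, of "x i"]
      i that inj_onD[OF inj, of j i] by auto
  have "tvec s \<theta> x (s c (x i)) = (\<Sum>j\<in>{1..\<theta>}. if j = i then single [i] c else 0)"
    unfolding tvec_def
  proof (rule sum.cong[OF refl])
    fix j assume j: "j \<in> {1..\<theta>}"
    show "single [j] (V.representation (x ` {1..\<theta>}) (s c (x i)) (x j)) = (if j = i then single [i] c else 0)"
      unfolding rep[OF j] by simp
  qed
  thus ?thesis using i by simp
qed

text \<open>Each letter i contributes the scalar \<chi>(g_i), and multiplicativity of \<chi>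
  collects these scalars into its value at the degree of the word.\<close>

lemma word_act_diagonal:
  assumes V: "vector_space s" and inj: "inj_on x {1..\<theta>}" and indep: "\<not> module.dependent s (x ` {1..\<theta>})"
    and \<Gamma>: "group \<Gamma>" and gd: "\<And>i. i \<in> {1..\<theta>} \<Longrightarrow> gd i \<in> carrier \<Gamma>"
    and \<chi>_one: "\<chi> \<one>\<^bsub>\<Gamma>\<^esub> = 1"
    and \<chi>_mult: "\<And>h k. h \<in> carrier \<Gamma> \<Longrightarrow> k \<in> carrier \<Gamma> \<Longrightarrow> \<chi> (h \<otimes>\<^bsub>\<Gamma>\<^esub> k) = \<chi> h * \<chi> k"
    and act: "\<And>i. i \<in> {1..\<theta>} \<Longrightarrow> a g (x i) = s (\<chi> (gd i)) (x i)"
  shows "set w \<subseteq> {1..\<theta>} \<Longrightarrow> word_act s a \<theta> x g w = single w (\<chi> (word_deg \<Gamma> gd w))"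
proof (induction w)
  case (Cons i w)
  interpret \<Gamma>: group \<Gamma> by (rule \<Gamma>)
  have "word_deg \<Gamma> gd w \<in> carrier \<Gamma>"
    by (rule word_deg_closed[where I = "{1..\<theta>}", OF \<Gamma> gd]) (use Cons.prems in auto)
  moreover have i: "i \<in> {1..\<theta>}" using Cons.prems by simp
  ultimately show ?case
    using Cons by (simp add: act[OF i] tvec_scaled_basis[OF V inj indep i] tmul_single \<chi>_mult gd[OF i])
qed (simp add: \<chi>_one)

text \<open>The projection p is colinear and words are homogeneous for the coaction, so the coaction
  of b can be computed on a preimage in the tensor algebra.\<close>

lemma pre_nichols_coact:
  fixes B :: "('k::field, 'b::ab_group_add, 'g) yd_hopf_data"
  assumes pn: "pre_nichols \<Gamma> s a \<theta> x gd B p" and b: "b \<in> space B"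
  obtains t where "\<forall>w\<in>keys t. set w \<subseteq> {1..\<theta>}" "b = p t"
    "\<And>u. u \<in> carrier \<Gamma> \<Longrightarrow> lookup (coact B b) u =
      (\<Sum>w\<in>keys t. if word_deg \<Gamma> gd w = u then p (single w (lookup t w)) else 0)"
proof -
  let ?T = "tensor_algebra \<Gamma> s a \<theta> x gd"
  have map: "yd_hopf_map \<Gamma> ?T B p" and surj: "p ` space ?T = space B"
    using pn by (simp_all add: pre_nichols_def Let_def)
  have p_lin: "lin (space ?T) fscale (smul B) p"
    using map by (simp add: yd_hopf_map_def bialgebra_map_def tensor_algebra_def)
  have T: "space ?T = {t. \<forall>w\<in>keys t. set w \<subseteq> {1..\<theta>}}" by (simp add: tensor_algebra_def)
  have T_vec: "vec_sp (space ?T) fscale" unfolding T by (rule vec_sp_keys)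
  obtain t where t: "t \<in> space ?T" "b = p t" using b surj by blast
  show thesis
  proof (rule that[of t])
    show "\<forall>w\<in>keys t. set w \<subseteq> {1..\<theta>}" using t(1) by (simp add: T)
    show "b = p t" by (rule t(2))
    fix u assume u: "u \<in> carrier \<Gamma>"
    have "lookup (coact B b) u = p (lookup (coact ?T t) u)"
      using map u t by (simp add: yd_hopf_map_def)
    also have "lookup (coact ?T t) u = (\<Sum>w\<in>keys t. if word_deg \<Gamma> gd w = u then single w (lookup t w) else 0)"
      by (simp add: tensor_algebra_def lookup_sum lookup_single when_def)
    also have "p \<dots> = (\<Sum>w\<in>keys t. p (if word_deg \<Gamma> gd w = u then single w (lookup t w) else 0))"
      by (rule lin_sum[OF p_lin T_vec]) (use t(1) in \<open>auto simp: T split: if_splits\<close>)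
    also have "\<dots> = (\<Sum>w\<in>keys t. if word_deg \<Gamma> gd w = u then p (single w (lookup t w)) else 0)"
      using lin_zero[OF p_lin vec_sp_closed(1)[OF T_vec]] by (intro sum.cong) auto
    finally show "lookup (coact B b) u =
        (\<Sum>w\<in>keys t. if word_deg \<Gamma> gd w = u then p (single w (lookup t w)) else 0)" .
  qed
qed

lemma pre_nichols_coact_keys:
  fixes B :: "('k::field, 'b::ab_group_add, 'g) yd_hopf_data"
  assumes "pre_nichols \<Gamma> s a \<theta> x gd B p" "b \<in> space B" "u \<in> keys (coact B b)" "u \<in> carrier \<Gamma>"
  shows "u \<in> generate \<Gamma> (gd ` {1..\<theta>})"
proof -
  obtain t where t: "\<forall>w\<in>keys t. set w \<subseteq> {1..\<theta>}" and co: "\<And>u. u \<in> carrier \<Gamma> \<Longrightarrow>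
      lookup (coact B b) u = (\<Sum>w\<in>keys t. if word_deg \<Gamma> gd w = u then p (single w (lookup t w)) else 0)"
    by (rule pre_nichols_coact[OF assms(1,2)]) (rule that)
  have "\<exists>w\<in>keys t. word_deg \<Gamma> gd w = u"
  proof (rule ccontr)
    assume "\<not> ?thesis"
    hence "lookup (coact B b) u = 0" unfolding co[OF assms(4)] by (intro sum.neutral) auto
    thus False using assms(3) by (simp add: in_keys_iff)
  qed
  thus ?thesis using word_deg_generate t by blast
qed

text \<open>On a word this is the previous diagonal formula; it descends to \<open>B\<close> because
  p is linear, equivariant and colinear.\<close>

lemma pre_nichols_diagonal_act:
  fixes B :: "('k::field, 'b::ab_group_add, 'g) yd_hopf_data"
  assumes pn: "pre_nichols \<Gamma> s a \<theta> x gd B p" and b: "b \<in> space B"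
    and V: "vector_space s" and inj: "inj_on x {1..\<theta>}" and indep: "\<not> module.dependent s (x ` {1..\<theta>})"
    and \<Gamma>: "group \<Gamma>" and gd: "\<And>i. i \<in> {1..\<theta>} \<Longrightarrow> gd i \<in> carrier \<Gamma>" and g: "g \<in> carrier \<Gamma>"
    and \<chi>_one: "\<chi> \<one>\<^bsub>\<Gamma>\<^esub> = 1"
    and \<chi>_mult: "\<And>h k. h \<in> carrier \<Gamma> \<Longrightarrow> k \<in> carrier \<Gamma> \<Longrightarrow> \<chi> (h \<otimes>\<^bsub>\<Gamma>\<^esub> k) = \<chi> h * \<chi> k"
    and act: "\<And>i. i \<in> {1..\<theta>} \<Longrightarrow> a g (x i) = s (\<chi> (gd i)) (x i)"
  shows "act B g b = (\<Sum>u\<in>keys (coact B b). smul B (\<chi> u) (lookup (coact B b) u))"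
proof -
  let ?T = "tensor_algebra \<Gamma> s a \<theta> x gd"
  let ?d = "word_deg \<Gamma> gd"
  interpret \<Gamma>: group \<Gamma> by (rule \<Gamma>)
  have map: "yd_hopf_map \<Gamma> ?T B p" and B: "yd_graded_hopf \<Gamma> B"
    using pn by (simp_all add: pre_nichols_def Let_def)
  have yd: "yd_module \<Gamma> (space B) (smul B) (act B) (coact B)"
    using B by (simp add: yd_graded_hopf_def)
  interpret B: vector_space "smul B" using yd by (simp add: yd_module_def vec_sp_def)
  have p_lin: "lin (space ?T) fscale (smul B) p"
    using map by (simp add: yd_hopf_map_def bialgebra_map_def tensor_algebra_def)
  have T: "space ?T = {t. \<forall>w\<in>keys t. set w \<subseteq> {1..\<theta>}}" by (simp add: tensor_algebra_def)
  have T_vec: "vec_sp (space ?T) fscale" unfolding T by (rule vec_sp_keys)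
  obtain t where t: "\<forall>w\<in>keys t. set w \<subseteq> {1..\<theta>}" "b = p t" and co: "\<And>u. u \<in> carrier \<Gamma> \<Longrightarrow>
      lookup (coact B b) u = (\<Sum>w\<in>keys t. if ?d w = u then p (single w (lookup t w)) else 0)"
    by (rule pre_nichols_coact[OF pn b]) (rule that)
  have d: "?d w \<in> carrier \<Gamma>" if "w \<in> keys t" for w
    by (rule word_deg_closed[where I = "{1..\<theta>}", OF \<Gamma> gd]) (use t(1) that in auto)
  have w: "single w (lookup t w) \<in> space ?T" if "w \<in> keys t" for w using that t(1) by (simp add: T)
  have tT: "t \<in> space ?T" using t(1) by (simp add: T)
  have "act B g b = p (tact s a \<theta> x g t)"
    using map g tT unfolding t(2) by (simp add: yd_hopf_map_def tensor_algebra_def)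
  also have "tact s a \<theta> x g t = (\<Sum>w\<in>keys t. fscale (\<chi> (?d w)) (single w (lookup t w)))"
    unfolding tact_def lsum_def
  proof (rule sum.cong[OF refl])
    fix w assume "w \<in> keys t"
    hence "set w \<subseteq> {1..\<theta>}" using t(1) by blast
    from word_act_diagonal[of s x \<theta> \<Gamma> gd \<chi> a g, OF V inj indep \<Gamma> gd \<chi>_one \<chi>_mult act this]
    show "fscale (lookup t w) (word_act s a \<theta> x g w) = fscale (\<chi> (?d w)) (single w (lookup t w))"
      by (simp add: fscale_single mult.commute)
  qed
  also have "p \<dots> = (\<Sum>w\<in>keys t. smul B (\<chi> (?d w)) (p (single w (lookup t w))))"
    by (subst lin_sum[OF p_lin T_vec]) (auto simp: vec_sp_closed(3)[OF T_vec] w lin_scale[OF p_lin])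
  \<comment> \<open>The words are sorted by degree. Several words may share a degree, and a degree
    of a word may disappear from the coaction in \<open>B\<close>, as p need not be injective; the
    last step therefore shrinks the index set to the support.\<close>
  also have "\<dots> = (\<Sum>w\<in>keys t. \<Sum>u\<in>?d ` keys t. if ?d w = u then smul B (\<chi> u) (p (single w (lookup t w))) else 0)"
    by (rule sum.cong) (simp_all add: sum.delta')
  also have "\<dots> = (\<Sum>u\<in>?d ` keys t. \<Sum>w\<in>keys t. if ?d w = u then smul B (\<chi> u) (p (single w (lookup t w))) else 0)"
    by (rule sum.swap)
  also have "\<dots> = (\<Sum>u\<in>?d ` keys t. smul B (\<chi> u) (lookup (coact B b) u))"
    by (rule sum.cong) (auto simp: co d B.scale_sum_right if_distrib[of "smul B _"] cong: if_cong)
  also have "\<dots> = (\<Sum>u\<in>keys (coact B b). smul B (\<chi> u) (lookup (coact B b) u))"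
  proof (rule sum.mono_neutral_right)
    have "keys (coact B b) \<subseteq> carrier \<Gamma>" using yd b by (simp add: yd_module_def)
    show "keys (coact B b) \<subseteq> ?d ` keys t"
    proof
      fix u assume u: "u \<in> keys (coact B b)"
      show "u \<in> ?d ` keys t"
      proof (rule ccontr)
        assume "u \<notin> ?d ` keys t"
        hence "lookup (coact B b) u = 0"
          using \<open>keys (coact B b) \<subseteq> carrier \<Gamma>\<close> u by (subst co) (auto intro!: sum.neutral)
        thus False using u by (simp add: in_keys_iff)
      qed
    qed
  qed (auto simp: in_keys_iff)
  finally show ?thesis .
qed

text \<open>\<open>zesting\<close> constrains \<open>m\<close> and \<open>\<Omega>\<close> on the
  carrier only, so they are not unique as functions. Hence existence of a zested structure and the
  properties of every such structure are separate conclusions.\<close>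

theorem theorem4p4:
  fixes \<Gamma> :: "('g, 'm) monoid_scheme" and G :: "('s, 'n) monoid_scheme"
    and sV :: "'k::field \<Rightarrow> 'v::ab_group_add \<Rightarrow> 'v"
    and actV :: "'g \<Rightarrow> 'v \<Rightarrow> 'v" and coactV :: "'v \<Rightarrow> ('g \<Rightarrow>\<^sub>0 'v)"
    and \<theta> :: nat and x :: "nat \<Rightarrow> 'v" and gd :: "nat \<Rightarrow> 'g"
    and B :: "('k, 'b::ab_group_add, 'g) yd_hopf_data" and p :: "(nat list \<Rightarrow>\<^sub>0 'k) \<Rightarrow> 'b"
    and H :: "('k, 'g \<Rightarrow>\<^sub>0 'b) hopf_data"
    and supp :: "'g set" and \<iota>q :: "'g set \<Rightarrow> 's" and \<iota> :: "'g \<Rightarrow> 's"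
    and \<Gamma>0 :: "'g set" and \<Phi> :: "'g \<Rightarrow> 'g \<Rightarrow> 'k"
    and lam :: "'s \<Rightarrow> 's \<Rightarrow> 'g" and \<omega> :: "'s \<Rightarrow> 's \<Rightarrow> 's \<Rightarrow> 'k"
    and \<gamma> :: "'g \<Rightarrow> ('g \<Rightarrow>\<^sub>0 'b) \<Rightarrow> 'k"
  assumes "group \<Gamma>"
    and "yd_module \<Gamma> UNIV sV actV coactV"
    and "inj_on x {1..\<theta>}" and "\<not> module.dependent sV (x ` {1..\<theta>})"
    and "module.span sV (x ` {1..\<theta>}) = UNIV"
    and "\<And>i. i \<in> {1..\<theta>} \<Longrightarrow> gd i \<in> carrier \<Gamma> \<and> coactV (x i) = single (gd i) (x i)"
    and "pre_nichols \<Gamma> sV actV \<theta> x gd B p"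
    and "H = bosonization \<Gamma> B" and "hopf_algebra H" and "pointed H"
    and "supp = generate \<Gamma> (gd ` {1..\<theta>})"
    and "group G" and "\<iota>q \<in> hom (\<Gamma> Mod supp) G" and "\<iota>q ` carrier (\<Gamma> Mod supp) = carrier G"
    and "\<And>g. \<iota> g = \<iota>q (supp #>\<^bsub>\<Gamma>\<^esub> g)"
    and "subgroup \<Gamma>0 \<Gamma>" and "\<Gamma>0 \<subseteq> kernel \<Gamma> G \<iota>"
    and "\<And>g h. g \<in> \<Gamma>0 \<Longrightarrow> h \<in> carrier \<Gamma> \<Longrightarrow> g \<otimes>\<^bsub>\<Gamma>\<^esub> h = h \<otimes>\<^bsub>\<Gamma>\<^esub> g"
    and "\<Phi> \<in> hom (\<Gamma>\<lparr>carrier := \<Gamma>0\<rparr>) (char_group \<Gamma>)"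
    and "\<And>g i. g \<in> \<Gamma>0 \<Longrightarrow> i \<in> {1..\<theta>} \<Longrightarrow> actV g (x i) = sV (\<Phi> g (gd i)) (x i)"
    and "\<gamma> = boson_gamma B \<Phi>"
    and "normalized_2cocycle G \<Gamma> \<Gamma>0 lam"
    and "normalized_3cochain G \<omega>"
    and "\<And>g1 g2 g3 g4. g1 \<in> carrier G \<Longrightarrow> g2 \<in> carrier G \<Longrightarrow> g3 \<in> carrier G \<Longrightarrow> g4 \<in> carrier G \<Longrightarrow>
      \<gamma> (lam g1 g2) (grp_emb B (lam g3 g4)) =
        (\<omega> g1 g2 g3 * \<omega> g1 (g2 \<otimes>\<^bsub>G\<^esub> g3) g4 * \<omega> g2 g3 g4) /
        (\<omega> (g1 \<otimes>\<^bsub>G\<^esub> g2) g3 g4 * \<omega> g1 g2 (g3 \<otimes>\<^bsub>G\<^esub> g4))"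
  shows "cocentral_epi H G (boson_pi B \<iota>) \<and>
    (\<exists>r. relative_r_form H (module.span (smul H) (grp_emb B ` \<Gamma>0)) r \<and>
       (\<forall>h\<in>space H. \<forall>g\<in>\<Gamma>0. r h (grp_emb B g) = \<gamma> g h)) \<and>
    zesting_datum H G (boson_pi B \<iota>) (grp_emb B ` \<Gamma>0) (boson_gamma_H \<Gamma> B \<Phi>)
      (\<lambda>a b. grp_emb B (lam a b)) \<omega> \<and>
    (\<exists>m \<Omega>. zesting H G (boson_pi B \<iota>) (boson_gamma_H \<Gamma> B \<Phi>)
       (\<lambda>a b. grp_emb B (lam a b)) \<omega> m \<Omega>) \<and>
    (\<forall>m \<Omega>. zesting H G (boson_pi B \<iota>) (boson_gamma_H \<Gamma> B \<Phi>)
       (\<lambda>a b. grp_emb B (lam a b)) \<omega> m \<Omega> \<longrightarrow>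
       coquasi_hopf (H\<lparr>mul := m\<rparr>) \<Omega> \<and>
       (\<forall>y\<in>space B. \<forall>z\<in>space B. \<forall>g\<in>carrier \<Gamma>. \<forall>h\<in>carrier \<Gamma>.
          m (y #\<^sub>b g) (z #\<^sub>b h) =
            mul B y (act B g z) #\<^sub>b (g \<otimes>\<^bsub>\<Gamma>\<^esub> h \<otimes>\<^bsub>\<Gamma>\<^esub> lam (\<iota> g) (\<iota> h))) \<and>
       (\<forall>w\<in>space B. \<forall>y\<in>space B. \<forall>z\<in>space B. \<forall>g\<in>carrier \<Gamma>. \<forall>h\<in>carrier \<Gamma>. \<forall>k\<in>carrier \<Gamma>.
          \<Omega> (w #\<^sub>b g) (y #\<^sub>b h) (z #\<^sub>b k) =
            counit B w * counit B y * counit B z * \<omega> (\<iota> g) (\<iota> h) (\<iota> k) *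
            \<gamma> (lam (\<iota> g) (\<iota> h)) (grp_emb B k)))"
proof -
  interpret \<Gamma>: group \<Gamma> by (rule assms(1))
  interpret G: group G by (rule assms(12))
  have V: "vector_space sV" using assms(2) by (simp add: yd_module_def vec_sp_def)
  have gd: "gd i \<in> carrier \<Gamma>" if "i \<in> {1..\<theta>}" for i using assms(6)[OF that] by simp
  have B: "yd_graded_hopf \<Gamma> B" using assms(7) by (simp add: pre_nichols_def Let_def)
  \<comment> \<open>Makes \<open>\<Gamma> Mod supp\<close> a group and the coset map multiplicative,
    so that \<iota> is a homomorphism on \<Gamma>.\<close>
  have normal: "supp \<lhd> \<Gamma>"
    unfolding assms(11) by (rule normal_generate_degrees[OF assms(1,2,4,5,6)])
  interpret S: normal supp \<Gamma> by (rule normal)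
  have \<iota>_hom: "\<iota> \<in> hom \<Gamma> G"
  proof (rule homI)
    fix g h assume g: "g \<in> carrier \<Gamma>" and h: "h \<in> carrier \<Gamma>"
    hence c: "supp #>\<^bsub>\<Gamma>\<^esub> g \<in> carrier (\<Gamma> Mod supp)" "supp #>\<^bsub>\<Gamma>\<^esub> h \<in> carrier (\<Gamma> Mod supp)"
      by (auto simp: FactGroup_def RCOSETS_def)
    show "\<iota> g \<in> carrier G" unfolding assms(15) by (rule hom_in_carrier[OF assms(13) c(1)])
    show "\<iota> (g \<otimes>\<^bsub>\<Gamma>\<^esub> h) = \<iota> g \<otimes>\<^bsub>G\<^esub> \<iota> h"
      using hom_mult[OF assms(13) c] S.rcos_sum[OF g h] by (simp add: assms(15) FactGroup_def)
  qed
  have \<iota>_surj: "\<iota> ` carrier \<Gamma> = carrier G"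
  proof -
    have "carrier (\<Gamma> Mod supp) = (\<lambda>g. supp #>\<^bsub>\<Gamma>\<^esub> g) ` carrier \<Gamma>"
      by (auto simp: FactGroup_def RCOSETS_def)
    thus ?thesis unfolding assms(14)[symmetric] by (simp add: image_image assms(15))
  qed
  have \<iota>_supp: "\<iota> u = \<one>\<^bsub>G\<^esub>" if "u \<in> supp" for u
    using hom_one[OF assms(13) S.factorgroup_is_group assms(12)] S.rcos_const[OF assms(1) that]
    by (simp add: assms(15) FactGroup_def)
  have sub: "g \<in> carrier \<Gamma>" if "g \<in> \<Gamma>0" for g using assms(16) that by (rule subgroup.mem_carrier)
  have \<Phi>_char: "\<Phi> g \<in> hom \<Gamma> units_group" if "g \<in> \<Gamma>0" for g
    using hom_in_carrier[OF assms(19), of g] that by (simp add: char_group_def)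
  have \<Phi>_nz: "\<Phi> g h \<noteq> 0" if "g \<in> \<Gamma>0" "h \<in> carrier \<Gamma>" for g h
    using hom_in_carrier[OF \<Phi>_char[OF that(1)] that(2)] by (simp add: units_group_def)
  have \<Phi>_hom: "\<Phi> g (h \<otimes>\<^bsub>\<Gamma>\<^esub> k) = \<Phi> g h * \<Phi> g k" if "g \<in> \<Gamma>0" "h \<in> carrier \<Gamma>" "k \<in> carrier \<Gamma>" for g h k
    using hom_mult[OF \<Phi>_char[OF that(1)] that(2,3)] by (simp add: units_group_def)
  \<comment> \<open>A nonzero idempotent of the field is 1. \<open>\<Phi>_unit\<close> below follows
    in the same way from multiplicativity in the first argument, directly on values instead of
    through a group structure on \<open>char_group\<close>.\<close>
  have \<Phi>_one: "\<Phi> g \<one>\<^bsub>\<Gamma>\<^esub> = 1" if "g \<in> \<Gamma>0" for g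
    using \<Phi>_hom[OF that \<Gamma>.one_closed \<Gamma>.one_closed] \<Phi>_nz[OF that \<Gamma>.one_closed] by simp
  have \<Phi>_mult: "\<Phi> (g \<otimes>\<^bsub>\<Gamma>\<^esub> g') h = \<Phi> g h * \<Phi> g' h" if "g \<in> \<Gamma>0" "g' \<in> \<Gamma>0" "h \<in> carrier \<Gamma>" for g g' h
    using hom_mult[OF assms(19), of g g'] that by (simp add: char_group_def)
  have one0: "\<one>\<^bsub>\<Gamma>\<^esub> \<in> \<Gamma>0" by (rule subgroup.one_closed[OF assms(16)])
  have \<Phi>_unit: "\<Phi> \<one>\<^bsub>\<Gamma>\<^esub> h = 1" if "h \<in> carrier \<Gamma>" for h
    using \<Phi>_mult[OF one0 one0 that] \<Phi>_nz[OF one0 that] by simp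
  have hopf: "hopf_algebra (bosonization \<Gamma> B)" using assms(9) by (simp add: assms(8))
  have coact_keys: "u \<in> carrier \<Gamma>" if "b \<in> space B" "u \<in> keys (coact B b)" for b u
    using boson.coact_keys[OF boson.intro[OF assms(1) B hopf] that] .
  have \<iota>_coact: "\<iota> u = \<one>\<^bsub>G\<^esub>" if "b \<in> space B" "u \<in> keys (coact B b)" for b u
    using pre_nichols_coact_keys[OF assms(7) that coact_keys[OF that]] by (intro \<iota>_supp) (simp add: assms(11))
  have act: "act B g b = (\<Sum>u\<in>keys (coact B b). smul B (\<Phi> g u) (lookup (coact B b) u))"
    if g: "g \<in> \<Gamma>0" and b: "b \<in> space B" for g b
    by (rule pre_nichols_diagonal_act[where \<chi> = "\<Phi> g" and g = g, OF assms(7) b V assms(3,4,1) gd sub[OF g] \<Phi>_one[OF g] \<Phi>_hom[OF g] assms(20)[OF g]])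
  have lam: "lam a b \<in> \<Gamma>0" if "a \<in> carrier G" "b \<in> carrier G" for a b
    using assms(22) that by (simp add: normalized_2cocycle_def)
  interpret bg: boson_graded \<Gamma> B G \<iota>
    by (rule boson_graded.intro[OF boson.intro[OF assms(1) B hopf]
          boson_graded_axioms.intro[OF assms(12) \<iota>_hom \<iota>_surj \<iota>_coact]])
  have \<omega>_lam: "\<Phi> (lam a b) (lam c d) =
      (\<omega> a b c * \<omega> a (b \<otimes>\<^bsub>G\<^esub> c) d * \<omega> b c d) / (\<omega> (a \<otimes>\<^bsub>G\<^esub> b) c d * \<omega> a b (c \<otimes>\<^bsub>G\<^esub> d))"
    if "a \<in> carrier G" "b \<in> carrier G" "c \<in> carrier G" "d \<in> carrier G" for a b c d
    using assms(24)[OF that] bg.B_unt_nonzero by (simp add: assms(21) boson_gamma_def bg.B_counit_unt)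
  interpret bz: boson_zesting \<Gamma> B G \<iota> \<Gamma>0 \<Phi> lam \<omega>
  proof (rule boson_zesting.intro[OF bg.boson_graded_axioms boson_zesting_axioms.intro])
    show "\<iota> g = \<one>\<^bsub>G\<^esub>" if "g \<in> \<Gamma>0" for g using assms(17) that by (auto simp: kernel_def)
  qed (fact assms(16,18,22,23) \<Phi>_hom \<Phi>_one \<Phi>_mult \<Phi>_unit act \<omega>_lam)+
  show ?thesis
    unfolding assms(8) assms(21)
  proof (intro conjI allI impI ballI)
    show "\<exists>r. relative_r_form (bosonization \<Gamma> B)
        (module.span (smul (bosonization \<Gamma> B)) (grp_emb B ` \<Gamma>0)) r \<and>
      (\<forall>h\<in>space (bosonization \<Gamma> B). \<forall>g\<in>\<Gamma>0. r h (grp_emb B g) = boson_gamma B \<Phi> g h)"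
      using bz.relative_r_form bz.rform_grp by blast
  qed (fact bg.cocentral bz.zesting_datum bz.zesting_exists
    | (rule bz.zesting_coquasi_hopf bz.zesting_mul_single bz.zesting_assoc_single; assumption))+
qed

end
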